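(* Let $p$ be a prime, $q=p^m$, and let $\mathbb{F}_q$ be the finite field with $q$ elements. Let $A$ be any subset of $\mathbb{F}_q$ satisfying $|A/A| \approx |A|$. Fix $\delta \leq 1/33$. There exists an absolute constant $\lambda > 0$ such that if $$|A \cap cG| \leq \lambda |A|^{1 - \delta}$$ for all proper subfields $G$ of $\mathbb{F}_q$ and elements $c\in \mathbb{F}_q$, then $$E_{+}(A) < \max \bigg\{ |A|^{3-\delta}, \frac{|A|^{3 + 1/33}}{q^{1/33}} \bigg\}.$$ Moreover, if for all proper subfields $G$ of $\mathbb{F}_q$ and elements $c\in\mathbb{F}_q$ the set $A$ satisfies $$|A \cap cG| \ll |G|^{1/2},$$ then the same estimate holds with $\delta = 1/33$, that is, $$E_{+}(A) < \max \bigg\{ |A|^{3-1/33}, \frac{|A|^{3 + 1/33}}{q^{1/33}} \bigg\}.$$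
   Context: For $A\subset\mathbb{F}_q$, the ratio set is $A/A=\{a/b: a,b\in A,\ b\neq 0\}$, and $cG=\{cg: g\in G\}$. The additive energy of $A$ is $E_{+}(A) = |\{(a_1,a_2,b_1,b_2)\in A^4 : a_1+b_1=a_2+b_2\}|$. For positive real numbers $X$ and $Y$, $X \ll Y$ (equivalently $Y\gg X$) means that there exists an absolute constant $c>0$ such that $X\leq cY$; $X\approx Y$ means that both $X\ll Y$ and $Y\ll X$ hold.
   Formalization: The printed bound "E_+(A) < max{...}" is false (A = F_p gives E_+(A) = p^3 = max for 0 ≤ δ ≤ 1/33); it is proved as E_+(A) < C·max{...}, with C depending only on the implied constants in |A/A| ≈ |A| and |A ∩ cG| ≪ |G|^{1/2}. *)

theory Defs
  imports Complex_Main "HOL-Algebra.Algebra"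
begin

definition ratio_set :: "('a, 'm) ring_scheme \<Rightarrow> 'a set \<Rightarrow> 'a set" where
  "ratio_set F A = {a \<otimes>\<^bsub>F\<^esub> inv\<^bsub>F\<^esub> b | a b. a \<in> A \<and> b \<in> A \<and> b \<noteq> \<zero>\<^bsub>F\<^esub>}"

definition additive_energy :: "('a, 'm) ring_scheme \<Rightarrow> 'a set \<Rightarrow> nat" where
  "additive_energy F A =
     card {(a1, a2, b1, b2). a1 \<in> A \<and> a2 \<in> A \<and> b1 \<in> A \<and> b2 \<in> A \<and>
                             a1 \<oplus>\<^bsub>F\<^esub> b1 = a2 \<oplus>\<^bsub>F\<^esub> b2}"

definition proper_subfield :: "'a set \<Rightarrow> ('a, 'm) ring_scheme \<Rightarrow> bool" where
  "proper_subfield G F \<longleftrightarrow> subfield G F \<and> G \<noteq> carrier F"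

(* x and y are comparable up to the constant K.  The constant is an argument so that its place
   in the quantifier order stays visible; positivity of x and y belongs to the notation and
   here rules out A = {} and A = {0}. *)
definition approx_with :: "real \<Rightarrow> real \<Rightarrow> real \<Rightarrow> bool" where
  "approx_with K x y \<longleftrightarrow> 0 < x \<and> 0 < y \<and> x \<le> K * y \<and> y \<le> K * x"

(* Finite fields are structures rather than types of class field: absolute constants must be
   chosen before the field, and types cannot be quantified inside a formula.  Every finite
   field has an isomorphic copy with carrier in nat, so a statement of the form
   "there is c such that for all fields F :: 'a ring ..." with 'a arbitrary gives, at 'a = nat,
   one constant c for all finite fields. *)
definition finite_field_of_order :: "('a, 'm) ring_scheme \<Rightarrow> nat \<Rightarrow> bool" where
  "finite_field_of_order F q \<longleftrightarrow> field F \<and> finite (carrier F) \<and> card (carrier F) = q"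

end

theory Submission
  imports Defs
begin

text \<open>
Write \<open>N = |A|\<close> and \<open>E\<^sub>+(A) = N\<^sup>3 / M\<close>. The heart of the proof is \<open>energy_alternatives\<close>: up to
constants that depend on \<open>K\<close>, either \<open>N \<le> M ^ 33\<close>, or \<open>q \<le> M ^ 33 N\<close>, or some dilate \<open>c G\<close> of a proper
subfield satisfies \<open>|A \<inter> c G| \<ge> N / M\<close> and \<open>|G| \<le> M ^ 32 |A \<inter> c G|\<close>. If the claimed energy bound fails with a
large constant, then \<open>M\<close> is so small compared with \<open>N\<close> and \<open>q\<close> that the first two alternatives are impossible,
and each of the two hypotheses on intersections with dilates of subfields excludes the third one.

\<^bold>\<open>A structure with many dilation-invariant popular differences.\<close> Put \<open>H = A/A\<close>. By Pluennecke's inequality in the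
multiplicative group, all powers \<open>H\<^sup>n\<close> with bounded \<open>n\<close> have size comparable to \<open>N\<close>, so \<open>A\<close> behaves like a
multiplicative subgroup. Let \<open>S\<^sub>n\<close> be the set of \<open>s\<close> with at least \<open>\<theta>\<close> representations \<open>s = x - y\<close> in \<open>H\<^sup>n\<close>.
Dilating a representation shows \<open>H\<^sup>k S\<^sub>n \<subseteq> S\<^bsub>n+k\<^esub>\<close>. The energy of \<open>A\<close> makes \<open>S\<^sub>1\<close> large at a
suitable level \<open>\<theta>\<close> (\<open>exists_energy_level\<close>), while all \<open>S\<^sub>n\<close> are trivially at most a constant times \<open>M |S\<^sub>1|\<close>; hence
among the twelve scales \<open>n = 6 ^ j\<close>, \<open>j < 12\<close>, there is one at which passing from \<open>n\<close> to \<open>6 n\<close> enlarges the popular set by at most a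
factor of order \<open>M\<close> to the power \<open>1/12\<close> (\<open>exists_small_ratio\<close>). A vertex \<open>x\<^sub>0\<close> of large degree in the graph of
popular differences on \<open>H\<^sup>n\<close> gives a set \<open>T = {y / x\<^sub>0}\<close> with \<open>t u (1 - v)\<close> popular at scale \<open>6 n\<close> for all
\<open>t, u, v\<close> in \<open>T\<close> (\<open>exists_neighbourhood\<close>).

\<^bold>\<open>Differences of dilates are few.\<close> Since \<open>|T/T|\<close> is at most a constant times \<open>N\<close>, most pairs of elements of \<open>T\<close>
have a popular quotient. So for a large \<open>B \<subseteq> T\<close> and \<open>a, b \<in> B\<close> the sets \<open>a T\<close> and \<open>b T\<close> meet often, and through a common element
\<open>z\<close> every \<open>b x - a y = (b x - z) - (a y - z)\<close> is a combination of four popular differences in many ways. This bounds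
\<open>|b B - a B|\<close> (\<open>dilate_differences\<close>). After division by \<open>a\<close> one has \<open>1 \<in> B\<close> and \<open>|b B - B| \<le> \<kappa> |B|\<close> for all
\<open>b \<in> B\<close>, where \<open>\<kappa>\<^sup>3\<close> is at most a constant times \<open>M ^ 16\<close> and \<open>|B|\<close> is at least a constant times \<open>N / M\<close>.

\<^bold>\<open>Growth or a subfield.\<close> Let \<open>Q = (B - B)/(B - B)\<close>. For \<open>\<xi> \<notin> Q\<close> all elements \<open>x - \<xi> y\<close> with \<open>x, y \<in> B\<close> are
distinct. If \<open>Q\<close> is not closed under multiplication by \<open>B\<close> or under adding \<open>1\<close>, there is such a \<open>\<xi>\<close> for which
Pluennecke's inequality bounds the number of these elements by \<open>(4 \<kappa>) ^ 6 |B|\<close>, and therefore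
\<open>|B| \<le> (4 \<kappa>) ^ 6\<close>; this is the first alternative, and \<open>33 = 1 + 2 * 16\<close>. Otherwise \<open>Q\<close> is a subfield
(\<open>stable_subset_is_subfield\<close>) that contains \<open>B\<close>, and the average of \<open>|B - \<xi> B|\<close> over \<open>\<xi> \<in> Q\<close> shows that
\<open>|Q|\<close> is at most \<open>2 (4 \<kappa>) ^ 4 |B|\<close>, unless \<open>B\<close> is small again (\<open>small_or_subfield\<close>). If \<open>Q\<close> is the whole field this is the second alternative. If \<open>Q\<close>
is proper, then \<open>B \<subseteq> Q\<close> consists of products of boundedly many elements of \<open>A\<close> and their inverses, so a
multiplicative pigeonhole argument finds a dilate of \<open>Q\<close> that contains at least a constant times \<open>|B|\<close> elements of \<open>A\<close>
(\<open>card_le_coset_intersection\<close>).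
\<close>

section \<open>Sumsets in commutative groups\<close>

lemma set_mult_eq_image: "A <#>\<^bsub>G\<^esub> B = (\<lambda>(a, b). a \<otimes>\<^bsub>G\<^esub> b) ` (A \<times> B)"
  by (auto simp: set_mult_def)

lemma finite_set_mult: "finite A \<Longrightarrow> finite B \<Longrightarrow> finite (A <#>\<^bsub>G\<^esub> B)"
  by (simp add: set_mult_eq_image)

lemma mem_set_mult: "a \<in> A \<Longrightarrow> b \<in> B \<Longrightarrow> a \<otimes>\<^bsub>G\<^esub> b \<in> A <#>\<^bsub>G\<^esub> B"
  by (auto simp: set_mult_def)

primrec set_power :: "('a, 'b) monoid_scheme \<Rightarrow> 'a set \<Rightarrow> nat \<Rightarrow> 'a set" where
  "set_power G B 0 = {\<one>\<^bsub>G\<^esub>}"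
| "set_power G B (Suc n) = B <#>\<^bsub>G\<^esub> set_power G B n"

definition quotient_set :: "('a, 'b) monoid_scheme \<Rightarrow> 'a set \<Rightarrow> 'a set \<Rightarrow> 'a set" where
  "quotient_set G P Q = (\<lambda>(p, q). p \<otimes>\<^bsub>G\<^esub> inv\<^bsub>G\<^esub> q) ` (P \<times> Q)"

lemma finite_set_power: "finite B \<Longrightarrow> finite (set_power G B n)"
  by (induction n) (auto intro: finite_set_mult)

context comm_group
begin

lemma set_power_closed: "B \<subseteq> carrier G \<Longrightarrow> set_power G B n \<subseteq> carrier G"
  by (induction n) (simp_all add: set_mult_closed)

lemma set_mult_comm:
  assumes "P \<subseteq> carrier G" "Q \<subseteq> carrier G"
  shows "P <#> Q = Q <#> P"
proof -
  have "(\<lambda>(p, q). p \<otimes> q) ` (P \<times> Q) = (\<lambda>(p, q). q \<otimes> p) ` (P \<times> Q)"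
    using assms by (intro image_cong) (auto intro: m_comm)
  also have "\<dots> = (\<lambda>(q, p). q \<otimes> p) ` (Q \<times> P)" by auto
  finally show ?thesis by (simp add: set_mult_eq_image)
qed

lemma card_translate:
  assumes "V \<subseteq> carrier G" "c \<in> carrier G"
  shows "card (V <#> {c}) = card V"
proof -
  have "V <#> {c} = (\<lambda>x. x \<otimes> c) ` V" by (auto simp: set_mult_def)
  moreover have "inj_on (\<lambda>x. x \<otimes> c) V"
    using assms by (meson inj_onI right_cancel subsetD)
  ultimately show ?thesis by (simp add: card_image)
qed

text \<open>
Petridis's lemma: the set \<open>V\<close> minimises the growth ratio among its own subsets. Adding one element \<open>c\<close> to
\<open>C\<close> enlarges \<open>V B C\<close> at most by \<open>V B c\<close> without the part \<open>Z B c\<close> that is already there, and minimality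
says that this part has at least \<open>K |Z|\<close> elements. The elements of \<open>V c\<close> that already lie in \<open>V C\<close> come from
points of \<open>Z\<close>, so \<open>V C\<close> grows at least by \<open>|V| - |Z|\<close>.
\<close>

lemma petridis:
  fixes K :: real
  assumes V: "finite V" "V \<subseteq> carrier G" and B: "finite B" "B \<subseteq> carrier G"
    and eq: "real (card (V <#> B)) = K * real (card V)"
    and minimal: "\<And>Z. Z \<subseteq> V \<Longrightarrow> K * real (card Z) \<le> real (card (Z <#> B))"
    and C: "finite C" "C \<subseteq> carrier G"
  shows "real (card (V <#> (B <#> C))) \<le> K * real (card (V <#> C))"
proof (cases "V = {}")
  case True
  then show ?thesis by (simp add: set_mult_def)
next
  case nonempty: False
  have K: "K \<ge> 0"
    using eq nonempty V
    by (metis card_gt_0_iff of_nat_0_le_iff of_nat_0_less_iff zero_le_mult_iff linorder_not_less)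
  have fin: "finite (V <#> (B <#> D))" if "finite D" for D
    using V B that by (intro finite_set_mult)
  show ?thesis
    using C
  proof (induction C rule: finite_induct)
    case empty
    then show ?case by (simp add: set_mult_def)
  next
    case (insert c C)
    have c: "c \<in> carrier G" and C: "C \<subseteq> carrier G" using insert.prems by auto
    \<comment> \<open>The points \<open>x\<close> for which all of \<open>x B c\<close> is already covered, and those whose translate by \<open>c\<close> is.\<close>
    define Z where "Z = {x \<in> V. (\<lambda>b. x \<otimes> (b \<otimes> c)) ` B \<subseteq> V <#> (B <#> C)}"
    define W where "W = {x \<in> V. x \<otimes> c \<in> V <#> C}"
    have sub: "Z \<subseteq> V" "W \<subseteq> V" by (auto simp: Z_def W_def)
    have WZ: "W \<subseteq> Z"
    proof
      fix x assume "x \<in> W"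
      then obtain x' c' where x: "x \<in> V" and x': "x' \<in> V" "c' \<in> C" "x \<otimes> c = x' \<otimes> c'"
        by (auto simp: W_def set_mult_def)
      have "x \<otimes> (b \<otimes> c) \<in> V <#> (B <#> C)" if "b \<in> B" for b
      proof -
        have "x \<in> carrier G" "x' \<in> carrier G" "b \<in> carrier G" "c' \<in> carrier G"
          using x x' that V B C by auto
        then have "x \<otimes> (b \<otimes> c) = x' \<otimes> (b \<otimes> c')"
          using x'(3) c by (metis m_lcomm)
        then show ?thesis
          using x' that mem_set_mult by metis
      qed
      then show "x \<in> Z"
        using x by (auto simp: Z_def)
    qed
    have upper: "V <#> (B <#> insert c C) \<subseteq> (V <#> (B <#> C)) \<union> (((V <#> B) <#> {c}) - ((Z <#> B) <#> {c}))"
    proof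
      fix y assume "y \<in> V <#> (B <#> insert c C)"
      then obtain x b d where y: "x \<in> V" "b \<in> B" "d \<in> insert c C" "y = x \<otimes> (b \<otimes> d)"
        by (auto simp: set_mult_def)
      show "y \<in> (V <#> (B <#> C)) \<union> (((V <#> B) <#> {c}) - ((Z <#> B) <#> {c}))"
      proof (cases "y \<in> V <#> (B <#> C)")
        case False
        then have "d = c" using y by (auto intro!: mem_set_mult)
        then have "y = (x \<otimes> b) \<otimes> c" using y V B c by (metis m_assoc subsetD)
        then have "y \<in> (V <#> B) <#> {c}" using y by (auto intro!: mem_set_mult)
        moreover have "y \<notin> (Z <#> B) <#> {c}"
        proof
          assume "y \<in> (Z <#> B) <#> {c}"
          then obtain z b' where z: "z \<in> Z" "b' \<in> B" "y = (z \<otimes> b') \<otimes> c"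
            by (auto simp: set_mult_def)
          then have "y = z \<otimes> (b' \<otimes> c)" using sub V B c by (metis m_assoc subsetD)
          then show False using z False by (auto simp: Z_def)
        qed
        ultimately show ?thesis by simp
      qed simp
    qed
    have lower: "(V <#> C) \<union> ((V <#> {c}) - (W <#> {c})) \<subseteq> V <#> insert c C"
      by (auto simp: set_mult_def)
    have disj: "(V <#> C) \<inter> ((V <#> {c}) - (W <#> {c})) = {}"
    proof (rule equals0I, elim IntE DiffE)
      fix y assume y: "y \<in> V <#> C" "y \<in> V <#> {c}" "y \<notin> W <#> {c}"
      then obtain x where x: "x \<in> V" "y = x \<otimes> c" by (auto simp: set_mult_def)
      with y have "x \<in> W" by (simp add: W_def)
      with x y show False by (auto simp: set_mult_def)
    qed
    have subs: "W <#> {c} \<subseteq> V <#> {c}" "(Z <#> B) <#> {c} \<subseteq> (V <#> B) <#> {c}"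
      using sub by (simp_all add: mono_set_mult)
    have fins: "finite (V <#> C)" "finite (V <#> {c})" "finite (W <#> {c})" "finite ((V <#> B) <#> {c})"
        "finite ((Z <#> B) <#> {c})"
      using V B insert.hyps sub finite_subset by (auto intro!: finite_set_mult)
    have "real (card (V <#> (B <#> insert c C)))
        \<le> real (card (V <#> (B <#> C))) + real (card (((V <#> B) <#> {c}) - ((Z <#> B) <#> {c})))"
    proof -
      have "card (V <#> (B <#> insert c C)) \<le> card ((V <#> (B <#> C)) \<union> (((V <#> B) <#> {c}) - ((Z <#> B) <#> {c})))"
        using upper fins fin insert.hyps by (intro card_mono) auto
      also have "\<dots> \<le> card (V <#> (B <#> C)) + card (((V <#> B) <#> {c}) - ((Z <#> B) <#> {c}))"
        by (rule card_Un_le)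
      finally show ?thesis by linarith
    qed
    also have "card (((V <#> B) <#> {c}) - ((Z <#> B) <#> {c})) = card ((V <#> B) <#> {c}) - card ((Z <#> B) <#> {c})"
      using fins subs by (intro card_Diff_subset) auto
    also have "\<dots> = card (V <#> B) - card (Z <#> B)"
      using V B c sub by (simp add: card_translate set_mult_closed subset_trans)
    also have "real (card (V <#> B) - card (Z <#> B)) = real (card (V <#> B)) - real (card (Z <#> B))"
      using sub V B by (intro of_nat_diff card_mono finite_set_mult mono_set_mult) auto
    also have "\<dots> \<le> K * real (card V) - K * real (card Z)"
      using eq minimal[OF sub(1)] by linarith
    also have "real (card (V <#> (B <#> C))) \<le> K * real (card (V <#> C))"
      using insert.IH C by simp
    finally have 1: "real (card (V <#> (B <#> insert c C)))
        \<le> K * (real (card (V <#> C)) + real (card V) - real (card Z))"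
      by (simp add: algebra_simps)
    have "card (V <#> C) + (card V - card W) = card (V <#> C) + card ((V <#> {c}) - (W <#> {c}))"
      using fins subs V c sub by (subst card_Diff_subset) (auto simp: card_translate)
    also have "\<dots> = card ((V <#> C) \<union> ((V <#> {c}) - (W <#> {c})))"
      using fins disj by (subst card_Un_disjoint) auto
    also have "\<dots> \<le> card (V <#> insert c C)"
      using lower V insert.hyps by (intro card_mono finite_set_mult) auto
    finally have "card (V <#> C) + (card V - card W) \<le> card (V <#> insert c C)" .
    moreover have "card W \<le> card Z" "card Z \<le> card V"
      using WZ sub V finite_subset by (auto intro!: card_mono)
    ultimately have "real (card (V <#> C)) + real (card V) - real (card Z) \<le> real (card (V <#> insert c C))"
      by linarith
    then have "K * (real (card (V <#> C)) + real (card V) - real (card Z)) \<le> K * real (card (V <#> insert c C))"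
      using K by (rule mult_left_mono)
    with 1 show ?case by linarith
  qed
qed

text \<open>
Each pair of a quotient \<open>d = p / q\<close> and an \<open>x\<close> is recovered from \<open>(p x, q x)\<close>, once a representation of every
\<open>d\<close> has been fixed. Using products \<open>P X\<close> instead of the customary quotients \<open>P / X\<close> costs nothing, as \<open>X\<close> may
be inverted.
\<close>

lemma ruzsa_triangle:
  assumes P: "finite P" "P \<subseteq> carrier G" and Q: "finite Q" "Q \<subseteq> carrier G"
    and V: "finite V" "V \<subseteq> carrier G"
  shows "card (quotient_set G P Q) * card V \<le> card (P <#> V) * card (Q <#> V)"
proof -
  have "\<forall>d\<in>quotient_set G P Q. \<exists>p q. p \<in> P \<and> q \<in> Q \<and> d = p \<otimes> inv q"
    by (auto simp: quotient_set_def)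
  then obtain p q where pq: "\<And>d. d \<in> quotient_set G P Q \<Longrightarrow> p d \<in> P \<and> q d \<in> Q \<and> d = p d \<otimes> inv (q d)"
    by metis
  define \<phi> where "\<phi> = (\<lambda>(d, x). (p d \<otimes> x, q d \<otimes> x))"
  have rec: "(p d \<otimes> x) \<otimes> inv (q d \<otimes> x) = d" if "d \<in> quotient_set G P Q" "x \<in> V" for d x
  proof -
    have c: "p d \<in> carrier G" "q d \<in> carrier G" "x \<in> carrier G" using pq that P Q V by auto
    then have "(p d \<otimes> x) \<otimes> inv (q d \<otimes> x) = p d \<otimes> (x \<otimes> (inv x \<otimes> inv (q d)))"
      by (simp add: m_assoc inv_mult_group)
    also have "\<dots> = p d \<otimes> inv (q d)"
    proof -
      have "x \<otimes> (inv x \<otimes> inv (q d)) = (x \<otimes> inv x) \<otimes> inv (q d)"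
        using c by (intro m_assoc[symmetric]) auto
      then show ?thesis using c by simp
    qed
    finally show ?thesis using pq that by metis
  qed
  have "inj_on \<phi> (quotient_set G P Q \<times> V)"
  proof (rule inj_onI)
    fix u v assume u: "u \<in> quotient_set G P Q \<times> V" and v: "v \<in> quotient_set G P Q \<times> V" and e: "\<phi> u = \<phi> v"
    obtain d x where ux: "u = (d, x)" by (cases u)
    obtain d' x' where vx: "v = (d', x')" by (cases v)
    have e2: "p d \<otimes> x = p d' \<otimes> x'" "q d \<otimes> x = q d' \<otimes> x'" using e by (auto simp: \<phi>_def ux vx)
    have "d = d'" using rec[of d x] rec[of d' x'] e2 u v ux vx by auto
    moreover have "x = x'"
    proof -
      have "p d \<in> carrier G" "x \<in> carrier G" "x' \<in> carrier G" using pq u v ux vx P V by auto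
      then show ?thesis using e2 \<open>d = d'\<close> by auto
    qed
    ultimately show "u = v" by (simp add: ux vx)
  qed
  moreover have "\<phi> ` (quotient_set G P Q \<times> V) \<subseteq> (P <#> V) \<times> (Q <#> V)"
    using pq by (auto simp: \<phi>_def intro!: mem_set_mult)
  ultimately have "card (quotient_set G P Q \<times> V) \<le> card ((P <#> V) \<times> (Q <#> V))"
    using P Q V by (intro card_inj_on_le) (auto intro!: finite_set_mult)
  then show ?thesis by (simp add: card_cartesian_product)
qed

text \<open>
The subset of \<open>Y\<close> with the smallest growth ratio under multiplication by \<open>B\<close> satisfies the hypothesis of \<open>petridis\<close>;
iteration bounds its products with powers of \<open>B\<close>, and the triangle inequality turns two of these bounds
into one for quotients.
\<close>

lemma pluennecke_ruzsa:
  fixes K :: real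
  assumes Y: "finite Y" "Y \<subseteq> carrier G" "Y \<noteq> {}" and B: "finite B" "B \<subseteq> carrier G"
    and le: "real (card (Y <#> B)) \<le> K * real (card Y)"
  shows "real (card (quotient_set G (set_power G B k) (set_power G B l))) \<le> K ^ (k + l) * real (card Y)"
proof -
  define ratio where "ratio = (\<lambda>Z. real (card (Z <#> B)) / real (card Z))"
  have "finite (Pow Y - {{}})" "Pow Y - {{}} \<noteq> {}" using Y by auto
  then obtain V where V: "V \<in> Pow Y - {{}}" and least: "\<And>Z. Z \<in> Pow Y - {{}} \<Longrightarrow> ratio V \<le> ratio Z"
    using arg_min_if_finite[of "Pow Y - {{}}" ratio] by (metis not_less)
  define L where "L = ratio V"
  have fV: "finite V" "V \<subseteq> carrier G" "V \<noteq> {}" using V Y finite_subset by auto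
  have posV: "card V > 0" using fV by (simp add: card_gt_0_iff)
  have L0: "L \<ge> 0" by (simp add: L_def ratio_def)
  have LK: "L \<le> K"
  proof -
    have "L \<le> ratio Y" using least Y by (simp add: L_def)
    also have "\<dots> \<le> K" using le Y by (simp add: ratio_def field_simps card_gt_0_iff)
    finally show ?thesis .
  qed
  have eq: "real (card (V <#> B)) = L * real (card V)" using posV by (simp add: L_def ratio_def)
  have minimal: "L * real (card Z) \<le> real (card (Z <#> B))" if "Z \<subseteq> V" for Z
  proof (cases "Z = {}")
    case False
    then have "L \<le> ratio Z" using least V that by (auto simp: L_def)
    moreover have "card Z > 0" using False that fV finite_subset by (auto simp: card_gt_0_iff)
    ultimately show ?thesis by (simp add: ratio_def field_simps)
  qed simp
  have pow: "real (card (V <#> set_power G B n)) \<le> L ^ n * real (card V)" for n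
  proof (induction n)
    case 0
    then show ?case using card_translate[OF fV(2), of \<one>] by simp
  next
    case (Suc n)
    have "real (card (V <#> set_power G B (Suc n))) \<le> L * real (card (V <#> set_power G B n))"
      using petridis[OF fV(1,2) B eq minimal finite_set_power[OF B(1), of G n]
          set_power_closed[OF B(2), of n]] by simp
    also have "\<dots> \<le> L * (L ^ n * real (card V))" using Suc L0 by (intro mult_left_mono)
    finally show ?case by (simp add: mult.assoc)
  qed
  let ?D = "quotient_set G (set_power G B k) (set_power G B l)"
  have comm: "set_power G B n <#> V = V <#> set_power G B n" for n
    using set_power_closed[OF B(2), of n] fV(2) by (rule set_mult_comm)
  have "card ?D * card V \<le> card (V <#> set_power G B k) * card (V <#> set_power G B l)"
    using ruzsa_triangle[OF finite_set_power[OF B(1), of G k] set_power_closed[OF B(2), of k]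
        finite_set_power[OF B(1), of G l] set_power_closed[OF B(2), of l] fV(1,2)]
    by (simp add: comm)
  then have "real (card ?D) * real (card V)
      \<le> real (card (V <#> set_power G B k)) * real (card (V <#> set_power G B l))"
    by (metis of_nat_le_iff of_nat_mult)
  also have "\<dots> \<le> (L ^ k * real (card V)) * (L ^ l * real (card V))"
    using pow L0 by (intro mult_mono) auto
  finally have "real (card ?D) * real (card V) \<le> (L ^ (k + l) * real (card V)) * real (card V)"
    by (simp add: power_add mult_ac)
  then have "real (card ?D) \<le> L ^ (k + l) * real (card V)" using posV by simp
  also have "\<dots> \<le> K ^ (k + l) * real (card Y)"
    using L0 LK V Y by (intro mult_mono power_mono) (auto intro!: card_mono)
  finally show ?thesis .
qed

end

context comm_group
begin

lemma set_power_mult_mem: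
  assumes B: "B \<subseteq> carrier G" and x: "x \<in> set_power G B m" and y: "y \<in> set_power G B n"
  shows "x \<otimes> y \<in> set_power G B (m + n)"
  using x
proof (induction m arbitrary: x)
  case 0
  then show ?case using y set_power_closed[OF B, of n] by auto
next
  case (Suc m)
  then obtain b z where bz: "b \<in> B" "z \<in> set_power G B m" "x = b \<otimes> z" by (auto simp: set_mult_def)
  have "b \<in> carrier G" "z \<in> carrier G" "y \<in> carrier G"
    using bz y B set_power_closed[OF B] by auto
  then have "x \<otimes> y = b \<otimes> (z \<otimes> y)" using bz by (simp add: m_assoc)
  then show ?case using Suc.IH[OF bz(2)] bz(1) by (auto intro: mem_set_mult)
qed

lemma set_power_inv_mem:
  assumes B: "B \<subseteq> carrier G" and inv: "\<And>b. b \<in> B \<Longrightarrow> inv b \<in> B" and x: "x \<in> set_power G B m"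
  shows "inv x \<in> set_power G B m"
  using x
proof (induction m arbitrary: x)
  case (Suc m)
  then obtain b z where bz: "b \<in> B" "z \<in> set_power G B m" "x = b \<otimes> z" by (auto simp: set_mult_def)
  have "b \<in> carrier G" "z \<in> carrier G" using bz B set_power_closed[OF B] by auto
  then have "inv x = inv b \<otimes> inv z" using bz by (simp add: inv_mult)
  then show ?case using Suc.IH[OF bz(2)] inv[OF bz(1)] by (auto intro: mem_set_mult)
qed simp

lemma one_mem_set_power:
  assumes "\<one> \<in> B" shows "\<one> \<in> set_power G B m"
proof (induction m)
  case (Suc m)
  then show ?case using mem_set_mult[OF assms Suc, of G] by simp
qed simp

text \<open>
Commutativity collects numerators and denominators.
\<close>

lemma set_power_quotient_set:
  assumes A: "A \<subseteq> carrier G"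
  shows "set_power G (quotient_set G A A) n \<subseteq> quotient_set G (set_power G A n) (set_power G A n)"
proof (induction n)
  case 0
  then show ?case by (auto simp: quotient_set_def)
next
  case (Suc n)
  show ?case
  proof
    fix x assume "x \<in> set_power G (quotient_set G A A) (Suc n)"
    then obtain h z where hz: "h \<in> quotient_set G A A" "z \<in> set_power G (quotient_set G A A) n" "x = h \<otimes> z"
      by (auto simp: set_mult_def)
    obtain a b where ab: "a \<in> A" "b \<in> A" "h = a \<otimes> inv b" using hz by (auto simp: quotient_set_def)
    obtain u v where uv: "u \<in> set_power G A n" "v \<in> set_power G A n" "z = u \<otimes> inv v"
      using hz(2) Suc by (auto simp: quotient_set_def)
    have c: "a \<in> carrier G" "b \<in> carrier G" "u \<in> carrier G" "v \<in> carrier G"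
      using ab uv A set_power_closed[OF A, of n] by auto
    have "x = (a \<otimes> u) \<otimes> inv (b \<otimes> v)"
      using c by (simp add: hz ab uv inv_mult m_ac)
    moreover have "a \<otimes> u \<in> set_power G A (Suc n)" "b \<otimes> v \<in> set_power G A (Suc n)"
      using ab uv by (auto intro: mem_set_mult)
    ultimately show "x \<in> quotient_set G (set_power G A (Suc n)) (set_power G A (Suc n))"
      by (auto simp: quotient_set_def)
  qed
qed

text \<open>
A small ratio set controls all its powers: \<open>pluennecke_ruzsa\<close> is applied with \<open>Y\<close> the set of inverses of \<open>A\<close>.
\<close>

lemma card_set_power_quotient_set:
  fixes K :: real
  assumes A: "finite A" "A \<subseteq> carrier G" "A \<noteq> {}"
    and K: "real (card (quotient_set G A A)) \<le> K * real (card A)"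
  shows "real (card (set_power G (quotient_set G A A) n)) \<le> K ^ (2 * n) * real (card A)"
proof -
  define Y where "Y = (\<lambda>a. inv a) ` A"
  have Y: "finite Y" "Y \<subseteq> carrier G" "Y \<noteq> {}" "card Y = card A"
    using A inj_on_subset[OF inv_inj A(2)] by (auto simp: Y_def card_image)
  have "Y <#> A = A <#> Y" using Y A by (intro set_mult_comm)
  also have "\<dots> = quotient_set G A A" by (auto simp: set_mult_def quotient_set_def Y_def)
  finally have le: "real (card (Y <#> A)) \<le> K * real (card Y)" using K Y by simp
  have "card (set_power G (quotient_set G A A) n) \<le> card (quotient_set G (set_power G A n) (set_power G A n))"
    using A by (intro card_mono set_power_quotient_set) (auto simp: quotient_set_def intro!: finite_set_power)
  then show ?thesis
    using pluennecke_ruzsa[OF Y(1-3) A(1,2) le, of n n] Y(4) by (simp add: mult_2)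
qed

end

section \<open>Popular quotients and popular differences\<close>

lemma sum_card_fibres:
  assumes "finite P" "finite D"
  shows "(\<Sum>d\<in>D. card {p \<in> P. g p = d}) = card {p \<in> P. g p \<in> D}"
proof -
  have "card {p \<in> P. g p = d} = (\<Sum>x\<in>{x \<in> {p \<in> P. g p \<in> D}. g x = d}. 1)" if "d \<in> D" for d
    using that by (auto intro!: arg_cong[where f = card])
  then have "(\<Sum>d\<in>D. card {p \<in> P. g p = d}) = (\<Sum>d\<in>D. \<Sum>x\<in>{x \<in> {p \<in> P. g p \<in> D}. g x = d}. 1)"
    by (intro sum.cong) simp_all
  also have "\<dots> = (\<Sum>x\<in>{p \<in> P. g p \<in> D}. 1)"
    using assms by (intro sum.group) auto
  finally show ?thesis by simp
qed

context comm_group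
begin

text \<open>
The number of common elements of the translates \<open>b T\<close> and \<open>u T\<close>, counted as solutions of \<open>b v = u w\<close> so that no
inverse appears.
\<close>

definition common :: "'a set \<Rightarrow> 'a \<Rightarrow> 'a \<Rightarrow> nat" where
  "common T b u = card {p \<in> T \<times> T. b \<otimes> fst p = u \<otimes> snd p}"

text \<open>
The equation \<open>b v = u w\<close> says that \<open>w / v\<close> is the quotient \<open>b / u\<close>. So the number of coincidences is the
number of representations of \<open>b / u\<close> in \<open>T / T\<close>, which depends on the pair \<open>(b, u)\<close> only through its quotient.
\<close>

lemma common_eq_fibre:
  assumes "T \<subseteq> carrier G" "b \<in> carrier G" "u \<in> carrier G"
  shows "common T b u = card {q \<in> T \<times> T. fst q \<otimes> inv (snd q) = b \<otimes> inv u}"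
proof -
  have "bij_betw prod.swap {p \<in> T \<times> T. b \<otimes> fst p = u \<otimes> snd p}
          {q \<in> T \<times> T. fst q \<otimes> inv (snd q) = b \<otimes> inv u}"
  proof (rule bij_betw_byWitness[where f' = prod.swap])
    have *: "b \<otimes> v = u \<otimes> w \<longleftrightarrow> w \<otimes> inv v = b \<otimes> inv u" if "v \<in> T" "w \<in> T" for v w
    proof -
      have c: "v \<in> carrier G" "w \<in> carrier G" using that assms by auto
      have "w \<otimes> inv v = b \<otimes> inv u \<longleftrightarrow> w = b \<otimes> inv u \<otimes> v"
        using c assms by (metis inv_closed inv_solve_right m_closed)
      also have "b \<otimes> inv u \<otimes> v = inv u \<otimes> (b \<otimes> v)"
        using c assms by (metis inv_closed m_assoc m_comm)
      also have "w = inv u \<otimes> (b \<otimes> v) \<longleftrightarrow> b \<otimes> v = u \<otimes> w"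
        using c assms by (metis inv_solve_left m_closed)
      finally show ?thesis by simp
    qed
    show "prod.swap ` {p \<in> T \<times> T. b \<otimes> fst p = u \<otimes> snd p}
        \<subseteq> {q \<in> T \<times> T. fst q \<otimes> inv (snd q) = b \<otimes> inv u}"
      using * by auto
    show "prod.swap ` {q \<in> T \<times> T. fst q \<otimes> inv (snd q) = b \<otimes> inv u}
        \<subseteq> {p \<in> T \<times> T. b \<otimes> fst p = u \<otimes> snd p}"
      using * by auto
  qed auto
  then show ?thesis unfolding common_def by (rule bij_betw_same_card)
qed

text \<open>
Pairs are grouped by their quotient. By \<open>common_eq_fibre\<close>, a quotient with few coincidences is also the quotient
of few pairs, namely fewer than \<open>\<eta>\<close>, and there are at most \<open>|T / T|\<close> quotients.
\<close>

lemma card_unpopular_pairs: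
  assumes T: "finite T" "T \<subseteq> carrier G" and "0 \<le> \<eta>"
  shows "real (card {q \<in> T \<times> T. real (common T (fst q) (snd q)) < \<eta>})
    \<le> \<eta> * real (card (quotient_set G T T))"
proof -
  define r where "r = (\<lambda>x. card {q \<in> T \<times> T. fst q \<otimes> inv (snd q) = x})"
  define D where "D = {x \<in> quotient_set G T T. real (r x) < \<eta>}"
  have fin: "finite (quotient_set G T T)" using T by (simp add: quotient_set_def)
  have "{q \<in> T \<times> T. real (common T (fst q) (snd q)) < \<eta>} = {q \<in> T \<times> T. fst q \<otimes> inv (snd q) \<in> D}"
  proof (intro Collect_cong conj_cong refl)
    fix q assume q: "q \<in> T \<times> T"
    then have "fst q \<in> carrier G" "snd q \<in> carrier G" using T by auto
    then have "common T (fst q) (snd q) = r (fst q \<otimes> inv (snd q))"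
      using common_eq_fibre[OF T(2)] by (simp add: r_def)
    moreover have "fst q \<otimes> inv (snd q) \<in> quotient_set G T T"
      using q by (auto simp: quotient_set_def)
    ultimately show "(real (common T (fst q) (snd q)) < \<eta>) = (fst q \<otimes> inv (snd q) \<in> D)"
      by (simp add: D_def)
  qed
  then have "card {q \<in> T \<times> T. real (common T (fst q) (snd q)) < \<eta>} = (\<Sum>x\<in>D. r x)"
    using sum_card_fibres[of "T \<times> T" D "\<lambda>q. fst q \<otimes> inv (snd q)"] T fin
    by (simp add: r_def D_def)
  then have "real (card {q \<in> T \<times> T. real (common T (fst q) (snd q)) < \<eta>}) = (\<Sum>x\<in>D. real (r x))"
    by simp
  also have "\<dots> \<le> (\<Sum>x\<in>D. \<eta>)" by (intro sum_mono) (auto simp: D_def)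
  also have "\<dots> = \<eta> * real (card D)" by simp
  also have "\<dots> \<le> \<eta> * real (card (quotient_set G T T))"
    using \<open>0 \<le> \<eta>\<close> fin by (intro mult_left_mono) (auto simp: D_def intro!: card_mono)
  finally show ?thesis .
qed

lemma card_le_quotient_set:
  assumes T: "finite T" "T \<subseteq> carrier G"
  shows "card T \<le> card (quotient_set G T T)"
proof (cases "T = {}")
  case False
  then obtain t where t: "t \<in> T" by auto
  have "inj_on (\<lambda>x. x \<otimes> inv t) T"
    using T t by (intro inj_onI) (metis inv_closed right_cancel subsetD)
  moreover have "(\<lambda>x. x \<otimes> inv t) ` T \<subseteq> quotient_set G T T"
    using t by (auto simp: quotient_set_def)
  ultimately show ?thesis
    using T by (intro card_inj_on_le) (auto simp: quotient_set_def)
qed simp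

end

locale finite_field = field +
  assumes finite_carrier: "finite (carrier R)"
begin

lemma finite_subset_carrier: "V \<subseteq> carrier R \<Longrightarrow> finite V"
  using finite_carrier finite_subset by blast

lemma minus_eq_zero_iff: "x \<in> carrier R \<Longrightarrow> y \<in> carrier R \<Longrightarrow> x \<ominus> y = \<zero> \<longleftrightarrow> x = y"
  by (metis r_right_minus_eq)

lemma inv_mem: "x \<in> carrier R \<Longrightarrow> x \<noteq> \<zero> \<Longrightarrow> inv x \<in> carrier R"
  using field_Units by auto

definition reps :: "'a set \<Rightarrow> 'a \<Rightarrow> nat" where
  "reps V s = card {p \<in> V \<times> V. fst p \<ominus> snd p = s}"

definition popular :: "'a set \<Rightarrow> real \<Rightarrow> 'a set" where
  "popular V \<theta> = {s \<in> carrier R. \<theta> \<le> real (reps V s)}"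

lemma sum_reps:
  assumes "V \<subseteq> carrier R" "S \<subseteq> carrier R"
  shows "(\<Sum>s\<in>S. reps V s) = card {p \<in> V \<times> V. fst p \<ominus> snd p \<in> S}"
  unfolding reps_def using assms by (intro sum_card_fibres) (auto intro: finite_subset_carrier)

lemma card_popular:
  assumes "V \<subseteq> carrier R"
  shows "\<theta> * real (card (popular V \<theta>)) \<le> real (card V ^ 2)"
proof -
  have "\<theta> * real (card (popular V \<theta>)) = (\<Sum>s\<in>popular V \<theta>. \<theta>)" by simp
  also have "\<dots> \<le> (\<Sum>s\<in>popular V \<theta>. real (reps V s))"
    by (intro sum_mono) (simp add: popular_def)
  also have "\<dots> = real (card {p \<in> V \<times> V. fst p \<ominus> snd p \<in> popular V \<theta>})"
    using sum_reps[OF assms, of "popular V \<theta>"] by (simp add: popular_def flip: of_nat_sum)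
  also have "\<dots> \<le> real (card (V \<times> V))"
    using assms by (intro of_nat_mono card_mono) (auto intro: finite_subset_carrier)
  finally show ?thesis by (simp add: card_cartesian_product power2_eq_square)
qed

lemma reps_le_card:
  assumes "V \<subseteq> carrier R"
  shows "reps V s \<le> card V"
proof -
  have "inj_on snd {p \<in> V \<times> V. fst p \<ominus> snd p = s}"
  proof (rule inj_onI)
    fix p p' assume p: "p \<in> {p \<in> V \<times> V. fst p \<ominus> snd p = s}" and p': "p' \<in> {p \<in> V \<times> V. fst p \<ominus> snd p = s}"
      and eq: "snd p = snd p'"
    have "fst p \<oplus> (\<ominus> snd p) = fst p' \<oplus> (\<ominus> snd p)" using p p' eq by (simp add: a_minus_def)
    moreover have "fst p \<in> carrier R" "fst p' \<in> carrier R" "\<ominus> snd p \<in> carrier R" using p p' assms by auto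
    ultimately show "p = p'" using eq by (simp add: prod_eq_iff)
  qed
  then show ?thesis
    unfolding reps_def using finite_subset_carrier[OF assms] by (intro card_inj_on_le[where f = snd]) auto
qed

text \<open>
Dilation maps representations of \<open>s\<close> to representations of \<open>h s\<close>. This is the only place where the
multiplicative structure acts on popular differences.
\<close>

lemma popular_mult:
  assumes V: "V \<subseteq> carrier R" and W: "W \<subseteq> carrier R"
    and h: "h \<in> carrier R" "h \<noteq> \<zero>" and hV: "\<And>x. x \<in> V \<Longrightarrow> h \<otimes> x \<in> W"
    and s: "s \<in> popular V \<theta>"
  shows "h \<otimes> s \<in> popular W \<theta>"
proof -
  have "reps V s \<le> reps W (h \<otimes> s)"
    unfolding reps_def
  proof (rule card_inj_on_le[where f = "map_prod ((\<otimes>) h) ((\<otimes>) h)"])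
    show "inj_on (map_prod ((\<otimes>) h) ((\<otimes>) h)) {p \<in> V \<times> V. fst p \<ominus> snd p = s}"
      using V h by (intro inj_onI) (auto simp: m_lcancel subset_iff)
    show "map_prod ((\<otimes>) h) ((\<otimes>) h) ` {p \<in> V \<times> V. fst p \<ominus> snd p = s}
        \<subseteq> {p \<in> W \<times> W. fst p \<ominus> snd p = h \<otimes> s}"
    proof (clarsimp simp: hV)
      fix x y assume "x \<in> V" "y \<in> V"
      then have "x \<in> carrier R" "y \<in> carrier R" using V by auto
      then show "h \<otimes> x \<ominus> h \<otimes> y = h \<otimes> (x \<ominus> y)"
        using h by (simp add: a_minus_def r_distr r_minus)
    qed
    show "finite {p \<in> W \<times> W. fst p \<ominus> snd p = h \<otimes> s}"
      using finite_subset_carrier[OF W] by simp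
  qed
  then show ?thesis using s h by (auto simp: popular_def)
qed

lemma additive_energy_eq_sum:
  assumes A: "A \<subseteq> carrier R"
  shows "additive_energy R A = (\<Sum>s\<in>carrier R. reps A s ^ 2)"
proof -
  let ?P = "A \<times> A" and ?d = "\<lambda>p. fst p \<ominus> snd p"
  have *: "a1 \<oplus> b1 = a2 \<oplus> b2 \<longleftrightarrow> a1 \<ominus> a2 = b2 \<ominus> b1"
    if "a1 \<in> A" "a2 \<in> A" "b1 \<in> A" "b2 \<in> A" for a1 a2 b1 b2
  proof -
    have c: "a1 \<in> carrier R" "a2 \<in> carrier R" "b1 \<in> carrier R" "b2 \<in> carrier R" using that A by auto
    show ?thesis
    proof
      assume e: "a1 \<oplus> b1 = a2 \<oplus> b2"
      have "a1 \<ominus> a2 = (a1 \<oplus> b1) \<ominus> (a2 \<oplus> b1)" using c by algebra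
      also have "\<dots> = b2 \<ominus> b1" unfolding e using c by algebra
      finally show "a1 \<ominus> a2 = b2 \<ominus> b1" .
    next
      assume e: "a1 \<ominus> a2 = b2 \<ominus> b1"
      have "a1 \<oplus> b1 = (a1 \<ominus> a2) \<oplus> (a2 \<oplus> b1)" using c by algebra
      also have "\<dots> = a2 \<oplus> b2" unfolding e using c by algebra
      finally show "a1 \<oplus> b1 = a2 \<oplus> b2" .
    qed
  qed
  have "additive_energy R A = card {r \<in> ?P \<times> ?P. ?d (fst r) = ?d (snd r)}"
    unfolding additive_energy_def
    by (rule bij_betw_same_card[where f = "\<lambda>(a1, a2, b1, b2). ((a1, a2), (b2, b1))"],
        rule bij_betw_byWitness[where f' = "\<lambda>((a1, a2), (b2, b1)). (a1, a2, b1, b2)"])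
       (auto simp: *)
  also have "\<dots> = card {r \<in> {r \<in> ?P \<times> ?P. ?d (fst r) = ?d (snd r)}. ?d (fst r) \<in> carrier R}"
    using A by (intro arg_cong[where f = card]) (auto intro!: minus_closed)
  also have "\<dots> = (\<Sum>s\<in>carrier R. card {r \<in> {r \<in> ?P \<times> ?P. ?d (fst r) = ?d (snd r)}. ?d (fst r) = s})"
    using finite_subset_carrier[OF A] finite_carrier by (intro sum_card_fibres[symmetric]) auto
  also have "\<dots> = (\<Sum>s\<in>carrier R. reps A s ^ 2)"
  proof (intro sum.cong refl)
    fix s
    have "{r \<in> {r \<in> ?P \<times> ?P. ?d (fst r) = ?d (snd r)}. ?d (fst r) = s} = {p \<in> ?P. ?d p = s} \<times> {p \<in> ?P. ?d p = s}"
      by auto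
    then show "card {r \<in> {r \<in> ?P \<times> ?P. ?d (fst r) = ?d (snd r)}. ?d (fst r) = s} = reps A s ^ 2"
      by (simp add: reps_def card_cartesian_product power2_eq_square)
  qed
  finally show ?thesis .
qed

text \<open>
In a solution of \<open>a1 + b1 = a2 + b2\<close> in which one variable vanishes, two of the other three determine the third.
\<close>

lemma additive_energy_delete_zero:
  assumes A: "A \<subseteq> carrier R"
  shows "additive_energy R A \<le> additive_energy R (A - {\<zero>}) + 4 * card A ^ 2"
proof -
  define Q where "Q = {(a1, a2, b1, b2). a1 \<in> A \<and> a2 \<in> A \<and> b1 \<in> A \<and> b2 \<in> A \<and> a1 \<oplus> b1 = a2 \<oplus> b2}"
  have finA: "finite A" using A by (rule finite_subset_carrier)
  have bound: "card T \<le> card A ^ 2" if "T = (\<lambda>(x, y). f x y) ` {p \<in> A \<times> A. h p}" for T and f :: "'a \<Rightarrow> 'a \<Rightarrow> 'a \<times> 'a \<times> 'a \<times> 'a" and h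
  proof -
    have "card T \<le> card {p \<in> A \<times> A. h p}" unfolding that using finA by (intro card_image_le) auto
    also have "\<dots> \<le> card (A \<times> A)" using finA by (intro card_mono) auto
    finally show ?thesis by (simp add: card_cartesian_product power2_eq_square)
  qed
  let ?Q1 = "(\<lambda>(x, y). (\<zero>, x, x \<oplus> y, y)) ` {p \<in> A \<times> A. True}"
  let ?Q2 = "(\<lambda>(x, y). (x, \<zero>, y, x \<oplus> y)) ` {p \<in> A \<times> A. True}"
  let ?Q3 = "(\<lambda>(x, y). (x \<oplus> y, x, \<zero>, y)) ` {p \<in> A \<times> A. True}"
  let ?Q4 = "(\<lambda>(x, y). (x, x \<oplus> y, y, \<zero>)) ` {p \<in> A \<times> A. True}"
  let ?Q0 = "{(a1, a2, b1, b2). a1 \<in> A - {\<zero>} \<and> a2 \<in> A - {\<zero>} \<and> b1 \<in> A - {\<zero>} \<and> b2 \<in> A - {\<zero>} \<and> a1 \<oplus> b1 = a2 \<oplus> b2}"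
  have "Q \<subseteq> ?Q0 \<union> (?Q1 \<union> (?Q2 \<union> (?Q3 \<union> ?Q4)))"
  proof
    fix r assume r: "r \<in> Q"
    then obtain a1 a2 b1 b2 where r: "r = (a1, a2, b1, b2)" "a1 \<in> A" "a2 \<in> A" "b1 \<in> A" "b2 \<in> A"
        "a1 \<oplus> b1 = a2 \<oplus> b2" by (auto simp: Q_def)
    have c: "a1 \<in> carrier R" "a2 \<in> carrier R" "b1 \<in> carrier R" "b2 \<in> carrier R" using r A by auto
    consider "a1 = \<zero>" | "a2 = \<zero>" | "b1 = \<zero>" | "b2 = \<zero>" | "a1 \<noteq> \<zero>" "a2 \<noteq> \<zero>" "b1 \<noteq> \<zero>" "b2 \<noteq> \<zero>" by blast
    then show "r \<in> ?Q0 \<union> (?Q1 \<union> (?Q2 \<union> (?Q3 \<union> ?Q4)))"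
    proof cases
      case 1
      then have "r \<in> ?Q1" using r c by (auto intro!: image_eqI[of _ _ "(a2, b2)"])
      then show ?thesis by blast
    next
      case 2
      then have "r \<in> ?Q2" using r c by (auto intro!: image_eqI[of _ _ "(a1, b1)"])
      then show ?thesis by blast
    next
      case 3
      then have "r \<in> ?Q3" using r c by (auto intro!: image_eqI[of _ _ "(a2, b2)"])
      then show ?thesis by blast
    next
      case 4
      then have "r \<in> ?Q4" using r c by (auto intro!: image_eqI[of _ _ "(a1, b1)"])
      then show ?thesis by blast
    next
      case 5
      then show ?thesis using r by auto
    qed
  qed
  moreover have "finite ?Q0"
    by (rule finite_subset[of _ "A \<times> A \<times> A \<times> A"]) (auto simp: finA)
  ultimately have "card Q \<le> card (?Q0 \<union> (?Q1 \<union> (?Q2 \<union> (?Q3 \<union> ?Q4))))"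
    using finA by (intro card_mono) auto
  also have "\<dots> \<le> card ?Q0 + (card ?Q1 + (card ?Q2 + (card ?Q3 + card ?Q4)))"
    by (intro order_trans[OF card_Un_le] add_left_mono order.refl)
  also have "\<dots> \<le> card ?Q0 + 4 * card A ^ 2"
    using bound[OF refl, of "\<lambda>x y. (\<zero>, x, x \<oplus> y, y)" "\<lambda>_. True"]
      bound[OF refl, of "\<lambda>x y. (x, \<zero>, y, x \<oplus> y)" "\<lambda>_. True"]
      bound[OF refl, of "\<lambda>x y. (x \<oplus> y, x, \<zero>, y)" "\<lambda>_. True"]
      bound[OF refl, of "\<lambda>x y. (x, x \<oplus> y, y, \<zero>)" "\<lambda>_. True"] by linarith
  finally show ?thesis by (simp add: additive_energy_def Q_def)
qed

lemma exists_popular_vertex: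
  assumes V: "V \<subseteq> carrier R" "V \<noteq> {}" and S: "S \<subseteq> carrier R"
  shows "\<exists>x\<in>V. (\<Sum>s\<in>S. reps V s) \<le> card V * card {y \<in> V. x \<ominus> y \<in> S}"
proof (rule ccontr)
  assume "\<not> ?thesis"
  then have lt: "card V * card {y \<in> V. x \<ominus> y \<in> S} < (\<Sum>s\<in>S. reps V s)" if "x \<in> V" for x
    using that by auto
  have finV: "finite V" using V by (auto intro: finite_subset_carrier)
  have "{p \<in> V \<times> V. fst p \<ominus> snd p \<in> S} = (SIGMA x:V. {y \<in> V. x \<ominus> y \<in> S})" by auto
  then have "(\<Sum>s\<in>S. reps V s) = (\<Sum>x\<in>V. card {y \<in> V. x \<ominus> y \<in> S})"
    using finV V S by (simp add: sum_reps)
  then have "card V * (\<Sum>s\<in>S. reps V s) = (\<Sum>x\<in>V. card V * card {y \<in> V. x \<ominus> y \<in> S})"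
    by (simp add: sum_distrib_left)
  also have "\<dots> < (\<Sum>x\<in>V. \<Sum>s\<in>S. reps V s)"
    using finV V lt by (intro sum_strict_mono) auto
  finally show False by simp
qed

end

section \<open>Dilates of a set with many popular differences\<close>

context finite_field
begin

lemma carrier_units_of: "carrier (units_of R) = carrier R - {\<zero>}"
  by (simp add: units_of_carrier field_Units)

abbreviation common_multiples :: "'a set \<Rightarrow> 'a \<Rightarrow> 'a \<Rightarrow> nat" where
  "common_multiples T b u \<equiv> comm_group.common (units_of R) T b u"

lemma common_multiples_def: "common_multiples T b u = card {p \<in> T \<times> T. b \<otimes> fst p = u \<otimes> snd p}"
  using comm_group.common_def[OF units_comm_group, of T b u] by (simp add: units_of_mult)

text \<open>
A pair \<open>p = (u, u')\<close> in \<open>P\<close> is a common element \<open>z = b u = a u'\<close> of \<open>b T\<close> and \<open>a T\<close>. A coincidence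
\<open>x v = u v'\<close> gives \<open>b x - z = b x (1 - v) - b u (1 - v')\<close>, a difference of two elements of \<open>S\<close>, and in the same
way a coincidence \<open>y w = u' w'\<close> treats \<open>a y - z\<close>. So each choice of these data represents \<open>b x - a y\<close> by four
elements of \<open>S\<close>, and the data can be read off from the four elements.
\<close>

lemma link_count:
  fixes \<zeta> :: real
  assumes T: "T \<subseteq> carrier R - {\<zero>}" and S: "S \<subseteq> carrier R"
    and TTS: "\<And>t u v. t \<in> T \<Longrightarrow> u \<in> T \<Longrightarrow> v \<in> T \<Longrightarrow> t \<otimes> u \<otimes> (\<one> \<ominus> v) \<in> S"
    and mem: "a \<in> T" "b \<in> T" "x \<in> T" "y \<in> T"
    and P: "P \<subseteq> {p \<in> T \<times> T. b \<otimes> fst p = a \<otimes> snd p}"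
    and \<zeta>: "0 \<le> \<zeta>"
    and pop: "\<And>p. p \<in> P \<Longrightarrow> \<zeta> \<le> real (common_multiples T x (fst p))"
      "\<And>p. p \<in> P \<Longrightarrow> \<zeta> \<le> real (common_multiples T y (snd p))"
  shows "real (card P) * \<zeta>\<^sup>2
    \<le> real (card {q \<in> S \<times> S \<times> S \<times> S. (\<lambda>(s1, s2, s3, s4). (s1 \<ominus> s2) \<ominus> (s3 \<ominus> s4)) q = b \<otimes> x \<ominus> a \<otimes> y})"
proof -
  define C where "C = (\<lambda>x u. {p \<in> T \<times> T. x \<otimes> fst p = u \<otimes> snd p})"
  define D where "D = (SIGMA p:P. C x (fst p) \<times> C y (snd p))"
  define F where "F = {q \<in> S \<times> S \<times> S \<times> S. (\<lambda>(s1, s2, s3, s4). (s1 \<ominus> s2) \<ominus> (s3 \<ominus> s4)) q = b \<otimes> x \<ominus> a \<otimes> y}"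
  define \<phi> where "\<phi> = (\<lambda>((u, u'), (v, v'), (w, w')).
    (b \<otimes> x \<otimes> (\<one> \<ominus> v), b \<otimes> u \<otimes> (\<one> \<ominus> v'), a \<otimes> y \<otimes> (\<one> \<ominus> w), a \<otimes> u' \<otimes> (\<one> \<ominus> w')))"
  have finT: "finite T" using T by (auto intro: finite_subset_carrier)
  have finC: "finite (C x u)" for x u using finT by (simp add: C_def)
  have finP: "finite P" using finite_subset[OF P] finT by simp
  have Tc: "\<And>t. t \<in> T \<Longrightarrow> t \<in> carrier R" "\<And>t. t \<in> T \<Longrightarrow> t \<noteq> \<zero>" using T by auto
  have one_minus_inj: "v = w" if "\<one> \<ominus> v = \<one> \<ominus> w" "v \<in> carrier R" "w \<in> carrier R" for v w
  proof -
    have "v = \<one> \<ominus> (\<one> \<ominus> v)" using that(2) by algebra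
    also have "\<dots> = w" unfolding that(1) using that(2,3) by algebra
    finally show ?thesis .
  qed
  have expand: "c \<otimes> u \<otimes> (\<one> \<ominus> v) = c \<otimes> u \<ominus> c \<otimes> (u \<otimes> v)" if "c \<in> T" "u \<in> T" "v \<in> T" for c u v
  proof -
    have "c \<in> carrier R" "u \<in> carrier R" "v \<in> carrier R" using that Tc by auto
    then show ?thesis by algebra
  qed
  have DT: "u \<in> T" "u' \<in> T" "v \<in> T" "v' \<in> T" "w \<in> T" "w' \<in> T"
      "b \<otimes> u = a \<otimes> u'" "x \<otimes> v = u \<otimes> v'" "y \<otimes> w = u' \<otimes> w'"
    if "((u, u'), (v, v'), (w, w')) \<in> D" for u u' v v' w w'
    using that P by (auto simp: D_def C_def)
  have "inj_on \<phi> D"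
  proof (rule inj_onI)
    fix d d2 assume d: "d \<in> D" and d2: "d2 \<in> D" and eq: "\<phi> d = \<phi> d2"
    obtain u u' v v' w w' where dd: "d = ((u, u'), (v, v'), (w, w'))" by (metis surj_pair)
    obtain u2 u2' v2 v2' w2 w2' where dd2: "d2 = ((u2, u2'), (v2, v2'), (w2, w2'))" by (metis surj_pair)
    note h = DT[OF d[unfolded dd]] and h2 = DT[OF d2[unfolded dd2]]
    have e: "b \<otimes> x \<otimes> (\<one> \<ominus> v) = b \<otimes> x \<otimes> (\<one> \<ominus> v2)" "b \<otimes> u \<otimes> (\<one> \<ominus> v') = b \<otimes> u2 \<otimes> (\<one> \<ominus> v2')"
        "a \<otimes> y \<otimes> (\<one> \<ominus> w) = a \<otimes> y \<otimes> (\<one> \<ominus> w2)"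
      using eq by (auto simp: \<phi>_def dd dd2)
    note c = h(1-6)[THEN Tc(1)] h2(1-6)[THEN Tc(1)] mem[THEN Tc(1)]
    note n = h(1-6)[THEN Tc(2)] h2(1-6)[THEN Tc(2)] mem[THEN Tc(2)]
    have "b \<otimes> x \<noteq> \<zero>" "a \<otimes> y \<noteq> \<zero>" using c n integral by blast+
    then have "\<one> \<ominus> v = \<one> \<ominus> v2" "\<one> \<ominus> w = \<one> \<ominus> w2"
      using e c by (metis m_lcancel m_closed minus_closed one_closed)+
    then have v: "v = v2" and w: "w = w2" using one_minus_inj c by auto
    have "b \<otimes> u \<ominus> b \<otimes> (x \<otimes> v) = b \<otimes> u2 \<ominus> b \<otimes> (x \<otimes> v)"
      using e(2) expand[OF mem(2) h(1) h(4)] expand[OF mem(2) h2(1) h2(4)] by (simp only: h(8)[symmetric] h2(8)[symmetric] v)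
    moreover have "b \<otimes> u \<in> carrier R" "b \<otimes> u2 \<in> carrier R" "b \<otimes> (x \<otimes> v) \<in> carrier R" using c by auto
    ultimately have "b \<otimes> u = b \<otimes> u2" by (metis a_minus_def a_inv_closed add.right_cancel)
    then have u: "u = u2" using c n by (metis m_lcancel)
    have "a \<otimes> u' = a \<otimes> u2'" using h(7) h2(7) u by simp
    then have u': "u' = u2'" using c n by (metis m_lcancel)
    have "u \<otimes> v' = u \<otimes> v2'" using h(8) h2(8) u v by simp
    then have v': "v' = v2'" using c n by (metis m_lcancel)
    have "u' \<otimes> w' = u' \<otimes> w2'" using h(9) h2(9) u' w by simp
    then have w': "w' = w2'" using c n by (metis m_lcancel)
    show "d = d2" using dd dd2 u u' v v' w w' by simp
  qed
  moreover have "\<phi> ` D \<subseteq> F"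
  proof
    fix q assume "q \<in> \<phi> ` D"
    then obtain d where d: "d \<in> D" and q: "q = \<phi> d" by auto
    obtain u u' v v' w w' where dd: "d = ((u, u'), (v, v'), (w, w'))" by (metis surj_pair)
    note h = DT[OF d[unfolded dd]]
    note c = h(1-6)[THEN Tc(1)] mem[THEN Tc(1)]
    have "(b \<otimes> x \<otimes> (\<one> \<ominus> v) \<ominus> b \<otimes> u \<otimes> (\<one> \<ominus> v')) \<ominus> (a \<otimes> y \<otimes> (\<one> \<ominus> w) \<ominus> a \<otimes> u' \<otimes> (\<one> \<ominus> w'))
        = ((b \<otimes> x \<ominus> b \<otimes> (x \<otimes> v)) \<ominus> (b \<otimes> u \<ominus> b \<otimes> (x \<otimes> v)))
          \<ominus> ((a \<otimes> y \<ominus> a \<otimes> (y \<otimes> w)) \<ominus> (b \<otimes> u \<ominus> a \<otimes> (y \<otimes> w)))"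
      unfolding expand[OF mem(2,3) h(3)] expand[OF mem(2) h(1,4)] expand[OF mem(1,4) h(5)] expand[OF mem(1) h(2,6)]
      unfolding h(8)[symmetric] h(9)[symmetric] h(7)[symmetric] ..
    also have "\<dots> = b \<otimes> x \<ominus> a \<otimes> y" using c by algebra
    finally show "q \<in> F" using h mem TTS by (simp add: F_def q dd \<phi>_def)
  qed
  moreover have "finite F"
    using finite_subset_carrier[OF S] by (auto simp: F_def)
  ultimately have "card D \<le> card F" by (intro card_inj_on_le)
  have "real (card P) * \<zeta>\<^sup>2 = (\<Sum>p\<in>P. \<zeta> * \<zeta>)" by (simp add: power2_eq_square)
  also have "\<dots> \<le> (\<Sum>p\<in>P. real (card (C x (fst p))) * real (card (C y (snd p))))"
    using pop \<zeta> by (intro sum_mono mult_mono) (auto simp: C_def common_multiples_def)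
  also have "\<dots> = real (card D)"
    using finP finC by (simp add: D_def card_SigmaI card_cartesian_product)
  also have "\<dots> \<le> real (card F)" using \<open>card D \<le> card F\<close> by simp
  finally show ?thesis by (simp add: F_def)
qed

text \<open>
All but few pairs in \<open>T\<close> have a popular quotient, by \<open>card_unpopular_pairs\<close>. Two thresholds are used. With \<open>\<eta>\<close> of
order \<open>|T|\<^sup>2 / Q\<close>, a positive proportion of the elements \<open>b\<close> has \<open>\<eta>\<close> coincidences with one fixed \<open>a\<close>. With the
smaller \<open>\<zeta>\<close> there are so few bad pairs that, for most \<open>x\<close>, at most \<open>\<eta> / 3\<close> elements of \<open>T\<close> are bad for
\<open>x\<close>; hence at least \<open>\<eta> / 3\<close> of the common elements of \<open>b T\<close> and \<open>a T\<close> can be used in \<open>link_count\<close> for given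
\<open>x\<close> and \<open>y\<close>. Every difference \<open>b x - a y\<close> then has at least \<open>\<eta> / 3 * \<zeta>\<^sup>2\<close> representations by quadruples from \<open>S\<close>.
\<close>

lemma dilate_differences:
  fixes Q :: real
  assumes T: "T \<subseteq> carrier R - {\<zero>}" "T \<noteq> {}" and S: "S \<subseteq> carrier R"
    and TTS: "\<And>t u v. t \<in> T \<Longrightarrow> u \<in> T \<Longrightarrow> v \<in> T \<Longrightarrow> t \<otimes> u \<otimes> (\<one> \<ominus> v) \<in> S"
    and Q: "real (card (quotient_set (units_of R) T T)) \<le> Q"
  shows "\<exists>B a. B \<subseteq> T \<and> a \<in> B \<and> card T \<le> 2 * card B \<and>
    (\<forall>b\<in>B. real (card ((\<lambda>(x, y). b \<otimes> x \<ominus> a \<otimes> y) ` (B \<times> B))) * real (card T) ^ 8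
      \<le> 221184 * real (card S) ^ 4 * Q ^ 5)"
proof -
  interpret U: comm_group "units_of R" by (rule units_comm_group)
  define \<tau> where "\<tau> = real (card T)"
  have finT: "finite T" using T by (auto intro: finite_subset_carrier)
  have TU: "T \<subseteq> carrier (units_of R)" using T by (simp add: carrier_units_of)
  have \<tau>: "\<tau> > 0" using finT T by (simp add: \<tau>_def card_gt_0_iff)
  have "\<tau> \<le> Q" using U.card_le_quotient_set[OF finT TU] Q by (simp add: \<tau>_def)
  then have Q0: "Q > 0" using \<tau> by simp
  define \<eta> where "\<eta> = \<tau>\<^sup>2 / (8 * Q)"
  define \<zeta> where "\<zeta> = \<eta> * \<tau> / (12 * Q)"
  have \<eta>0: "\<eta> > 0" and \<zeta>0: "\<zeta> > 0" using \<tau> Q0 by (auto simp: \<eta>_def \<zeta>_def)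
  define bad where "bad = (\<lambda>b u. real (common_multiples T b u) < \<zeta>)"
  define low where "low = (\<lambda>b u. real (common_multiples T b u) < \<eta>)"
  define B3 where "B3 = {b \<in> T. real (card {u \<in> T. bad b u}) \<le> \<eta> / 3}"
  have few: "real (\<Sum>b\<in>V. card {u \<in> W. real (common_multiples T b u) < \<epsilon>}) \<le> \<epsilon> * Q"
    if "0 \<le> \<epsilon>" "V \<subseteq> T" "W \<subseteq> T" for \<epsilon> V W
  proof -
    have fin: "finite V" "finite W" using that finT finite_subset by auto
    have "(\<Sum>b\<in>V. card {u \<in> W. real (common_multiples T b u) < \<epsilon>})
        = card (SIGMA b:V. {u \<in> W. real (common_multiples T b u) < \<epsilon>})" using fin by simp
    also have "\<dots> \<le> card {q \<in> T \<times> T. real (U.common T (fst q) (snd q)) < \<epsilon>}"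
      using finT that by (intro card_mono) auto
    finally have "real (\<Sum>b\<in>V. card {u \<in> W. real (common_multiples T b u) < \<epsilon>})
        \<le> \<epsilon> * real (card (quotient_set (units_of R) T T))"
      using U.card_unpopular_pairs[OF finT TU that(1)] by linarith
    also have "\<dots> \<le> \<epsilon> * Q" using Q that(1) by (rule mult_left_mono)
    finally show ?thesis .
  qed
  \<comment> \<open>By the choice of \<open>\<zeta>\<close>, at most a quarter of \<open>T\<close> has many bad partners.\<close>
  have B3T: "B3 \<subseteq> T" by (auto simp: B3_def)
  have "real (card (T - B3)) * (\<eta> / 3) = (\<Sum>b\<in>T - B3. \<eta> / 3)" by simp
  also have "\<dots> \<le> (\<Sum>b\<in>T - B3. real (card {u \<in> T. bad b u}))"
    by (intro sum_mono) (auto simp: B3_def)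
  also have "\<dots> \<le> \<zeta> * Q"
    using few[of \<zeta> "T - B3" T] \<zeta>0 by (simp add: bad_def)
  also have "\<dots> = (\<tau> / 4) * (\<eta> / 3)" using Q0 by (simp add: \<zeta>_def)
  finally have "real (card (T - B3)) \<le> \<tau> / 4"
    using \<eta>0 by (metis divide_pos_pos mult_le_cancel_right_pos zero_less_numeral)
  moreover have "card T = card (T - B3) + card B3"
    using finT B3T by (metis card_Diff_subset card_mono finite_subset le_add_diff_inverse2)
  ultimately have B3card: "3 * \<tau> / 4 \<le> real (card B3)" by (simp add: \<tau>_def)
  \<comment> \<open>By the choice of \<open>\<eta>\<close>, at most \<open>\<tau>\<^sup>2 / 8\<close> pairs have few coincidences.\<close>
  have "\<exists>a\<in>B3. real (card {b \<in> B3. low a b}) \<le> \<tau> / 6"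
  proof (rule ccontr)
    assume "\<not> ?thesis"
    then have gt: "\<tau> / 6 < real (card {b \<in> B3. low a b})" if "a \<in> B3" for a using that by auto
    have "\<tau> / 6 * (3 * \<tau> / 4) \<le> \<tau> / 6 * real (card B3)" using B3card \<tau> by (intro mult_left_mono) auto
    also have "\<dots> = (\<Sum>a\<in>B3. \<tau> / 6)" by simp
    also have "\<dots> < (\<Sum>a\<in>B3. real (card {b \<in> B3. low a b}))"
      using gt finT B3T finite_subset B3card \<tau> by (intro sum_strict_mono) (auto intro: finite_subset)
    also have "\<dots> \<le> \<eta> * Q" using few[of \<eta> B3 B3] B3T \<eta>0 by (simp add: low_def)
    also have "\<dots> = \<tau>\<^sup>2 / 8" using Q0 by (simp add: \<eta>_def)
    finally show False by (simp add: power2_eq_square)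
  qed
  then obtain a where a: "a \<in> B3" and alow: "real (card {b \<in> B3. low a b}) \<le> \<tau> / 6" by auto
  define B where "B = {b \<in> B3. \<not> low a b}"
  have finB3: "finite B3" using B3T finT by (rule finite_subset)
  have "card B3 = card {b \<in> B3. low a b} + card B"
    using finB3 by (subst card_Un_disjoint[symmetric]) (auto simp: B_def intro!: arg_cong[where f = card])
  then have Bcard: "card T \<le> 2 * card B" using alow B3card \<tau> by (simp add: \<tau>_def)
  have comm: "common_multiples T b u = common_multiples T u b" for b u
    unfolding common_multiples_def
    by (rule bij_betw_same_card[where f = prod.swap], rule bij_betw_byWitness[where f' = prod.swap]) auto
  have "common_multiples T a a = card T"
  proof -
    have "a \<in> carrier R" "a \<noteq> \<zero>" using a B3T T by auto
    then have "{p \<in> T \<times> T. a \<otimes> fst p = a \<otimes> snd p} = (\<lambda>t. (t, t)) ` T"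
      using T by (auto simp: m_lcancel subset_iff)
    then show ?thesis by (simp add: common_multiples_def card_image inj_on_def)
  qed
  moreover have "\<eta> \<le> \<tau>" using \<open>\<tau> \<le> Q\<close> \<tau> Q0 by (simp add: \<eta>_def power2_eq_square field_simps)
  ultimately have aB: "a \<in> B" using a by (simp add: B_def low_def \<tau>_def)
  have BT: "B \<subseteq> T" using B3T by (auto simp: B_def)
  have main: "real (card ((\<lambda>(x, y). b \<otimes> x \<ominus> a \<otimes> y) ` (B \<times> B))) * \<tau> ^ 8
      \<le> 221184 * real (card S) ^ 4 * Q ^ 5" if b: "b \<in> B" for b
  proof -
    let ?D = "(\<lambda>(x, y). b \<otimes> x \<ominus> a \<otimes> y) ` (B \<times> B)"
    let ?g = "\<lambda>(s1, s2, s3, s4). (s1 \<ominus> s2) \<ominus> (s3 \<ominus> s4)"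
    have finB: "finite B" using BT finT by (rule finite_subset)
    have fibre: "\<eta> / 3 * \<zeta>\<^sup>2 \<le> real (card {q \<in> S \<times> S \<times> S \<times> S. ?g q = d})" if d: "d \<in> ?D" for d
    proof -
      obtain x y where xy: "x \<in> B" "y \<in> B" "d = b \<otimes> x \<ominus> a \<otimes> y" using d by auto
      define P0 where "P0 = {p \<in> T \<times> T. b \<otimes> fst p = a \<otimes> snd p}"
      define P where "P = {p \<in> P0. \<not> bad x (fst p) \<and> \<not> bad y (snd p)}"
      have finP0: "finite P0" using finT by (simp add: P0_def)
      have nz: "a \<in> carrier R" "a \<noteq> \<zero>" "b \<in> carrier R" "b \<noteq> \<zero>" using aB b BT T by auto
      have "inj_on fst P0"
        using nz T by (auto simp: inj_on_def P0_def subset_iff) (metis m_lcancel)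
      then have "card {p \<in> P0. bad x (fst p)} \<le> card {u \<in> T. bad x u}"
        using finT by (intro card_inj_on_le[where f = fst]) (auto simp: P0_def inj_on_def)
      moreover have "inj_on snd P0"
        using nz T by (auto simp: inj_on_def P0_def subset_iff) (metis m_lcancel)
      then have "card {p \<in> P0. bad y (snd p)} \<le> card {u \<in> T. bad y u}"
        using finT by (intro card_inj_on_le[where f = snd]) (auto simp: P0_def inj_on_def)
      moreover have "real (card {u \<in> T. bad x u}) \<le> \<eta> / 3" "real (card {u \<in> T. bad y u}) \<le> \<eta> / 3"
        using xy by (auto simp: B_def B3_def)
      moreover have "card P0 \<le> card P + (card {p \<in> P0. bad x (fst p)} + card {p \<in> P0. bad y (snd p)})"
      proof -
        have "card P0 \<le> card (P \<union> ({p \<in> P0. bad x (fst p)} \<union> {p \<in> P0. bad y (snd p)}))"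
          using finP0 by (intro card_mono) (auto simp: P_def)
        also have "\<dots> \<le> card P + (card {p \<in> P0. bad x (fst p)} + card {p \<in> P0. bad y (snd p)})"
          by (intro order_trans[OF card_Un_le] add_left_mono order.refl)
        finally show ?thesis .
      qed
      moreover have "\<eta> \<le> real (card P0)"
        using b comm[of a b] by (simp add: B_def low_def P0_def common_multiples_def)
      ultimately have "\<eta> / 3 \<le> real (card P)" by linarith
      then have "\<eta> / 3 * \<zeta>\<^sup>2 \<le> real (card P) * \<zeta>\<^sup>2" by (intro mult_right_mono) auto
      also have "\<dots> \<le> real (card {q \<in> S \<times> S \<times> S \<times> S. ?g q = b \<otimes> x \<ominus> a \<otimes> y})"
      proof (rule link_count[OF T(1) S TTS])
        show "a \<in> T" "b \<in> T" "x \<in> T" "y \<in> T" using aB b xy BT by auto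
        show "P \<subseteq> {p \<in> T \<times> T. b \<otimes> fst p = a \<otimes> snd p}" by (auto simp: P_def P0_def)
        show "0 \<le> \<zeta>" using \<zeta>0 by simp
        show "\<zeta> \<le> real (common_multiples T x (fst p))" "\<zeta> \<le> real (common_multiples T y (snd p))"
          if "p \<in> P" for p
          using that by (auto simp: P_def bad_def)
      qed
      finally show ?thesis by (simp add: xy)
    qed
    have finS: "finite (S \<times> S \<times> S \<times> S)" using finite_subset_carrier[OF S] by simp
    have "real (card ?D) * (\<eta> / 3 * \<zeta>\<^sup>2) = (\<Sum>d\<in>?D. \<eta> / 3 * \<zeta>\<^sup>2)" by simp
    also have "\<dots> \<le> (\<Sum>d\<in>?D. real (card {q \<in> S \<times> S \<times> S \<times> S. ?g q = d}))"
      by (intro sum_mono fibre)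
    also have "\<dots> = real (card {q \<in> S \<times> S \<times> S \<times> S. ?g q \<in> ?D})"
      using sum_card_fibres[OF finS, of ?D ?g] finB by (simp flip: of_nat_sum)
    also have "\<dots> \<le> real (card (S \<times> S \<times> S \<times> S))"
      using finS by (intro of_nat_mono card_mono) auto
    also have "\<dots> = real (card S) ^ 4" by (simp add: card_cartesian_product power4_eq_xxxx)
    finally have "real (card ?D) * (\<eta> / 3 * \<zeta>\<^sup>2) \<le> real (card S) ^ 4" .
    moreover have "\<eta> / 3 * \<zeta>\<^sup>2 = \<tau> ^ 8 / (221184 * Q ^ 5)"
      using Q0 by (simp add: \<eta>_def \<zeta>_def power2_eq_square field_simps eval_nat_numeral)
    ultimately have "real (card ?D) * \<tau> ^ 8 / (221184 * Q ^ 5) \<le> real (card S) ^ 4" by simp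
    then show ?thesis using Q0 by (simp add: divide_le_eq mult_ac)
  qed
  show ?thesis
    using BT aB Bcard main by (auto simp: \<tau>_def)
qed

end

context finite_field
begin

text \<open>
The argument on quotients of differences needs \<open>1\<close> in the set. Dividing the set of \<open>dilate_differences\<close> by \<open>a\<close>
achieves this and replaces \<open>b B - a B\<close> by a dilate of itself.
\<close>

lemma normalised_dilate_differences:
  fixes Q :: real
  assumes T: "T \<subseteq> carrier R - {\<zero>}" "T \<noteq> {}" and S: "S \<subseteq> carrier R"
    and TTS: "\<And>t u v. t \<in> T \<Longrightarrow> u \<in> T \<Longrightarrow> v \<in> T \<Longrightarrow> t \<otimes> u \<otimes> (\<one> \<ominus> v) \<in> S"
    and Q: "real (card (quotient_set (units_of R) T T)) \<le> Q"
  shows "\<exists>B \<subseteq> quotient_set (units_of R) T T. \<one> \<in> B \<and> card T \<le> 2 * card B \<and>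
    (\<forall>b\<in>B. real (card ((\<lambda>(x, y). b \<otimes> x \<ominus> y) ` (B \<times> B))) * real (card T) ^ 8
      \<le> 221184 * real (card S) ^ 4 * Q ^ 5)"
proof -
  interpret U: comm_group "units_of R" by (rule units_comm_group)
  obtain D a where D: "D \<subseteq> T" "a \<in> D" "card T \<le> 2 * card D"
    and le: "\<And>b. b \<in> D \<Longrightarrow> real (card ((\<lambda>(x, y). b \<otimes> x \<ominus> a \<otimes> y) ` (D \<times> D))) * real (card T) ^ 8
      \<le> 221184 * real (card S) ^ 4 * Q ^ 5"
    using dilate_differences[OF T S TTS Q] by auto
  have ac: "a \<in> carrier R" "a \<noteq> \<zero>" and Dc: "D \<subseteq> carrier R - {\<zero>}" using D T by auto
  define i where "i = inv a"
  have i: "i \<in> carrier R" "a \<otimes> i = \<one>" "i \<otimes> a = \<one>" using ac inv_mem field_Units by (auto simp: i_def)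
  have i0: "i \<noteq> \<zero>" using i ac by auto
  define B where "B = (\<lambda>x. x \<otimes> i) ` D"
  have finD: "finite D" using Dc by (auto intro: finite_subset_carrier)
  have "inj_on (\<lambda>x. x \<otimes> i) D" using Dc i i0 by (auto simp: inj_on_def m_rcancel subset_iff)
  then have cardB: "card B = card D" by (simp add: B_def card_image)
  have "B \<subseteq> quotient_set (units_of R) T T"
  proof
    fix z assume "z \<in> B"
    then obtain x where x: "x \<in> D" "z = x \<otimes> i" by (auto simp: B_def)
    have "inv\<^bsub>units_of R\<^esub> a = i" using ac by (simp add: units_of_inv field_Units i_def)
    then have "z = (\<lambda>(p, q). p \<otimes>\<^bsub>units_of R\<^esub> inv\<^bsub>units_of R\<^esub> q) (x, a)" using x by (simp add: units_of_mult)
    then show "z \<in> quotient_set (units_of R) T T" unfolding quotient_set_def using x D by blast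
  qed
  moreover have "\<one> \<in> B" using D(2) i by (force simp: B_def)
  moreover have "real (card ((\<lambda>(x, y). b \<otimes> x \<ominus> y) ` (B \<times> B))) * real (card T) ^ 8
      \<le> 221184 * real (card S) ^ 4 * Q ^ 5" if b: "b \<in> B" for b
  proof -
    obtain d where d: "d \<in> D" "b = d \<otimes> i" using b by (auto simp: B_def)
    have dc: "d \<in> carrier R" using d Dc by auto
    have "(\<lambda>(x, y). b \<otimes> x \<ominus> y) ` (B \<times> B) \<subseteq> (\<lambda>w. i \<otimes> i \<otimes> w) ` ((\<lambda>(x, y). d \<otimes> x \<ominus> a \<otimes> y) ` (D \<times> D))"
    proof clarify
      fix x y assume "x \<in> B" "y \<in> B"
      then obtain x' y' where xy: "x' \<in> D" "y' \<in> D" "x = x' \<otimes> i" "y = y' \<otimes> i" by (auto simp: B_def)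
      have c: "x' \<in> carrier R" "y' \<in> carrier R" using xy Dc by auto
      have "i \<otimes> i \<otimes> (d \<otimes> x' \<ominus> a \<otimes> y') = (d \<otimes> i) \<otimes> (x' \<otimes> i) \<ominus> (a \<otimes> i) \<otimes> (y' \<otimes> i)"
        using c dc ac(1) i(1) by algebra
      also have "\<dots> = b \<otimes> x \<ominus> y" using i c by (simp add: xy d)
      finally show "b \<otimes> x \<ominus> y \<in> (\<lambda>w. i \<otimes> i \<otimes> w) ` ((\<lambda>(x, y). d \<otimes> x \<ominus> a \<otimes> y) ` (D \<times> D))"
        using xy by (metis (no_types, lifting) SigmaI case_prod_conv image_eqI)
    qed
    then have "card ((\<lambda>(x, y). b \<otimes> x \<ominus> y) ` (B \<times> B)) \<le> card ((\<lambda>w. i \<otimes> i \<otimes> w) ` ((\<lambda>(x, y). d \<otimes> x \<ominus> a \<otimes> y) ` (D \<times> D)))"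
      using finD by (intro card_mono) auto
    also have "\<dots> \<le> card ((\<lambda>(x, y). d \<otimes> x \<ominus> a \<otimes> y) ` (D \<times> D))" using finD by (intro card_image_le) auto
    finally have "real (card ((\<lambda>(x, y). b \<otimes> x \<ominus> y) ` (B \<times> B))) * real (card T) ^ 8
        \<le> real (card ((\<lambda>(x, y). d \<otimes> x \<ominus> a \<otimes> y) ` (D \<times> D))) * real (card T) ^ 8"
      by (intro mult_right_mono) auto
    then show ?thesis using le[OF d(1)] by linarith
  qed
  ultimately show ?thesis using D(3) cardB by (intro exI[of _ B]) auto
qed

text \<open>
Choose \<open>x\<^sub>0\<close> of at least average degree in the graph on \<open>H\<^sup>n\<close> whose edges are the popular differences, and divide its
neighbours by \<open>x\<^sub>0\<close>. For \<open>v = y / x\<^sub>0\<close> one has \<open>t u (1 - v) = (t u / x\<^sub>0) (x\<^sub>0 - y)\<close>, and the factor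
\<open>t u / x\<^sub>0\<close> is a product of \<open>2 n + 2 n + n\<close> elements of \<open>H\<close>; this is where the step from \<open>n\<close> to \<open>6 n\<close> comes from.
\<close>

lemma exists_neighbourhood:
  fixes H :: "'a set"
  defines "V \<equiv> set_power (units_of R) H"
  assumes H: "H \<subseteq> carrier R - {\<zero>}" "\<one> \<in> H" "\<And>h. h \<in> H \<Longrightarrow> inv h \<in> H"
    and pop: "popular (V n) \<theta> \<noteq> {}" and \<theta>: "0 < \<theta>"
  shows "\<exists>T \<subseteq> V (2 * n). T \<noteq> {} \<and>
    \<theta> * real (card (popular (V n) \<theta>)) \<le> real (card (V n)) * real (card T) \<and>
    (\<forall>t\<in>T. \<forall>u\<in>T. \<forall>v\<in>T. t \<otimes> u \<otimes> (\<one> \<ominus> v) \<in> popular (V (6 * n)) \<theta>)"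
proof -
  interpret U: comm_group "units_of R" by (rule units_comm_group)
  have HU: "H \<subseteq> carrier (units_of R)" using H by (simp add: carrier_units_of)
  have Vc: "V k \<subseteq> carrier R - {\<zero>}" for k
    using U.set_power_closed[OF HU, of k] by (simp add: V_def carrier_units_of)
  have Vmult: "x \<otimes> y \<in> V (j + k)" if "x \<in> V j" "y \<in> V k" for x y j k
    using U.set_power_mult_mem[OF HU] that by (simp add: V_def units_of_mult)
  have Vinv: "inv x \<in> V k" if "x \<in> V k" for x k
  proof -
    have "inv\<^bsub>units_of R\<^esub> h \<in> H" if "h \<in> H" for h
      using H that by (subst units_of_inv) (auto simp: field_Units)
    then have "inv\<^bsub>units_of R\<^esub> x \<in> V k" using U.set_power_inv_mem[OF HU] that by (simp add: V_def)
    moreover have "x \<in> Units R" using Vc that by (auto simp: field_Units)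
    ultimately show ?thesis by (simp add: units_of_inv)
  qed
  have "V n \<noteq> {}" using U.one_mem_set_power[of H n] H by (auto simp: V_def units_of_one)
  let ?S = "popular (V n) \<theta>"
  have Sc: "?S \<subseteq> carrier R" by (auto simp: popular_def)
  obtain x0 where x0: "x0 \<in> V n" and le: "(\<Sum>s\<in>?S. reps (V n) s) \<le> card (V n) * card {y \<in> V n. x0 \<ominus> y \<in> ?S}"
    using exists_popular_vertex[OF _ \<open>V n \<noteq> {}\<close> Sc] Vc[of n] by auto
  have x0c: "x0 \<in> carrier R" "x0 \<noteq> \<zero>" using x0 Vc by auto
  define i where "i = inv x0"
  have i: "i \<in> carrier R" "x0 \<otimes> i = \<one>" "i \<otimes> x0 = \<one>" "i \<in> V n"
    using x0c inv_mem field_Units Vinv[OF x0] by (auto simp: i_def)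
  have i0: "i \<noteq> \<zero>" using i Vc by auto
  define T where "T = (\<lambda>y. y \<otimes> i) ` {y \<in> V n. x0 \<ominus> y \<in> ?S}"
  have "inj_on (\<lambda>y. y \<otimes> i) {y \<in> V n. x0 \<ominus> y \<in> ?S}"
    using Vc[of n] i(1) i0 by (auto simp: inj_on_def m_rcancel subset_iff)
  then have cardT: "card T = card {y \<in> V n. x0 \<ominus> y \<in> ?S}" by (simp add: T_def card_image)
  have "\<theta> * real (card ?S) = (\<Sum>s\<in>?S. \<theta>)" by simp
  also have "\<dots> \<le> (\<Sum>s\<in>?S. real (reps (V n) s))" by (intro sum_mono) (simp add: popular_def)
  also have "\<dots> = real (\<Sum>s\<in>?S. reps (V n) s)" by simp
  also have "\<dots> \<le> real (card (V n) * card T)" unfolding cardT using le by (rule of_nat_mono)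
  finally have large: "\<theta> * real (card ?S) \<le> real (card (V n)) * real (card T)" by simp
  have "T \<noteq> {}"
  proof
    assume "T = {}"
    moreover have "finite ?S" using Sc by (rule finite_subset_carrier)
    then have "0 < \<theta> * real (card ?S)" using pop \<theta> by (simp add: card_gt_0_iff)
    ultimately show False using large by simp
  qed
  moreover have TV: "T \<subseteq> V (2 * n)" using i Vmult by (auto simp: T_def mult_2)
  moreover have "t \<otimes> u \<otimes> (\<one> \<ominus> v) \<in> popular (V (6 * n)) \<theta>" if mem: "t \<in> T" "u \<in> T" "v \<in> T" for t u v
  proof -
    obtain y where y: "y \<in> V n" "x0 \<ominus> y \<in> ?S" "v = y \<otimes> i" using mem(3) by (auto simp: T_def)
    have yc: "y \<in> carrier R" using y Vc by auto
    have tu: "t \<in> V (2 * n)" "u \<in> V (2 * n)" using mem TV by auto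
    have tuc: "t \<in> carrier R" "u \<in> carrier R" using tu Vc by auto
    have h: "t \<otimes> u \<otimes> i \<in> V (5 * n)" using Vmult[OF Vmult[OF tu] i(4)] by (simp add: algebra_simps)
    have "t \<otimes> u \<otimes> i \<otimes> (x0 \<ominus> y) \<in> popular (V (6 * n)) \<theta>"
    proof (rule popular_mult[OF _ _ _ _ _ y(2)])
      show "V n \<subseteq> carrier R" "V (6 * n) \<subseteq> carrier R" "t \<otimes> u \<otimes> i \<in> carrier R" "t \<otimes> u \<otimes> i \<noteq> \<zero>"
        using Vc h by auto
      show "t \<otimes> u \<otimes> i \<otimes> x \<in> V (6 * n)" if "x \<in> V n" for x
        using Vmult[OF h that] by (simp add: algebra_simps)
    qed
    also have "t \<otimes> u \<otimes> i \<otimes> (x0 \<ominus> y) = t \<otimes> u \<otimes> (x0 \<otimes> i \<ominus> y \<otimes> i)" using tuc i(1) x0c(1) yc by algebra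
    also have "\<dots> = t \<otimes> u \<otimes> (\<one> \<ominus> v)" using i y by simp
    finally show ?thesis .
  qed
  ultimately show ?thesis using large by (intro exI[of _ T]) auto
qed

end

section \<open>Growth under dilation, or a subfield\<close>

text \<open>
The Cauchy--Schwarz inequality for the fibre sizes of \<open>f\<close>, as nonnegativity of their variance.
\<close>

lemma card_squared_le_image_times_collisions:
  assumes "finite P"
  shows "real (card P) ^ 2 \<le> real (card (f ` P)) * real (card {r \<in> P \<times> P. f (fst r) = f (snd r)})"
proof (cases "P = {}")
  case False
  define n where "n = (\<lambda>d. real (card {p \<in> P. f p = d}))"
  let ?D = "f ` P"
  have fin: "finite ?D" using assms by simp
  have pos: "real (card ?D) > 0" using False fin by (simp add: card_gt_0_iff)
  have "(\<Sum>d\<in>?D. card {p \<in> P. f p = d}) = card {p \<in> P. f p \<in> ?D}"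
    using assms fin by (rule sum_card_fibres)
  also have "{p \<in> P. f p \<in> ?D} = P" by auto
  finally have sum_n: "(\<Sum>d\<in>?D. n d) = real (card P)" by (simp add: n_def flip: of_nat_sum)
  have square: "card {r \<in> {r \<in> P \<times> P. f (fst r) = f (snd r)}. f (fst r) = d} = card {p \<in> P. f p = d} ^ 2" for d
  proof -
    have "{r \<in> {r \<in> P \<times> P. f (fst r) = f (snd r)}. f (fst r) = d} = {p \<in> P. f p = d} \<times> {p \<in> P. f p = d}"
      by auto
    then show ?thesis by (simp add: card_cartesian_product power2_eq_square)
  qed
  have "(\<Sum>d\<in>?D. card {r \<in> {r \<in> P \<times> P. f (fst r) = f (snd r)}. f (fst r) = d})
      = card {r \<in> {r \<in> P \<times> P. f (fst r) = f (snd r)}. f (fst r) \<in> ?D}"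
    using assms fin by (intro sum_card_fibres) auto
  also have "{r \<in> {r \<in> P \<times> P. f (fst r) = f (snd r)}. f (fst r) \<in> ?D} = {r \<in> P \<times> P. f (fst r) = f (snd r)}"
    by auto
  finally have "(\<Sum>d\<in>?D. card {p \<in> P. f p = d} ^ 2) = card {r \<in> P \<times> P. f (fst r) = f (snd r)}"
    by (simp only: square)
  then have sum_sq: "(\<Sum>d\<in>?D. n d ^ 2) = real (card {r \<in> P \<times> P. f (fst r) = f (snd r)})"
    by (simp add: n_def flip: of_nat_sum of_nat_power)
  define m where "m = real (card P) / real (card ?D)"
  have "0 \<le> (\<Sum>d\<in>?D. (n d - m) ^ 2)" by (intro sum_nonneg) simp
  also have "\<dots> = (\<Sum>d\<in>?D. n d ^ 2) - 2 * m * (\<Sum>d\<in>?D. n d) + real (card ?D) * m ^ 2"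
    by (simp add: power2_diff sum.distrib sum_subtractf sum_distrib_left mult_ac)
  also have "\<dots> = (\<Sum>d\<in>?D. n d ^ 2) - real (card P) ^ 2 / real (card ?D)"
    using pos by (simp add: sum_n m_def power2_eq_square field_simps)
  finally have "real (card P) ^ 2 / real (card ?D) \<le> (\<Sum>d\<in>?D. n d ^ 2)" by simp
  then show ?thesis using pos by (simp add: sum_sq divide_le_eq mult.commute)
qed simp

context finite_field
begin

definition diff_quotients :: "'a set \<Rightarrow> 'a set" where
  "diff_quotients B = {(a \<ominus> b) \<otimes> inv (c \<ominus> d) | a b c d. a \<in> B \<and> b \<in> B \<and> c \<in> B \<and> d \<in> B \<and> c \<noteq> d}"

lemma diff_quotients_carrier:
  assumes B: "B \<subseteq> carrier R"
  shows "diff_quotients B \<subseteq> carrier R"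
proof
  fix r assume "r \<in> diff_quotients B"
  then obtain a b c d where r: "r = (a \<ominus> b) \<otimes> inv (c \<ominus> d)" "a \<in> B" "b \<in> B" "c \<in> B" "d \<in> B" "c \<noteq> d"
    by (auto simp: diff_quotients_def)
  have c: "a \<in> carrier R" "b \<in> carrier R" "c \<in> carrier R" "d \<in> carrier R" using r B by auto
  then have "c \<ominus> d \<noteq> \<zero>" using r by (simp add: minus_eq_zero_iff)
  then show "r \<in> carrier R" using c r by (simp add: inv_mem)
qed

text \<open>
The translations that preserve \<open>Q\<close> form an additive group \<open>A\<close> that contains \<open>1\<close> and, as \<open>B\<close> permutes \<open>Q\<close>, is
closed under multiplication by \<open>B\<close>. The multipliers of \<open>A\<close> form a finite subring \<open>G\<close> of a field, hence a
subfield, and \<open>B \<subseteq> G\<close>. Finally \<open>G \<subseteq> A\<close> because \<open>1 \<in> A\<close>, \<open>A \<subseteq> Q\<close> because \<open>0 \<in> Q\<close>, and \<open>Q \<subseteq> G\<close>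
because \<open>Q\<close> consists of quotients of differences of elements of \<open>B\<close>; so all three sets agree.
\<close>

lemma stable_subset_is_subfield:
  assumes B: "B \<subseteq> carrier R - {\<zero>}" "\<one> \<in> B"
    and Q: "Q \<subseteq> diff_quotients B" "\<zero> \<in> Q"
    and mult: "\<And>b r. b \<in> B \<Longrightarrow> r \<in> Q \<Longrightarrow> b \<otimes> r \<in> Q"
    and add_one: "\<And>r. r \<in> Q \<Longrightarrow> \<one> \<oplus> r \<in> Q"
  shows "subfield Q R \<and> B \<subseteq> Q"
proof -
  have Bc: "B \<subseteq> carrier R" using B by auto
  have Qc: "Q \<subseteq> carrier R" using Q(1) diff_quotients_carrier[OF Bc] by blast
  have finQ: "finite Q" using Qc by (rule finite_subset_carrier)
  define A where "A = {x \<in> carrier R. \<forall>r\<in>Q. x \<oplus> r \<in> Q}"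
  define G where "G = {x \<in> carrier R. \<forall>y\<in>A. x \<otimes> y \<in> A}"
  have Ac: "A \<subseteq> carrier R" and Gc: "G \<subseteq> carrier R" by (auto simp: A_def G_def)
  have A0: "\<zero> \<in> A" and A1: "\<one> \<in> A" using Qc add_one by (auto simp: A_def)
  have Aadd: "x \<oplus> y \<in> A" if "x \<in> A" "y \<in> A" for x y
  proof -
    have "x \<oplus> y \<oplus> r \<in> Q" if r: "r \<in> Q" for r
    proof -
      have "x \<oplus> y \<oplus> r = x \<oplus> (y \<oplus> r)" using \<open>x \<in> A\<close> \<open>y \<in> A\<close> r Ac Qc by (intro a_assoc) auto
      then show ?thesis using \<open>x \<in> A\<close> \<open>y \<in> A\<close> r by (simp add: A_def)
    qed
    then show ?thesis using that Ac by (auto simp: A_def)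
  qed
  have Aneg: "\<ominus> x \<in> A" if x: "x \<in> A" for x
  proof -
    have xc: "x \<in> carrier R" using x Ac by auto
    have "inj_on ((\<oplus>) x) A" using xc Ac by (auto simp: inj_on_def subset_iff)
    then have "(\<oplus>) x ` A = A"
      using Aadd x finite_subset_carrier[OF Ac] by (intro endo_inj_surj) auto
    then obtain y where y: "y \<in> A" "x \<oplus> y = \<zero>" using A0 by (metis imageE)
    then have "y = \<ominus> x" using xc Ac by (metis add.inv_equality add.m_comm subsetD)
    then show ?thesis using y by simp
  qed
  have AB: "b \<otimes> x \<in> A" if b: "b \<in> B" and x: "x \<in> A" for b x
  proof -
    have bc: "b \<in> carrier R" "b \<noteq> \<zero>" and xc: "x \<in> carrier R" using b x B Ac by auto
    have "inj_on ((\<otimes>) b) Q" using bc Qc by (auto simp: inj_on_def m_lcancel subset_iff)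
    then have img: "(\<otimes>) b ` Q = Q" using finQ mult b by (intro endo_inj_surj) auto
    have "b \<otimes> x \<oplus> r \<in> Q" if "r \<in> Q" for r
    proof -
      obtain r' where r': "r' \<in> Q" "r = b \<otimes> r'" using \<open>r \<in> Q\<close> img by (metis imageE)
      have "b \<otimes> x \<oplus> r = b \<otimes> (x \<oplus> r')" using r' bc xc Qc by (auto simp: r_distr)
      then show ?thesis using r' x b mult by (simp add: A_def)
    qed
    then show ?thesis using bc xc by (simp add: A_def)
  qed
  have BG: "B \<subseteq> G" using AB Bc by (auto simp: G_def)
  have Gadd: "x \<oplus> y \<in> G" if "x \<in> G" "y \<in> G" for x y
    using that Ac Aadd by (auto simp: G_def l_distr subset_iff)
  have Gmult: "x \<otimes> y \<in> G" if "x \<in> G" "y \<in> G" for x y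
    using that Ac by (auto simp: G_def m_assoc subset_iff)
  have Gneg: "\<ominus> x \<in> G" if "x \<in> G" for x
    using that Ac Aneg by (auto simp: G_def l_minus subset_iff)
  have G1: "\<one> \<in> G" using B BG by auto
  have Ginv: "inv x \<in> G" if x: "x \<in> G" "x \<noteq> \<zero>" for x
  proof -
    have xc: "x \<in> carrier R" using x Gc by auto
    have "inj_on ((\<otimes>) x) G" using xc x Gc by (auto simp: inj_on_def m_lcancel subset_iff)
    then have "(\<otimes>) x ` G = G"
      using Gmult x finite_subset_carrier[OF Gc] by (intro endo_inj_surj) auto
    then obtain y where y: "y \<in> G" "x \<otimes> y = \<one>" using G1 by (metis imageE)
    then have "inv x = y" using xc Gc by (metis comm_inv_char subsetD)
    then show ?thesis using y by simp
  qed
  have "subfield G R"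
    using Gc G1 Gneg Gmult Gadd Ginv by (intro subfieldI' subringI) auto
  have "G \<subseteq> A" using A1 by (force simp: G_def)
  moreover have "A \<subseteq> Q" using Q(2) by (force simp: A_def)
  moreover have "Q \<subseteq> G"
  proof
    fix r assume "r \<in> Q"
    then obtain a b c d where r: "r = (a \<ominus> b) \<otimes> inv (c \<ominus> d)" "a \<in> B" "b \<in> B" "c \<in> B" "d \<in> B" "c \<noteq> d"
      using Q(1) by (auto simp: diff_quotients_def)
    have "a \<ominus> b \<in> G" "c \<ominus> d \<in> G" using r BG Gadd Gneg by (auto simp: a_minus_def subset_iff)
    moreover have "c \<in> carrier R" "d \<in> carrier R" using r Bc by auto
    then have "c \<ominus> d \<noteq> \<zero>" using r(6) by (simp only: minus_eq_zero_iff) simp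
    ultimately show "r \<in> G" using r Gmult Ginv by simp
  qed
  ultimately have "Q = G" by auto
  then show ?thesis using \<open>subfield G R\<close> BG by simp
qed

text \<open>
A coincidence \<open>c x - d y = c x' - d y'\<close> with \<open>y \<noteq> y'\<close> would exhibit \<open>d / c\<close> as \<open>(x - x') / (y - y')\<close>.
\<close>

lemma inj_on_dilates:
  assumes B: "B \<subseteq> carrier R" and c: "c \<in> carrier R" "c \<noteq> \<zero>" and d: "d \<in> carrier R"
    and notin: "d \<otimes> inv c \<notin> diff_quotients B"
  shows "card ((\<lambda>(x, y). c \<otimes> x \<ominus> d \<otimes> y) ` (B \<times> B)) = card B ^ 2"
proof -
  have "inj_on (\<lambda>(x, y). c \<otimes> x \<ominus> d \<otimes> y) (B \<times> B)"
  proof (rule inj_onI, clarify)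
    fix x y x' y' assume m: "x \<in> B" "y \<in> B" "x' \<in> B" "y' \<in> B"
      and e: "c \<otimes> x \<ominus> d \<otimes> y = c \<otimes> x' \<ominus> d \<otimes> y'"
    have cc: "x \<in> carrier R" "y \<in> carrier R" "x' \<in> carrier R" "y' \<in> carrier R" using m B by auto
    have ic: "inv c \<in> carrier R" "c \<otimes> inv c = \<one>" using c inv_mem field_Units by auto
    have "c \<otimes> (x \<ominus> x') = (c \<otimes> x \<ominus> d \<otimes> y) \<oplus> d \<otimes> y \<ominus> c \<otimes> x'" using cc c d by algebra
    also have "\<dots> = d \<otimes> (y \<ominus> y')" unfolding e using cc c d by algebra
    finally have e2: "c \<otimes> (x \<ominus> x') = d \<otimes> (y \<ominus> y')" .
    show "x = x' \<and> y = y'"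
    proof (cases "y = y'")
      case True
      then have z: "y \<ominus> y' = \<zero>" using cc by (simp add: minus_eq_zero_iff)
      then have "c \<otimes> (x \<ominus> x') = \<zero>" using e2[unfolded z] d by simp
      then have "x \<ominus> x' = \<zero>" using c cc by (meson integral minus_closed)
      then show ?thesis using True cc by (simp add: minus_eq_zero_iff)
    next
      case False
      then have nz: "y \<ominus> y' \<noteq> \<zero>" using cc by (simp add: minus_eq_zero_iff)
      then have iy: "inv (y \<ominus> y') \<in> carrier R" "(y \<ominus> y') \<otimes> inv (y \<ominus> y') = \<one>"
        using cc inv_mem field_Units by auto
      have "(x \<ominus> x') \<otimes> inv (y \<ominus> y') = (c \<otimes> inv c) \<otimes> ((x \<ominus> x') \<otimes> inv (y \<ominus> y'))"
        using ic iy cc by simp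
      also have "\<dots> = (c \<otimes> (x \<ominus> x')) \<otimes> (inv c \<otimes> inv (y \<ominus> y'))"
        using ic(1) iy(1) cc c by (simp add: m_ac)
      also have "\<dots> = d \<otimes> inv c \<otimes> ((y \<ominus> y') \<otimes> inv (y \<ominus> y'))"
        unfolding e2 using ic(1) iy(1) cc d by (simp add: m_ac)
      also have "\<dots> = d \<otimes> inv c" using ic iy d by simp
      finally have "d \<otimes> inv c = (x \<ominus> x') \<otimes> inv (y \<ominus> y')" by (rule sym)
      then have "d \<otimes> inv c \<in> diff_quotients B"
        using m False unfolding diff_quotients_def by blast
      then show ?thesis using notin by simp
    qed
  qed
  then show ?thesis by (simp add: card_image card_cartesian_product power2_eq_square)
qed

text \<open>
Pluennecke's inequality for the union \<open>U\<close> of a bounded number of dilates, compared with the common hub \<open>- B\<close>: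
\<open>|U - B|\<close> is at most the sum of the bounds for the single dilates.
\<close>

lemma iterated_dilates:
  fixes \<kappa> :: real
  assumes B: "B \<subseteq> carrier R" and I: "I \<subseteq> B" "card I \<le> 4" "I \<noteq> {}"
    and \<kappa>: "\<And>b. b \<in> B \<Longrightarrow> real (card ((\<lambda>(x, y). b \<otimes> x \<ominus> y) ` (B \<times> B))) \<le> \<kappa> * real (card B)"
  defines "U \<equiv> (\<lambda>(b, x). b \<otimes> x) ` (I \<times> B)"
  shows "real (card (quotient_set (add_monoid R) (set_power (add_monoid R) U k) (set_power (add_monoid R) U l)))
    \<le> (4 * \<kappa>) ^ (k + l) * real (card B)"
proof -
  define Y where "Y = (\<lambda>x. \<ominus> x) ` B"
  have finB: "finite B" using B by (rule finite_subset_carrier)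
  have finI: "finite I" using I(1) finB by (rule finite_subset)
  have cardY: "card Y = card B"
    unfolding Y_def using inj_on_subset[OF add.inv_inj B] by (rule card_image)
  have Uc: "U \<subseteq> carrier R" using B I by (auto simp: U_def)
  have Yc: "Y \<subseteq> carrier R" using B by (auto simp: Y_def)
  have "Y <#>\<^bsub>add_monoid R\<^esub> U \<subseteq> (\<Union>b\<in>I. (\<lambda>(x, y). b \<otimes> x \<ominus> y) ` (B \<times> B))"
  proof
    fix z assume "z \<in> Y <#>\<^bsub>add_monoid R\<^esub> U"
    then obtain y b x where z: "y \<in> B" "b \<in> I" "x \<in> B" "z = (\<ominus> y) \<oplus> b \<otimes> x"
      by (auto simp: set_mult_def Y_def U_def)
    have "y \<in> carrier R" "b \<in> carrier R" "x \<in> carrier R" using z I B by auto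
    then have "z = b \<otimes> x \<ominus> y" using z by (simp add: a_minus_def a_comm)
    then show "z \<in> (\<Union>b\<in>I. (\<lambda>(x, y). b \<otimes> x \<ominus> y) ` (B \<times> B))" using z by auto
  qed
  then have "card (Y <#>\<^bsub>add_monoid R\<^esub> U) \<le> card (\<Union>b\<in>I. (\<lambda>(x, y). b \<otimes> x \<ominus> y) ` (B \<times> B))"
    using finI finB by (intro card_mono) auto
  also have "\<dots> \<le> (\<Sum>b\<in>I. card ((\<lambda>(x, y). b \<otimes> x \<ominus> y) ` (B \<times> B)))"
    using finI by (rule card_UN_le)
  finally have "real (card (Y <#>\<^bsub>add_monoid R\<^esub> U)) \<le> (\<Sum>b\<in>I. real (card ((\<lambda>(x, y). b \<otimes> x \<ominus> y) ` (B \<times> B))))"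
    by (simp flip: of_nat_sum)
  also have "\<dots> \<le> (\<Sum>b\<in>I. \<kappa> * real (card B))" using \<kappa> I by (intro sum_mono) auto
  also have "\<dots> = real (card I) * (\<kappa> * real (card B))" by simp
  also have "\<dots> \<le> 4 * (\<kappa> * real (card B))"
  proof (rule mult_right_mono)
    obtain b where "b \<in> B" using I by auto
    then have "0 \<le> real (card ((\<lambda>(x, y). b \<otimes> x \<ominus> y) ` (B \<times> B)))" "real (card ((\<lambda>(x, y). b \<otimes> x \<ominus> y) ` (B \<times> B))) \<le> \<kappa> * real (card B)"
      using \<kappa> by auto
    then show "0 \<le> \<kappa> * real (card B)" by linarith
  qed (use I in simp)
  finally have "real (card (Y <#>\<^bsub>add_monoid R\<^esub> U)) \<le> 4 * \<kappa> * real (card Y)" by (simp add: cardY)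
  moreover have "Y \<noteq> {}" using I by (auto simp: Y_def)
  ultimately show ?thesis
    using comm_group.pluennecke_ruzsa[OF a_comm_group, of Y U "4 * \<kappa>" k l] Uc Yc finite_subset_carrier cardY by simp
qed

lemma set_power_add_monoid:
  "u \<in> U \<Longrightarrow> U \<subseteq> carrier R \<Longrightarrow> u \<in> set_power (add_monoid R) U 1"
  "u \<in> U \<Longrightarrow> v \<in> U \<Longrightarrow> U \<subseteq> carrier R \<Longrightarrow> u \<oplus> v \<in> set_power (add_monoid R) U 2"
  "u \<in> U \<Longrightarrow> v \<in> U \<Longrightarrow> w \<in> U \<Longrightarrow> U \<subseteq> carrier R \<Longrightarrow> u \<oplus> (v \<oplus> w) \<in> set_power (add_monoid R) U 3"
proof -
  have 1: "u \<in> set_power (add_monoid R) U 1" if "u \<in> U" "U \<subseteq> carrier R" for u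
  proof -
    have "u = u \<oplus> \<zero>" using that by auto
    then show ?thesis using that mem_set_mult[of u U \<zero> "{\<zero>}" "add_monoid R"] by simp
  qed
  have 2: "u \<oplus> v \<in> set_power (add_monoid R) U 2" if "u \<in> U" "v \<in> U" "U \<subseteq> carrier R" for u v
    using mem_set_mult[OF that(1) 1[OF that(2,3)], of "add_monoid R"] by (simp add: numeral_2_eq_2)
  show "u \<in> U \<Longrightarrow> U \<subseteq> carrier R \<Longrightarrow> u \<in> set_power (add_monoid R) U 1" by (rule 1)
  show "u \<in> U \<Longrightarrow> v \<in> U \<Longrightarrow> U \<subseteq> carrier R \<Longrightarrow> u \<oplus> v \<in> set_power (add_monoid R) U 2" by (rule 2)
  show "u \<oplus> (v \<oplus> w) \<in> set_power (add_monoid R) U 3" if "u \<in> U" "v \<in> U" "w \<in> U" "U \<subseteq> carrier R"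
    using mem_set_mult[OF that(1) 2[OF that(2-4)], of "add_monoid R"]
    by (simp add: numeral_3_eq_3 numeral_2_eq_2)
qed

lemma diff_mem_quotient_set:
  "p \<in> P \<Longrightarrow> q \<in> Q \<Longrightarrow> p \<ominus> q \<in> quotient_set (add_monoid R) P Q"
  by (auto simp: quotient_set_def a_minus_def a_inv_def)

text \<open>
From here on every dilate \<open>b B\<close> with \<open>b \<in> B\<close> has few differences with \<open>B\<close> itself. By the normalisation
\<open>1 \<in> B\<close> this includes the additive doubling of \<open>B\<close>.
\<close>

context
  fixes B :: "'a set" and \<kappa> :: real
  assumes B: "B \<subseteq> carrier R - {\<zero>}" and B1: "\<one> \<in> B"
    and \<kappa>: "\<And>b. b \<in> B \<Longrightarrow> real (card ((\<lambda>(x, y). b \<otimes> x \<ominus> y) ` (B \<times> B))) \<le> \<kappa> * real (card B)"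
begin

lemma B_carrier: "B \<subseteq> carrier R" using B by auto

lemma dilate_sums_le:
  assumes I: "I \<subseteq> B" "card I \<le> 4" "I \<noteq> {}"
    and D: "D \<subseteq> quotient_set (add_monoid R) (set_power (add_monoid R) ((\<lambda>(b, x). b \<otimes> x) ` (I \<times> B)) k)
      (set_power (add_monoid R) ((\<lambda>(b, x). b \<otimes> x) ` (I \<times> B)) l)"
  shows "real (card D) \<le> (4 * \<kappa>) ^ (k + l) * real (card B)"
proof -
  have finB: "finite B" "finite I" using B_carrier finite_subset_carrier I finite_subset by blast+
  have "card D \<le> card (quotient_set (add_monoid R) (set_power (add_monoid R) ((\<lambda>(b, x). b \<otimes> x) ` (I \<times> B)) k)
      (set_power (add_monoid R) ((\<lambda>(b, x). b \<otimes> x) ` (I \<times> B)) l))"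
    using D finB by (intro card_mono) (auto simp: quotient_set_def intro!: finite_set_power)
  then show ?thesis using iterated_dilates[OF B_carrier I \<kappa>, of k l] by linarith
qed

text \<open>
Because \<open>B - 1\<close> is contained in \<open>1 B - B\<close>.
\<close>

lemma kappa_ge_1: "1 \<le> \<kappa>"
proof -
  have finB: "finite B" using B_carrier by (rule finite_subset_carrier)
  have "inj_on (\<lambda>x. x \<ominus> \<one>) B"
  proof (rule inj_onI)
    fix x y assume "x \<in> B" "y \<in> B" "x \<ominus> \<one> = y \<ominus> \<one>"
    then show "x = y" using B_carrier by (auto simp: a_minus_def subset_iff)
  qed
  then have "card B = card ((\<lambda>x. x \<ominus> \<one>) ` B)" by (simp add: card_image)
  also have "\<dots> \<le> card ((\<lambda>(x, y). \<one> \<otimes> x \<ominus> y) ` (B \<times> B))"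
  proof (rule card_mono)
    show "(\<lambda>x. x \<ominus> \<one>) ` B \<subseteq> (\<lambda>(x, y). \<one> \<otimes> x \<ominus> y) ` (B \<times> B)"
    proof
      fix z assume "z \<in> (\<lambda>x. x \<ominus> \<one>) ` B"
      then obtain x where x: "x \<in> B" "z = x \<ominus> \<one>" by auto
      then have "z = (\<lambda>(x, y). \<one> \<otimes> x \<ominus> y) (x, \<one>)" using B_carrier by auto
      then show "z \<in> (\<lambda>(x, y). \<one> \<otimes> x \<ominus> y) ` (B \<times> B)" using x B1 by blast
    qed
  qed (use finB in simp)
  finally have "1 * real (card B) \<le> \<kappa> * real (card B)" using \<kappa>[OF B1] by linarith
  moreover have "real (card B) > 0" using finB B1 by (auto simp: card_gt_0_iff)
  ultimately show ?thesis by simp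
qed

lemma card_difference_dilate:
  assumes "t \<in> B" "t' \<in> B" "c \<in> B"
  shows "real (card ((\<lambda>(x, z). (t \<ominus> t') \<otimes> x \<ominus> c \<otimes> z) ` (B \<times> B))) \<le> (4 * \<kappa>) ^ 3 * real (card B)"
proof -
  let ?I = "{t, t', c}" and ?M = "add_monoid R"
  let ?U = "(\<lambda>(b, x). b \<otimes> x) ` (?I \<times> B)"
  have Uc: "?U \<subseteq> carrier R" using assms B_carrier by auto
  have c4: "card ?I \<le> 4" by (simp add: card_insert_if)
  have sub: "(\<lambda>(x, z). (t \<ominus> t') \<otimes> x \<ominus> c \<otimes> z) ` (B \<times> B)
      \<subseteq> quotient_set ?M (set_power ?M ?U 1) (set_power ?M ?U 2)"
  proof clarify
    fix x z assume m: "x \<in> B" "z \<in> B"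
    have "t \<in> carrier R" "t' \<in> carrier R" "c \<in> carrier R" "x \<in> carrier R" "z \<in> carrier R"
      using m assms B_carrier by auto
    then have "(t \<ominus> t') \<otimes> x \<ominus> c \<otimes> z = t \<otimes> x \<ominus> (t' \<otimes> x \<oplus> c \<otimes> z)" by algebra
    also have "\<dots> \<in> quotient_set ?M (set_power ?M ?U 1) (set_power ?M ?U 2)"
      using m Uc by (intro diff_mem_quotient_set set_power_add_monoid) auto
    finally show "(t \<ominus> t') \<otimes> x \<ominus> c \<otimes> z \<in> quotient_set ?M (set_power ?M ?U 1) (set_power ?M ?U 2)" .
  qed
  show ?thesis using dilate_sums_le[OF _ c4 _ sub] assms by (simp add: power3_eq_cube)
qed

lemma card_difference_dilates:
  assumes "a \<in> B" "b \<in> B" "c \<in> B" "d \<in> B"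
  shows "real (card ((\<lambda>(x, y). (c \<ominus> d) \<otimes> x \<ominus> (a \<ominus> b) \<otimes> y) ` (B \<times> B))) \<le> (4 * \<kappa>) ^ 4 * real (card B)"
proof -
  let ?I = "{a, b, c, d}" and ?M = "add_monoid R"
  let ?U = "(\<lambda>(b, x). b \<otimes> x) ` (?I \<times> B)"
  have Uc: "?U \<subseteq> carrier R" using assms B_carrier by auto
  have c4: "card ?I \<le> 4" by (simp add: card_insert_if)
  have sub: "(\<lambda>(x, y). (c \<ominus> d) \<otimes> x \<ominus> (a \<ominus> b) \<otimes> y) ` (B \<times> B)
      \<subseteq> quotient_set ?M (set_power ?M ?U 2) (set_power ?M ?U 2)"
  proof clarify
    fix x y assume m: "x \<in> B" "y \<in> B"
    have "a \<in> carrier R" "b \<in> carrier R" "c \<in> carrier R" "d \<in> carrier R" "x \<in> carrier R" "y \<in> carrier R"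
      using m assms B_carrier by auto
    then have "(c \<ominus> d) \<otimes> x \<ominus> (a \<ominus> b) \<otimes> y = (c \<otimes> x \<oplus> b \<otimes> y) \<ominus> (d \<otimes> x \<oplus> a \<otimes> y)" by algebra
    also have "\<dots> \<in> quotient_set ?M (set_power ?M ?U 2) (set_power ?M ?U 2)"
      using m Uc by (intro diff_mem_quotient_set set_power_add_monoid) auto
    finally show "(c \<ominus> d) \<otimes> x \<ominus> (a \<ominus> b) \<otimes> y \<in> quotient_set ?M (set_power ?M ?U 2) (set_power ?M ?U 2)" .
  qed
  show ?thesis using dilate_sums_le[OF _ c4 _ sub] assms by simp
qed

lemma card_difference_dilates_add_one:
  assumes "a \<in> B" "b \<in> B" "c \<in> B" "d \<in> B"
  shows "real (card ((\<lambda>(x, y). (c \<ominus> d) \<otimes> x \<ominus> ((c \<ominus> d) \<oplus> (a \<ominus> b)) \<otimes> y) ` (B \<times> B)))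
    \<le> (4 * \<kappa>) ^ 6 * real (card B)"
proof -
  let ?I = "{a, b, c, d}" and ?M = "add_monoid R"
  let ?U = "(\<lambda>(b, x). b \<otimes> x) ` (?I \<times> B)"
  have Uc: "?U \<subseteq> carrier R" using assms B_carrier by auto
  have c4: "card ?I \<le> 4" by (simp add: card_insert_if)
  have sub: "(\<lambda>(x, y). (c \<ominus> d) \<otimes> x \<ominus> ((c \<ominus> d) \<oplus> (a \<ominus> b)) \<otimes> y) ` (B \<times> B)
      \<subseteq> quotient_set ?M (set_power ?M ?U 3) (set_power ?M ?U 3)"
  proof clarify
    fix x y assume m: "x \<in> B" "y \<in> B"
    have "a \<in> carrier R" "b \<in> carrier R" "c \<in> carrier R" "d \<in> carrier R" "x \<in> carrier R" "y \<in> carrier R"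
      using m assms B_carrier by auto
    then have "(c \<ominus> d) \<otimes> x \<ominus> ((c \<ominus> d) \<oplus> (a \<ominus> b)) \<otimes> y
        = (c \<otimes> x \<oplus> (d \<otimes> y \<oplus> b \<otimes> y)) \<ominus> (d \<otimes> x \<oplus> (c \<otimes> y \<oplus> a \<otimes> y))" by algebra
    also have "\<dots> \<in> quotient_set ?M (set_power ?M ?U 3) (set_power ?M ?U 3)"
      using m Uc by (intro diff_mem_quotient_set set_power_add_monoid) auto
    finally show "(c \<ominus> d) \<otimes> x \<ominus> ((c \<ominus> d) \<oplus> (a \<ominus> b)) \<otimes> y
        \<in> quotient_set ?M (set_power ?M ?U 3) (set_power ?M ?U 3)" .
  qed
  show ?thesis using dilate_sums_le[OF _ c4 _ sub] assms by simp
qed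

text \<open>
With \<open>r = (a - b) / (c - d)\<close>, the \<open>|B|\<^sup>2\<close> elements \<open>(c - d) x - s (a - b) y\<close> are distinct. The products \<open>s a\<close> and
\<open>s b\<close> need not lie in \<open>B\<close>, so Pluennecke's inequality does not apply at once; the triangle inequality through
\<open>s B\<close> separates \<open>(c - d) B - s B\<close> from \<open>s ((a - b) B - B)\<close>, which involve three dilates each.
\<close>

lemma card_le_if_not_mult_closed:
  assumes r: "r \<in> diff_quotients B" and s: "s \<in> B" and notin: "s \<otimes> r \<notin> diff_quotients B"
  shows "real (card B) \<le> (4 * \<kappa>) ^ 6"
proof -
  obtain a b c d where r: "r = (a \<ominus> b) \<otimes> inv (c \<ominus> d)" and m: "a \<in> B" "b \<in> B" "c \<in> B" "d \<in> B" "c \<noteq> d"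
    using assms by (auto simp: diff_quotients_def)
  have cc: "a \<in> carrier R" "b \<in> carrier R" "c \<in> carrier R" "d \<in> carrier R" "s \<in> carrier R" using m s B_carrier by auto
  have finB: "finite B" and Bpos: "card B > 0"
    using B_carrier finite_subset_carrier B1 by (auto simp: card_gt_0_iff)
  have nz: "c \<ominus> d \<noteq> \<zero>" using cc m by (simp add: minus_eq_zero_iff)
  define P where "P = (\<lambda>y. s \<otimes> (a \<ominus> b) \<otimes> y) ` B"
  define Q where "Q = (\<lambda>x. (c \<ominus> d) \<otimes> x) ` B"
  define V where "V = (\<lambda>z. \<ominus> (s \<otimes> z)) ` B"
  have closed: "P \<subseteq> carrier R" "Q \<subseteq> carrier R" "V \<subseteq> carrier R" using cc B_carrier by (auto simp: P_def Q_def V_def)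
  have fin: "finite P" "finite Q" "finite V" using finB by (auto simp: P_def Q_def V_def)
  have cardV: "card V = card B"
  proof -
    have "s \<noteq> \<zero>" using s B by auto
    have "inj_on (\<lambda>z. \<ominus> (s \<otimes> z)) B"
    proof (rule inj_onI)
      fix z z' assume z: "z \<in> B" "z' \<in> B" and e: "\<ominus> (s \<otimes> z) = \<ominus> (s \<otimes> z')"
      have zc: "z \<in> carrier R" "z' \<in> carrier R" using z B_carrier by auto
      have "s \<otimes> z = \<ominus> (\<ominus> (s \<otimes> z))" using zc cc by simp
      also have "\<dots> = s \<otimes> z'" unfolding e using zc cc by simp
      finally show "z = z'" using \<open>s \<noteq> \<zero>\<close> zc cc by (simp add: m_lcancel)
    qed
    then show ?thesis by (simp add: V_def card_image)
  qed
  have "s \<otimes> (a \<ominus> b) \<otimes> inv (c \<ominus> d) \<notin> diff_quotients B"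
    using notin cc nz inv_mem by (simp add: r m_assoc)
  then have "card ((\<lambda>(x, y). (c \<ominus> d) \<otimes> x \<ominus> s \<otimes> (a \<ominus> b) \<otimes> y) ` (B \<times> B)) = card B ^ 2"
    using cc nz by (intro inj_on_dilates[OF B_carrier]) auto
  also have "(\<lambda>(x, y). (c \<ominus> d) \<otimes> x \<ominus> s \<otimes> (a \<ominus> b) \<otimes> y) ` (B \<times> B) = quotient_set (add_monoid R) Q P"
    by (auto simp: quotient_set_def P_def Q_def a_minus_def a_inv_def image_iff)
  finally have "card B ^ 2 * card B \<le> card (Q <#>\<^bsub>add_monoid R\<^esub> V) * card (P <#>\<^bsub>add_monoid R\<^esub> V)"
    using comm_group.ruzsa_triangle[OF a_comm_group, of Q P V] fin closed by (simp add: cardV)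
  then have "real (card B) ^ 2 * real (card B)
      \<le> real (card (Q <#>\<^bsub>add_monoid R\<^esub> V)) * real (card (P <#>\<^bsub>add_monoid R\<^esub> V))"
    by (metis of_nat_le_iff of_nat_mult of_nat_power)
  also have "\<dots> \<le> ((4 * \<kappa>) ^ 3 * real (card B)) * ((4 * \<kappa>) ^ 3 * real (card B))"
  proof (rule mult_mono)
    have "Q <#>\<^bsub>add_monoid R\<^esub> V \<subseteq> (\<lambda>(x, z). (c \<ominus> d) \<otimes> x \<ominus> s \<otimes> z) ` (B \<times> B)"
      by (auto simp: set_mult_def Q_def V_def a_minus_def image_iff)
    then have "card (Q <#>\<^bsub>add_monoid R\<^esub> V) \<le> card ((\<lambda>(x, z). (c \<ominus> d) \<otimes> x \<ominus> s \<otimes> z) ` (B \<times> B))"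
      using finB by (intro card_mono) auto
    then show "real (card (Q <#>\<^bsub>add_monoid R\<^esub> V)) \<le> (4 * \<kappa>) ^ 3 * real (card B)"
      using card_difference_dilate[OF m(3,4) s] by linarith
    have "P <#>\<^bsub>add_monoid R\<^esub> V \<subseteq> (\<lambda>w. s \<otimes> w) ` ((\<lambda>(x, z). (a \<ominus> b) \<otimes> x \<ominus> \<one> \<otimes> z) ` (B \<times> B))"
    proof
      fix w assume "w \<in> P <#>\<^bsub>add_monoid R\<^esub> V"
      then obtain x z where xz: "x \<in> B" "z \<in> B" "w = s \<otimes> (a \<ominus> b) \<otimes> x \<oplus> (\<ominus> (s \<otimes> z))"
        by (auto simp: set_mult_def P_def V_def)
      have "x \<in> carrier R" "z \<in> carrier R" using xz B_carrier by auto
      then have "w = s \<otimes> ((a \<ominus> b) \<otimes> x \<ominus> \<one> \<otimes> z)" unfolding xz(3) using cc by algebra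
      then show "w \<in> (\<lambda>w. s \<otimes> w) ` ((\<lambda>(x, z). (a \<ominus> b) \<otimes> x \<ominus> \<one> \<otimes> z) ` (B \<times> B))"
        using xz by auto
    qed
    then have "card (P <#>\<^bsub>add_monoid R\<^esub> V) \<le> card ((\<lambda>w. s \<otimes> w) ` ((\<lambda>(x, z). (a \<ominus> b) \<otimes> x \<ominus> \<one> \<otimes> z) ` (B \<times> B)))"
      using finB by (intro card_mono) auto
    also have "\<dots> \<le> card ((\<lambda>(x, z). (a \<ominus> b) \<otimes> x \<ominus> \<one> \<otimes> z) ` (B \<times> B))"
      using finB by (intro card_image_le) auto
    finally show "real (card (P <#>\<^bsub>add_monoid R\<^esub> V)) \<le> (4 * \<kappa>) ^ 3 * real (card B)"
      using card_difference_dilate[OF m(1,2) B1] by linarith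
  qed (use kappa_ge_1 in auto)
  also have "\<dots> = (4 * \<kappa>) ^ 6 * real (card B) ^ 2"
    by (simp add: power2_eq_square eval_nat_numeral)
  finally show ?thesis using Bpos by simp
qed

text \<open>
With \<open>r = (a - b) / (c - d)\<close> one has \<open>1 + r = ((c - d) + (a - b)) / (c - d)\<close>, and the distinct elements
\<open>(c - d) x - ((c - d) + (a - b)) y\<close> are combinations of six elements from dilates of \<open>B\<close>.
\<close>

lemma card_le_if_not_add_one_closed:
  assumes r: "r \<in> diff_quotients B" and notin: "\<one> \<oplus> r \<notin> diff_quotients B"
  shows "real (card B) \<le> (4 * \<kappa>) ^ 6"
proof -
  obtain a b c d where r: "r = (a \<ominus> b) \<otimes> inv (c \<ominus> d)" and m: "a \<in> B" "b \<in> B" "c \<in> B" "d \<in> B" "c \<noteq> d"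
    using assms by (auto simp: diff_quotients_def)
  have cc: "a \<in> carrier R" "b \<in> carrier R" "c \<in> carrier R" "d \<in> carrier R" using m B_carrier by auto
  have Bpos: "card B > 0" using B_carrier finite_subset_carrier B1 by (auto simp: card_gt_0_iff)
  have nz: "c \<ominus> d \<noteq> \<zero>" using cc m by (simp add: minus_eq_zero_iff)
  have "inv (c \<ominus> d) \<in> carrier R" "(c \<ominus> d) \<otimes> inv (c \<ominus> d) = \<one>" using nz cc inv_mem field_Units by auto
  then have "((c \<ominus> d) \<oplus> (a \<ominus> b)) \<otimes> inv (c \<ominus> d) \<notin> diff_quotients B"
    using notin cc by (simp add: r l_distr)
  then have "card ((\<lambda>(x, y). (c \<ominus> d) \<otimes> x \<ominus> ((c \<ominus> d) \<oplus> (a \<ominus> b)) \<otimes> y) ` (B \<times> B)) = card B ^ 2"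
    using cc nz by (intro inj_on_dilates[OF B_carrier]) auto
  then have "real (card B) ^ 2 \<le> (4 * \<kappa>) ^ 6 * real (card B)"
    using card_difference_dilates_add_one[OF m(1-4)] by simp
  then show ?thesis using Bpos by (simp add: power2_eq_square)
qed

lemma card_dilate_by_quotient:
  assumes r: "r \<in> diff_quotients B"
  shows "real (card ((\<lambda>(x, y). x \<ominus> r \<otimes> y) ` (B \<times> B))) \<le> (4 * \<kappa>) ^ 4 * real (card B)"
proof -
  obtain a b c d where r: "r = (a \<ominus> b) \<otimes> inv (c \<ominus> d)" and m: "a \<in> B" "b \<in> B" "c \<in> B" "d \<in> B" "c \<noteq> d"
    using assms by (auto simp: diff_quotients_def)
  have cc: "a \<in> carrier R" "b \<in> carrier R" "c \<in> carrier R" "d \<in> carrier R" using m B_carrier by auto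
  have finB: "finite B" using B_carrier by (rule finite_subset_carrier)
  have nz: "c \<ominus> d \<noteq> \<zero>" using cc m by (simp add: minus_eq_zero_iff)
  define i where "i = inv (c \<ominus> d)"
  have i: "i \<in> carrier R" "(c \<ominus> d) \<otimes> i = \<one>" using nz cc inv_mem field_Units by (auto simp: i_def)
  have "(\<lambda>(x, y). x \<ominus> r \<otimes> y) ` (B \<times> B)
      \<subseteq> (\<lambda>w. i \<otimes> w) ` ((\<lambda>(x, y). (c \<ominus> d) \<otimes> x \<ominus> (a \<ominus> b) \<otimes> y) ` (B \<times> B))"
  proof clarify
    fix x y assume xy: "x \<in> B" "y \<in> B"
    have xc: "x \<in> carrier R" "y \<in> carrier R" using xy B_carrier by auto
    have "i \<otimes> ((c \<ominus> d) \<otimes> x \<ominus> (a \<ominus> b) \<otimes> y) = ((c \<ominus> d) \<otimes> i) \<otimes> x \<ominus> ((a \<ominus> b) \<otimes> i) \<otimes> y"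
      using xc cc i(1) by algebra
    then have "x \<ominus> r \<otimes> y = i \<otimes> ((c \<ominus> d) \<otimes> x \<ominus> (a \<ominus> b) \<otimes> y)"
      using xc i(2) by (simp add: r i_def)
    then show "x \<ominus> r \<otimes> y \<in> (\<lambda>w. i \<otimes> w) ` ((\<lambda>(x, y). (c \<ominus> d) \<otimes> x \<ominus> (a \<ominus> b) \<otimes> y) ` (B \<times> B))"
      using xy by auto
  qed
  then have "card ((\<lambda>(x, y). x \<ominus> r \<otimes> y) ` (B \<times> B))
      \<le> card ((\<lambda>w. i \<otimes> w) ` ((\<lambda>(x, y). (c \<ominus> d) \<otimes> x \<ominus> (a \<ominus> b) \<otimes> y) ` (B \<times> B)))"
    using finB by (intro card_mono) auto
  also have "\<dots> \<le> card ((\<lambda>(x, y). (c \<ominus> d) \<otimes> x \<ominus> (a \<ominus> b) \<otimes> y) ` (B \<times> B))"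
    using finB by (intro card_image_le) auto
  finally show ?thesis using card_difference_dilates[OF m(1-4)] by linarith
qed

text \<open>
By Cauchy--Schwarz each \<open>r\<close> has at least \<open>|B|^4 / v\<close> coincidences \<open>x - r y = x' - r y'\<close>. Summed over \<open>r \<in> G\<close>,
there are \<open>|G| |B|\<^sup>2\<close> trivial coincidences, and a coincidence with \<open>y \<noteq> y'\<close> determines \<open>r\<close>.
\<close>

lemma card_le_if_all_dilates_small:
  fixes v :: real
  assumes G: "G \<subseteq> carrier R" and v0: "0 \<le> v"
    and v: "\<And>r. r \<in> G \<Longrightarrow> real (card ((\<lambda>(x, y). x \<ominus> r \<otimes> y) ` (B \<times> B))) \<le> v"
  shows "real (card G) * real (card B) ^ 4 \<le> v * (real (card G) * real (card B) ^ 2 + real (card B) ^ 4)"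
proof -
  define f where "f = (\<lambda>r p. fst p \<ominus> r \<otimes> snd p)"
  define coll where "coll = (\<lambda>r. {q \<in> (B \<times> B) \<times> (B \<times> B). f r (fst q) = f r (snd q)})"
  have finB: "finite B" and finG: "finite G" using B_carrier G by (auto intro: finite_subset_carrier)
  have eq_imp: "r \<otimes> (y \<ominus> y') = x \<ominus> x'"
    if "r \<in> G" "x \<in> B" "y \<in> B" "x' \<in> B" "y' \<in> B" "x \<ominus> r \<otimes> y = x' \<ominus> r \<otimes> y'" for r x y x' y'
  proof -
    have c: "r \<in> carrier R" "x \<in> carrier R" "y \<in> carrier R" "x' \<in> carrier R" "y' \<in> carrier R"
      using that G B_carrier by auto
    have "r \<otimes> (y \<ominus> y') = x \<ominus> (x \<ominus> r \<otimes> y) \<ominus> r \<otimes> y'" using c by algebra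
    also have "\<dots> = x \<ominus> x'" unfolding that(6) using c by algebra
    finally show ?thesis .
  qed
  have one: "real (card B) ^ 4 \<le> v * real (card (coll r))" if "r \<in> G" for r
  proof -
    have "f r ` (B \<times> B) = (\<lambda>(x, y). x \<ominus> r \<otimes> y) ` (B \<times> B)"
      by (intro image_cong) (auto simp: f_def)
    then have "real (card (B \<times> B)) ^ 2 \<le> real (card ((\<lambda>(x, y). x \<ominus> r \<otimes> y) ` (B \<times> B))) * real (card (coll r))"
      using card_squared_le_image_times_collisions[of "B \<times> B" "f r"] finB by (simp add: coll_def)
    also have "\<dots> \<le> v * real (card (coll r))" using v[OF that] by (intro mult_right_mono) auto
    finally show ?thesis by (simp add: card_cartesian_product power2_eq_square power4_eq_xxxx mult_ac)
  qed
  define W where "W = {w \<in> (SIGMA r:G. coll r). snd (fst (snd w)) \<noteq> snd (snd (snd w))}"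
  have fincoll: "finite (coll r)" for r using finB by (simp add: coll_def)
  have "(\<Sum>r\<in>G. card (coll r)) = card (SIGMA r:G. coll r)" using finG fincoll by simp
  also have "\<dots> \<le> card (G \<times> (\<lambda>p. (p, p)) ` (B \<times> B) \<union> W)"
  proof (rule card_mono)
    show "(SIGMA r:G. coll r) \<subseteq> G \<times> (\<lambda>p. (p, p)) ` (B \<times> B) \<union> W"
    proof
      fix w assume w: "w \<in> (SIGMA r:G. coll r)"
      obtain r x y x' y' where wd: "w = (r, (x, y), (x', y'))" by (metis surj_pair)
      have m: "r \<in> G" "x \<in> B" "y \<in> B" "x' \<in> B" "y' \<in> B" "x \<ominus> r \<otimes> y = x' \<ominus> r \<otimes> y'"
        using w by (auto simp: wd coll_def f_def)
      have c: "r \<in> carrier R" "x \<in> carrier R" "y \<in> carrier R" "x' \<in> carrier R" "y' \<in> carrier R"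
        using m G B_carrier by auto
      show "w \<in> G \<times> (\<lambda>p. (p, p)) ` (B \<times> B) \<union> W"
      proof (cases "y = y'")
        case True
        then have z: "y \<ominus> y' = \<zero>" using c by (simp add: minus_eq_zero_iff)
        then have "x \<ominus> x' = \<zero>" using eq_imp[OF m, unfolded z] c by simp
        then show ?thesis using True m c by (auto simp: wd minus_eq_zero_iff)
      next
        case False
        then show ?thesis using w by (simp add: wd W_def)
      qed
    qed
  qed (use finB finG fincoll in \<open>auto simp: W_def\<close>)
  also have "\<dots> \<le> card (G \<times> (\<lambda>p. (p, p)) ` (B \<times> B)) + card W"
    by (rule card_Un_le)
  also have "\<dots> \<le> card G * card B ^ 2 + card B ^ 4"
  proof (rule add_mono)
    show "card (G \<times> (\<lambda>p. (p, p)) ` (B \<times> B)) \<le> card G * card B ^ 2"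
      by (simp add: card_cartesian_product card_image inj_on_def power2_eq_square)
    have "inj_on snd W"
    proof (rule inj_onI)
      fix w w2 assume w: "w \<in> W"
        and w2: "w2 \<in> W" and e: "snd w = snd w2"
      obtain r x y x' y' where wd: "w = (r, (x, y), (x', y'))" by (metis surj_pair)
      obtain r2 where wd2: "w2 = (r2, (x, y), (x', y'))" using e wd by (metis prod.collapse snd_conv)
      have m: "r \<in> G" "r2 \<in> G" "x \<in> B" "y \<in> B" "x' \<in> B" "y' \<in> B" "y \<noteq> y'"
          "x \<ominus> r \<otimes> y = x' \<ominus> r \<otimes> y'" "x \<ominus> r2 \<otimes> y = x' \<ominus> r2 \<otimes> y'"
        using w w2 by (auto simp: wd wd2 coll_def f_def W_def)
      have "r \<otimes> (y \<ominus> y') = r2 \<otimes> (y \<ominus> y')"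
        using eq_imp[OF m(1,3,4,5,6,8)] eq_imp[OF m(2,3,4,5,6,9)] by simp
      moreover have "y \<in> carrier R" "y' \<in> carrier R" using m B_carrier by auto
      then have "y \<ominus> y' \<noteq> \<zero>" using m(7) by (simp only: minus_eq_zero_iff) simp
      moreover have "r \<in> carrier R" "r2 \<in> carrier R" "y \<ominus> y' \<in> carrier R" using m G B_carrier by auto
      ultimately have "r = r2" by (simp add: m_rcancel)
      then show "w = w2" by (simp add: wd wd2)
    qed
    then have "card W \<le> card ((B \<times> B) \<times> (B \<times> B))"
      using finB by (intro card_inj_on_le[where f = snd]) (auto simp: coll_def W_def)
    then show "card W \<le> card B ^ 4"
      by (simp add: card_cartesian_product power4_eq_xxxx mult_ac)
  qed
  finally have total: "(\<Sum>r\<in>G. card (coll r)) \<le> card G * card B ^ 2 + card B ^ 4" .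
  have "real (card G) * real (card B) ^ 4 = (\<Sum>r\<in>G. real (card B) ^ 4)" by simp
  also have "\<dots> \<le> (\<Sum>r\<in>G. v * real (card (coll r)))" using one by (intro sum_mono) auto
  also have "\<dots> = v * real (\<Sum>r\<in>G. card (coll r))" by (simp add: sum_distrib_left)
  also have "\<dots> \<le> v * real (card G * card B ^ 2 + card B ^ 4)"
    using total v0 by (intro mult_left_mono of_nat_mono)
  finally show ?thesis by simp
qed

text \<open>
If \<open>B\<close> is large, the set of quotients of differences is stable under multiplication by \<open>B\<close> and under adding
\<open>1\<close>, so it is a subfield. Its size is bounded by averaging over all its elements, each of which is a quotient of
differences and therefore gives few differences \<open>x - r y\<close>.
\<close>

lemma small_or_subfield:
  "real (card B) \<le> 2 * (4 * \<kappa>) ^ 6 \<or>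
    (\<exists>G. subfield G R \<and> B \<subseteq> G \<and> real (card G) \<le> 2 * (4 * \<kappa>) ^ 4 * real (card B))"
proof (rule disjCI)
  assume no: "\<not> (\<exists>G. subfield G R \<and> B \<subseteq> G \<and> real (card G) \<le> 2 * (4 * \<kappa>) ^ 4 * real (card B))"
  have finB: "finite B" using B_carrier by (rule finite_subset_carrier)
  have Bpos: "real (card B) > 0" using finB B1 by (auto simp: card_gt_0_iff)
  have \<kappa>4: "1 \<le> 4 * \<kappa>" using kappa_ge_1 by simp
  have pow6: "1 \<le> (4 * \<kappa>) ^ 6" using \<kappa>4 by (rule one_le_power)
  show "real (card B) \<le> 2 * (4 * \<kappa>) ^ 6"
  proof (rule ccontr)
    assume big: "\<not> ?thesis"
    have "B \<noteq> {\<one>}" using big pow6 by auto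
    then obtain c where c: "c \<in> B" "c \<noteq> \<one>" using B1 by auto
    let ?Q = "diff_quotients B"
    have "\<zero> = (c \<ominus> c) \<otimes> inv (c \<ominus> \<one>)"
    proof -
      have "c \<in> carrier R" using c B_carrier by auto
      moreover from this have z: "c \<ominus> c = \<zero>" and "c \<ominus> \<one> \<noteq> \<zero>" using c by (auto simp: minus_eq_zero_iff)
      ultimately show ?thesis unfolding z by (simp add: inv_mem)
    qed
    then have zero: "\<zero> \<in> ?Q" unfolding diff_quotients_def using c B1 by blast
    have "subfield ?Q R \<and> B \<subseteq> ?Q"
    proof (rule stable_subset_is_subfield[OF B B1 order_refl zero])
      show "b \<otimes> r \<in> ?Q" if "b \<in> B" "r \<in> ?Q" for b r
        using card_le_if_not_mult_closed[OF that(2,1)] big pow6 by argo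
      show "\<one> \<oplus> r \<in> ?Q" if "r \<in> ?Q" for r
        using card_le_if_not_add_one_closed[OF that] big pow6 by argo
    qed
    then have lt: "2 * (4 * \<kappa>) ^ 4 * real (card B) < real (card ?Q)" using no by auto
    define v where "v = (4 * \<kappa>) ^ 4 * real (card B)"
    define b where "b = real (card B)"
    define g where "g = real (card ?Q)"
    have v0: "0 \<le> v" using \<kappa>4 by (simp add: v_def)
    have "g * b ^ 4 \<le> v * (g * b ^ 2 + b ^ 4)"
      unfolding g_def b_def
      by (rule card_le_if_all_dilates_small[OF diff_quotients_carrier[OF B_carrier] v0])
         (use card_dilate_by_quotient in \<open>simp add: v_def\<close>)
    also have "\<dots> = v * g * b ^ 2 + v * b ^ 4" by (simp add: algebra_simps)
    also have "v * b ^ 4 \<le> g / 2 * b ^ 4"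
      using lt by (intro mult_right_mono) (auto simp: g_def v_def)
    finally have "g * (b ^ 2 * b ^ 2) \<le> g * (2 * v * b ^ 2)"
      by (simp add: power4_eq_xxxx power2_eq_square algebra_simps)
    moreover have "g > 0" using lt v0 unfolding g_def v_def by linarith
    ultimately have "b ^ 2 * b ^ 2 \<le> 2 * v * b ^ 2" by simp
    moreover have "0 < b ^ 2" using Bpos by (simp add: b_def)
    ultimately have "b ^ 2 \<le> 2 * v" by (rule mult_right_le_imp_le)
    then have "b \<le> 2 * (4 * \<kappa>) ^ 4" using Bpos by (simp add: b_def v_def power2_eq_square)
    also have "\<dots> \<le> 2 * (4 * \<kappa>) ^ 6" using \<kappa>4 by (intro mult_left_mono power_increasing) auto
    finally show False using big by (simp add: b_def)
  qed
qed

end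

end

section \<open>The choice of popularity level and of scale\<close>

text \<open>
If the second moment came from the level \<open>N / 32 ^ i\<close> alone, there would be about \<open>1024 ^ i N / M\<close> such \<open>s\<close>.
The lower bound is smaller than this by \<open>2 ^ i\<close> and a constant. If it failed at all levels, the
contributions would decay geometrically and their sum would be too small. No logarithm is lost, at the price of the factor
\<open>2 ^ i\<close>. The base \<open>32 = 2 ^ 5\<close> makes the powers of \<open>2 ^ i\<close> cancel in \<open>growth_constant_bound\<close>.
\<close>

lemma exists_energy_level:
  fixes f :: "'b \<Rightarrow> nat" and N M :: real
  assumes D: "finite D" and N: "N > 0" and M: "M > 0"
    and le: "\<And>s. s \<in> D \<Longrightarrow> real (f s) \<le> N"
    and energy: "N ^ 3 \<le> M * (\<Sum>s\<in>D. real (f s) ^ 2)"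
  shows "\<exists>i. N * 512 ^ i \<le> 2048 * M * real (card {s \<in> D. N / 32 ^ i \<le> real (f s)})"
proof (rule ccontr)
  define c where "c = (\<lambda>i. real (card {s \<in> D. N / 32 ^ i \<le> real (f s)}))"
  assume "\<not> ?thesis"
  then have lt: "2048 * M * c i < N * 512 ^ i" for i by (auto simp: c_def not_le)
  obtain n where n: "N < 32 ^ n" using real_arch_pow[of 32 N] by auto
  define g where "g = (\<lambda>s j. if N / 32 ^ Suc j \<le> real (f s) then (N / 32 ^ j) ^ 2 else 0)"
  have point: "real (f s) ^ 2 \<le> (\<Sum>j<n. g s j)" if s: "s \<in> D" for s
  proof (cases "f s = 0")
    case True
    then show ?thesis by (simp add: g_def sum_nonneg)
  next
    case False
    then have f1: "1 \<le> real (f s)" by simp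
    have "N / 32 ^ n < 1" using n by simp
    then have n0: "n \<noteq> 0" using le[OF s] f1 by (intro notI) simp
    define j where "j = (LEAST j. N / 32 ^ Suc j \<le> real (f s))"
    have ex: "N / 32 ^ Suc (n - 1) \<le> real (f s)" 
    proof -
      have "N / 32 ^ n \<le> real (f s)" using \<open>N / 32 ^ n < 1\<close> f1 by linarith
      moreover have "Suc (n - 1) = n" using n0 by simp
      ultimately show ?thesis by (simp only:)
    qed
    have j1: "N / 32 ^ Suc j \<le> real (f s)" unfolding j_def using ex by (rule LeastI)
    have "j \<le> n - 1" unfolding j_def using ex by (rule Least_le)
    then have jn: "j < n" using n0 by simp
    have "real (f s) \<le> N / 32 ^ j"
    proof (cases j)
      case 0
      then show ?thesis using le[OF s] by simp
    next
      case (Suc k)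
      then have "\<not> N / 32 ^ Suc k \<le> real (f s)"
        using not_less_Least[of k "\<lambda>j. N / 32 ^ Suc j \<le> real (f s)"] by (simp add: j_def)
      then show ?thesis using Suc by simp
    qed
    then have "real (f s) ^ 2 \<le> g s j" using j1 by (simp add: g_def power_mono)
    also have "\<dots> \<le> (\<Sum>j<n. g s j)" using jn by (intro member_le_sum) (auto simp: g_def)
    finally show ?thesis .
  qed
  have "(\<Sum>s\<in>D. real (f s) ^ 2) \<le> (\<Sum>s\<in>D. \<Sum>j<n. g s j)" by (intro sum_mono point)
  also have "\<dots> = (\<Sum>j<n. \<Sum>s\<in>D. g s j)" by (rule sum.swap)
  also have "\<dots> = (\<Sum>j<n. (N / 32 ^ j) ^ 2 * c (Suc j))"
  proof (intro sum.cong refl)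
    fix j
    have "(\<Sum>s\<in>D. g s j) = (\<Sum>s\<in>{s \<in> D. N / 32 ^ Suc j \<le> real (f s)}. (N / 32 ^ j) ^ 2)"
      unfolding g_def using D by (simp add: sum.If_cases Int_def)
    then show "(\<Sum>s\<in>D. g s j) = (N / 32 ^ j) ^ 2 * c (Suc j)" by (simp add: c_def)
  qed
  also have "\<dots> \<le> (\<Sum>j<n. N ^ 3 / (4 * M) * (1 / 2) ^ j)"
  proof (intro sum_mono)
    fix j
    have "c (Suc j) \<le> N * 512 ^ Suc j / (2048 * M)"
      using lt[of "Suc j"] M by (simp add: pos_le_divide_eq mult_ac)
    then have "(N / 32 ^ j) ^ 2 * c (Suc j) \<le> (N / 32 ^ j) ^ 2 * (N * 512 ^ Suc j / (2048 * M))"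
      by (intro mult_left_mono) auto
    also have "\<dots> = N ^ 3 / (4 * M) * (512 ^ j / (32 ^ j) ^ 2)"
      using M by (simp add: field_simps power2_eq_square power3_eq_cube)
    also have "512 ^ j / (32 ^ j) ^ 2 = ((1 :: real) / 2) ^ j"
      by (simp add: power2_eq_square flip: power_mult_distrib power_divide)
    finally show "(N / 32 ^ j) ^ 2 * c (Suc j) \<le> N ^ 3 / (4 * M) * (1 / 2) ^ j" .
  qed
  also have "\<dots> = N ^ 3 / (4 * M) * (\<Sum>j<n. (1 / 2) ^ j)" by (simp add: sum_distrib_left)
  also have "\<dots> \<le> N ^ 3 / (4 * M) * 2"
    using N M by (intro mult_left_mono) (auto simp: sum_gp_strict)
  finally have "(\<Sum>s\<in>D. real (f s) ^ 2) \<le> N ^ 3 / (4 * M) * 2" .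
  then have "M * (\<Sum>s\<in>D. real (f s) ^ 2) \<le> M * (N ^ 3 / (4 * M) * 2)"
    using M by (intro mult_left_mono) auto
  also have "\<dots> = N ^ 3 / 2" using M by simp
  finally have "N ^ 3 \<le> N ^ 3 / 2" using energy by linarith
  then show False using N by simp
qed

text \<open>
Otherwise the \<open>k\<close>-th powers of all \<open>k\<close> consecutive ratios exceed \<open>Q\<close>, and their product contradicts the bound on \<open>s k\<close>.
\<close>

lemma exists_small_ratio:
  fixes s :: "nat \<Rightarrow> real"
  assumes s: "\<And>j. 0 < s j" and Q: "0 \<le> Q" and le: "s k \<le> Q * s 0" and k: "k > 0"
  shows "\<exists>j<k. s (Suc j) ^ k \<le> Q * s j ^ k"
proof (rule ccontr)
  assume "\<not> ?thesis"
  then have gt: "Q * s j ^ k < s (Suc j) ^ k" if "j < k" for j using that by auto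
  have "Q ^ j * s 0 ^ k \<le> s j ^ k" if "j \<le> k" for j
    using that
  proof (induction j)
    case (Suc j)
    then have "Q * (Q ^ j * s 0 ^ k) \<le> Q * s j ^ k" using Q by (intro mult_left_mono) auto
    also have "\<dots> \<le> s (Suc j) ^ k" using gt[of j] Suc by simp
    finally show ?case by (simp add: mult.assoc)
  qed simp
  then have "Q ^ (k - 1) * s 0 ^ k \<le> s (k - 1) ^ k" by simp
  then have "Q * (Q ^ (k - 1) * s 0 ^ k) \<le> Q * s (k - 1) ^ k" using Q by (intro mult_left_mono)
  also have "\<dots> < s k ^ k" using gt[of "k - 1"] k by simp
  also have "\<dots> \<le> (Q * s 0) ^ k" using le s[of k] by (intro power_mono) auto
  also have "\<dots> = Q * (Q ^ (k - 1) * s 0 ^ k)" using k by (cases k) (auto simp: power_mult_distrib)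
  finally show False by simp
qed

text \<open>
The bookkeeping of exponents. Here \<open>s\<close> and \<open>s'\<close> are the numbers of popular differences at scales \<open>n\<close> and \<open>6 n\<close>,
\<open>w = 2 ^ i\<close> encodes the level \<open>N / w ^ 5\<close>, and the cubed quantity is the growth factor \<open>\<kappa>\<close>. If \<open>s'\<close> were
comparable to \<open>s\<close>, then \<open>\<kappa>\<close> would be of order \<open>(N w ^ 9 / s) ^ 5\<close> and so at most of order \<open>M ^ 5\<close>: the powers of
\<open>w\<close> cancel exactly. The weaker information \<open>s' ^ 12 \<le> M s ^ 12\<close>, up to a constant, contributes one more factor \<open>M\<close> to \<open>\<kappa>\<^sup>3\<close>.
\<close>

lemma growth_constant_bound:
  fixes N M s s' \<tau> \<beta> C w :: real
  assumes N: "N > 0" and M: "M > 0" and C: "C \<ge> 1" and w: "w \<ge> 1" and s'0: "s' \<ge> 0"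
    and s: "N * w ^ 9 \<le> 2048 * M * s"
    and s': "s' ^ 12 \<le> (2048 * C ^ 2 * M) * s ^ 12"
    and \<tau>: "s \<le> C * w ^ 5 * \<tau>" and \<beta>: "\<tau> \<le> 2 * \<beta>"
  shows "(221184 * s' ^ 4 * (C * N) ^ 5 / (\<tau> ^ 8 * \<beta>)) ^ 3 \<le> (442368 ^ 3 * 2048 ^ 16 * C ^ 44) * M ^ 16"
    and "N \<le> 4096 * C * M * \<beta>"
proof -
  have s0: "s > 0"
  proof -
    have "0 < N * w ^ 9" using N w by simp
    then have "0 < 2048 * M * s" using s by linarith
    then show ?thesis using M by (simp add: zero_less_mult_iff)
  qed
  have \<tau>0: "\<tau> > 0"
  proof -
    have "0 < C * w ^ 5 * \<tau>" using s0 \<tau> by linarith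
    moreover have "0 < C * w ^ 5" using C w by simp
    ultimately show ?thesis by (simp add: zero_less_mult_iff)
  qed
  have \<beta>0: "\<beta> > 0" using \<tau>0 \<beta> by simp
  have Cw: "C * w ^ 5 > 0" using C w by simp
  have inv_\<tau>: "1 / \<tau> \<le> C * w ^ 5 / s" using \<tau> \<tau>0 s0 by (simp add: field_simps)
  have "221184 * s' ^ 4 * (C * N) ^ 5 / (\<tau> ^ 8 * \<beta>) \<le> 221184 * s' ^ 4 * (C * N) ^ 5 / (\<tau> ^ 8 * (\<tau> / 2))"
    using \<beta> \<tau>0 \<beta>0 s'0 C N by (intro divide_left_mono mult_left_mono mult_pos_pos mult_nonneg_nonneg) auto
  also have "\<dots> = 442368 * s' ^ 4 * (C * N) ^ 5 * (1 / \<tau>) ^ 9"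
    using \<tau>0 by (simp add: field_simps eval_nat_numeral)
  finally have "(221184 * s' ^ 4 * (C * N) ^ 5 / (\<tau> ^ 8 * \<beta>)) ^ 3 \<le> (442368 * s' ^ 4 * (C * N) ^ 5 * (1 / \<tau>) ^ 9) ^ 3"
    using \<tau>0 \<beta>0 s'0 C N by (intro power_mono) auto
  also have "\<dots> = 442368 ^ 3 * s' ^ 12 * (C * N) ^ 15 * (1 / \<tau>) ^ 27"
    by (simp only: power_mult_distrib flip: power_mult) simp
  also have "\<dots> \<le> 442368 ^ 3 * ((2048 * C ^ 2 * M) * s ^ 12) * (C * N) ^ 15 * (C * w ^ 5 / s) ^ 27"
    using s' inv_\<tau> \<tau>0 s'0 C N M s0 w by (intro mult_mono power_mono) auto
  also have "\<dots> = (442368 ^ 3 * 2048 * C ^ 44 * M) * (N * w ^ 9 / s) ^ 15"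
  proof -
    have p: "(C * w ^ 5 / s) ^ 27 = C ^ 27 * w ^ 135 * (1 / s) ^ 27"
      by (simp add: power_divide power_mult_distrib flip: power_mult)
    have q: "(N * w ^ 9 / s) ^ 15 = N ^ 15 * w ^ 135 * (1 / s) ^ 15"
      by (simp add: power_divide power_mult_distrib flip: power_mult)
    have "(1 / s) ^ 27 = (1 / s) ^ 12 * (1 / s) ^ 15" by (simp flip: power_add)
    moreover have "s ^ 12 * (1 / s) ^ 12 = 1" using s0 by (simp flip: power_mult_distrib)
    ultimately have cancel: "s ^ 12 * (1 / s) ^ 27 = (1 / s) ^ 15" by (metis mult.assoc mult_1)
    have C44: "C ^ 2 * (C ^ 15 * C ^ 27) = C ^ 44" by (simp flip: power_add)
    have "442368 ^ 3 * ((2048 * C ^ 2 * M) * s ^ 12) * (C * N) ^ 15 * (C ^ 27 * w ^ 135 * (1 / s) ^ 27)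
        = 442368 ^ 3 * 2048 * (C ^ 2 * (C ^ 15 * C ^ 27)) * M * (N ^ 15 * w ^ 135 * (s ^ 12 * (1 / s) ^ 27))"
      by (simp only: power_mult_distrib mult_ac)
    then show ?thesis by (simp only: p q cancel C44)
  qed
  also have "\<dots> \<le> (442368 ^ 3 * 2048 * C ^ 44 * M) * (2048 * M) ^ 15"
    using s s0 C M N w by (intro mult_left_mono power_mono) (auto simp: divide_le_eq)
  also have "\<dots> = (442368 ^ 3 * 2048 ^ 16 * C ^ 44) * M ^ 16"
    by (simp add: power_mult_distrib eval_nat_numeral)
  finally show "(221184 * s' ^ 4 * (C * N) ^ 5 / (\<tau> ^ 8 * \<beta>)) ^ 3 \<le> (442368 ^ 3 * 2048 ^ 16 * C ^ 44) * M ^ 16" .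
  have "N * w ^ 5 \<le> N * w ^ 9" using N w by (intro mult_left_mono power_increasing) auto
  also have "\<dots> \<le> 2048 * M * (C * w ^ 5 * (2 * \<beta>))"
  proof -
    have "C * w ^ 5 * \<tau> \<le> C * w ^ 5 * (2 * \<beta>)" using \<beta> Cw by (intro mult_left_mono) auto
    then have "2048 * M * s \<le> 2048 * M * (C * w ^ 5 * (2 * \<beta>))" using \<tau> M by (intro mult_left_mono) auto
    then show ?thesis using s by linarith
  qed
  finally have "N * w ^ 5 \<le> (4096 * C * M * \<beta>) * w ^ 5" by (simp add: mult_ac)
  then show "N \<le> 4096 * C * M * \<beta>" using w by (simp add: mult_le_cancel_right)
qed

section \<open>The energy bound\<close>

context finite_field
begin

text \<open>
Some product \<open>y = v a\<close> has at least \<open>|V| / q\<close> representations. Their components \<open>a = y / v\<close> lie in \<open>y G\<close>, as \<open>V\<close> is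
contained in the subfield \<open>G\<close>.
\<close>

lemma card_le_coset_intersection:
  fixes q :: real
  assumes G: "subfield G R" and V: "V \<subseteq> G" "V \<subseteq> carrier R - {\<zero>}" "V \<noteq> {}" and A: "A \<subseteq> carrier R - {\<zero>}" "A \<noteq> {}"
    and q: "real (card (V <#>\<^bsub>units_of R\<^esub> A)) \<le> q * real (card A)" and q0: "0 \<le> q"
  shows "\<exists>c\<in>carrier R. real (card V) \<le> q * real (card (A \<inter> (c <#\<^bsub>R\<^esub> G)))"
proof -
  have fin: "finite V" "finite A" using V A by (auto intro: finite_subset_carrier)
  define Y where "Y = V <#>\<^bsub>units_of R\<^esub> A"
  have Y: "Y = (\<lambda>p. fst p \<otimes> snd p) ` (V \<times> A)"
    by (simp add: Y_def set_mult_eq_image units_of_mult split_def)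
  have finY: "finite Y" using fin by (simp add: Y)
  have cardA: "real (card A) > 0" using A fin by (simp add: card_gt_0_iff)
  have total: "(\<Sum>y\<in>Y. card {p \<in> V \<times> A. fst p \<otimes> snd p = y}) = card V * card A"
  proof -
    have "{p \<in> V \<times> A. fst p \<otimes> snd p \<in> Y} = V \<times> A" by (auto simp: Y)
    then show ?thesis
      using sum_card_fibres[of "V \<times> A" Y "\<lambda>p. fst p \<otimes> snd p"] fin finY by (simp add: card_cartesian_product)
  qed
  have "\<exists>y\<in>Y. real (card V) \<le> q * real (card {p \<in> V \<times> A. fst p \<otimes> snd p = y})"
  proof (rule ccontr)
    assume "\<not> ?thesis"
    then have lt: "q * real (card {p \<in> V \<times> A. fst p \<otimes> snd p = y}) < real (card V)" if "y \<in> Y" for y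
      using that by auto
    have "Y \<noteq> {}" using V A by (auto simp: Y)
    then have "(\<Sum>y\<in>Y. q * real (card {p \<in> V \<times> A. fst p \<otimes> snd p = y})) < (\<Sum>y\<in>Y. real (card V))"
      using finY lt by (intro sum_strict_mono) auto
    then have "q * real (card V * card A) < real (card Y) * real (card V)"
      by (simp add: total flip: sum_distrib_left of_nat_sum)
    also have "\<dots> \<le> (q * real (card A)) * real (card V)"
      using q by (intro mult_right_mono) (auto simp: Y_def)
    finally show False by simp
  qed
  then obtain y where y: "y \<in> Y" and le: "real (card V) \<le> q * real (card {p \<in> V \<times> A. fst p \<otimes> snd p = y})"
    by auto
  have yc: "y \<in> carrier R" using y V A by (auto simp: Y intro!: m_closed)
  have "card {p \<in> V \<times> A. fst p \<otimes> snd p = y} \<le> card (A \<inter> (y <#\<^bsub>R\<^esub> G))"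
  proof (rule card_inj_on_le[where f = snd])
    show "inj_on snd {p \<in> V \<times> A. fst p \<otimes> snd p = y}"
    proof (rule inj_onI)
      fix p p' assume p: "p \<in> {p \<in> V \<times> A. fst p \<otimes> snd p = y}" "p' \<in> {p \<in> V \<times> A. fst p \<otimes> snd p = y}"
        and e: "snd p = snd p'"
      have "fst p \<otimes> snd p = fst p' \<otimes> snd p" using p e by simp
      moreover have "fst p \<in> carrier R" "fst p' \<in> carrier R" "snd p \<in> carrier R" "snd p \<noteq> \<zero>"
        using p V A by auto
      ultimately have "fst p = fst p'" by (simp add: m_rcancel)
      then show "p = p'" using e by (simp add: prod_eq_iff)
    qed
    show "snd ` {p \<in> V \<times> A. fst p \<otimes> snd p = y} \<subseteq> A \<inter> (y <#\<^bsub>R\<^esub> G)"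
    proof
      fix a assume "a \<in> snd ` {p \<in> V \<times> A. fst p \<otimes> snd p = y}"
      then obtain v where va: "v \<in> V" "a \<in> A" "y = v \<otimes> a" by auto
      have c: "v \<in> carrier R" "v \<noteq> \<zero>" "a \<in> carrier R" using va V A by auto
      have iv: "inv v \<in> G" "inv v \<in> carrier R" "v \<otimes> inv v = \<one>"
        using subfield_m_inv[OF G, of v] va V c inv_mem by auto
      have "a = y \<otimes> inv v" unfolding va(3) using c iv by (metis m_assoc m_comm r_one)
      then show "a \<in> A \<inter> (y <#\<^bsub>R\<^esub> G)" unfolding l_coset_def using iv(1) va(2) by blast
    qed
    show "finite (A \<inter> (y <#\<^bsub>R\<^esub> G))" using fin by simp
  qed
  then have "q * real (card {p \<in> V \<times> A. fst p \<otimes> snd p = y}) \<le> q * real (card (A \<inter> (y <#\<^bsub>R\<^esub> G)))"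
    using q0 by (intro mult_left_mono) auto
  then show ?thesis using le yc by (intro bexI[of _ y]) auto
qed

end

text \<open>
The argument is a common bound for \<open>|H\<^sup>n| / |A|\<close>. The squared factor is the square of the constant in \<open>growth_constant_bound\<close>.
\<close>

definition energy_const :: "real \<Rightarrow> real" where
  "energy_const C = 2 ^ 25 * C ^ 2 * (442368 ^ 3 * 2048 ^ 16 * C ^ 44) ^ 2"

context finite_field
begin

lemma additive_energy_le_cube:
  assumes A: "A \<subseteq> carrier R"
  shows "additive_energy R A \<le> card A ^ 3"
proof -
  have "additive_energy R A = (\<Sum>s\<in>carrier R. reps A s * reps A s)"
    by (simp add: additive_energy_eq_sum[OF A] power2_eq_square)
  also have "\<dots> \<le> (\<Sum>s\<in>carrier R. card A * reps A s)"
    using reps_le_card[OF A] by (intro sum_mono mult_right_mono) auto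
  also have "\<dots> = card A * card {p \<in> A \<times> A. fst p \<ominus> snd p \<in> carrier R}"
    using sum_reps[OF A order_refl] by (simp flip: sum_distrib_left)
  also have "\<dots> \<le> card A * card (A \<times> A)"
    using finite_subset_carrier[OF A] by (intro mult_left_mono card_mono) auto
  finally show ?thesis by (simp add: card_cartesian_product power3_eq_cube)
qed

lemma set_power_quotient_units:
  assumes A: "A \<subseteq> carrier R - {\<zero>}" "A \<noteq> {}"
  defines "H \<equiv> quotient_set (units_of R) A A"
  shows "H \<subseteq> carrier R - {\<zero>}" "\<one> \<in> H" "\<And>h. h \<in> H \<Longrightarrow> inv h \<in> H"
    "\<And>a b. a \<in> A \<Longrightarrow> b \<in> A \<Longrightarrow> inv a \<otimes> b \<in> H"
proof -
  interpret U: comm_group "units_of R" by (rule units_comm_group)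
  have AU: "A \<subseteq> carrier (units_of R)" using A by (simp add: carrier_units_of)
  have H_eq: "H = (\<lambda>(a, b). a \<otimes> inv b) ` (A \<times> A)"
    unfolding H_def quotient_set_def units_of_mult
    using A by (intro image_cong) (auto simp: units_of_inv field_Units subset_iff)
  have ic: "inv a \<in> carrier R" "inv a \<noteq> \<zero>" "a \<in> carrier R" "a \<noteq> \<zero>" "a \<otimes> inv a = \<one>" if "a \<in> A" for a
  proof -
    have "a \<in> Units R" using that A by (auto simp: field_Units)
    then have "inv a \<in> Units R" by simp
    then show "inv a \<in> carrier R" "inv a \<noteq> \<zero>" "a \<in> carrier R" "a \<noteq> \<zero>" "a \<otimes> inv a = \<one>"
      using that A \<open>a \<in> Units R\<close> by (auto simp: field_Units)
  qed
  show "H \<subseteq> carrier R - {\<zero>}"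
    using ic by (auto simp: H_eq integral_iff)
  show "\<one> \<in> H"
  proof -
    obtain a where "a \<in> A" using A by auto
    then show ?thesis using ic[of a] by (force simp: H_eq)
  qed
  show "inv a \<otimes> b \<in> H" if "a \<in> A" "b \<in> A" for a b
    using that ic[of a] ic[of b] by (auto simp: H_eq m_comm intro!: image_eqI[of _ _ "(b, a)"])
  show "inv h \<in> H" if h: "h \<in> H" for h
  proof -
    obtain a b where ab: "a \<in> A" "b \<in> A" "h = a \<otimes> inv b" using h by (auto simp: H_eq)
    have "h \<otimes> (b \<otimes> inv a) = (a \<otimes> inv a) \<otimes> (b \<otimes> inv b)"
      using ic(1,3)[OF ab(1)] ic(1,3)[OF ab(2)] by (simp add: ab(3) m_ac)
    then have "h \<otimes> (b \<otimes> inv a) = \<one>" using ic[OF ab(1)] ic[OF ab(2)] by simp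
    then have "inv h = b \<otimes> inv a"
      using ic[OF ab(1)] ic[OF ab(2)] ab(3) by (intro comm_inv_char) auto
    then show ?thesis using ab by (auto simp: H_eq)
  qed
qed

text \<open>
The three alternatives are those of \<open>small_or_subfield\<close> for the normalised subset \<open>B\<close> of \<open>T/T\<close>: either \<open>B\<close> is small,
or it lies in a subfield \<open>G\<close> of size at most of order \<open>M ^ 32 |B|\<close>, which is the whole field or proper. In all cases
\<open>|A|\<close> is at most a constant times \<open>M |B|\<close>. All sets \<open>H\<^sup>n\<close> that occur have \<open>n \<le> 6 ^ 12\<close>, the twelfth scale.
\<close>

lemma energy_alternatives:
  fixes C M :: real
  assumes A: "A \<subseteq> carrier R - {\<zero>}" "A \<noteq> {}"
    and C: "\<And>n. n \<le> 6 ^ 12 \<Longrightarrow>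
      real (card (set_power (units_of R) (quotient_set (units_of R) A A) n)) \<le> C * real (card A)"
    and M: "1 \<le> M" and energy: "real (card A) ^ 3 \<le> M * real (additive_energy R A)"
  shows "real (card A) \<le> energy_const C * M ^ 33 \<or>
    real (card (carrier R)) \<le> energy_const C * M ^ 33 * real (card A) \<or>
    (\<exists>G c. proper_subfield G R \<and> c \<in> carrier R \<and>
      real (card A) \<le> energy_const C * M * real (card (A \<inter> (c <#\<^bsub>R\<^esub> G))) \<and>
      real (card G) \<le> energy_const C * M ^ 32 * real (card (A \<inter> (c <#\<^bsub>R\<^esub> G))))"
proof -
  interpret U: comm_group "units_of R" by (rule units_comm_group)
  define H where "H = quotient_set (units_of R) A A"
  define V where "V = (\<lambda>n. set_power (units_of R) H n)"
  define N where "N = real (card A)"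
  define top :: nat where "top = 6 ^ 12"
  note H = set_power_quotient_units[OF A, folded H_def]
  have Ac: "A \<subseteq> carrier R" using A by auto
  have finA: "finite A" using Ac by (rule finite_subset_carrier)
  have N: "N > 0" using A finA by (simp add: N_def card_gt_0_iff)
  have HU: "H \<subseteq> carrier (units_of R)" using H by (simp add: carrier_units_of)
  have Vc: "V k \<subseteq> carrier R - {\<zero>}" for k
    using U.set_power_closed[OF HU, of k] by (simp add: V_def carrier_units_of)
  have Vc': "V k \<subseteq> carrier R" for k using Vc[of k] by auto
  have finV: "finite (V k)" for k using Vc' by (rule finite_subset_carrier)
  have Vmult: "x \<otimes> y \<in> V (j + k)" if "x \<in> V j" "y \<in> V k" for x y j k
    using U.set_power_mult_mem[OF HU] that by (simp add: V_def units_of_mult)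
  have V1: "\<one> \<in> V k" for k
    using U.one_mem_set_power[of H k] H by (simp add: V_def units_of_one)
  have HV: "H \<subseteq> V 1"
  proof
    fix h assume h: "h \<in> H"
    then have "h = h \<otimes> \<one>" using H(1) by auto
    then show "h \<in> V 1"
      using mem_set_mult[OF h, of \<one> "{\<one>}" "units_of R"] by (simp add: V_def units_of_mult units_of_one)
  qed
  have cardV: "real (card (V n)) \<le> C * N" if "n \<le> top" for n
    using C[of n] that by (simp add: V_def H_def N_def top_def)
  have C1: "1 \<le> C"
  proof -
    have "card A \<le> card H"
    proof -
      have "card A \<le> card (quotient_set (units_of R) A A)"
        using finA A by (intro U.card_le_quotient_set) (auto simp: carrier_units_of)
      then show ?thesis by (simp add: H_def)
    qed
    also have "\<dots> \<le> card (V 1)" using HV finV by (intro card_mono)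
    finally have "N \<le> C * N" using cardV[of 1] by (simp add: N_def top_def)
    then show ?thesis using N by simp
  qed

  \<comment> \<open>The level of popularity: \<open>\<theta> = N / w ^ 5\<close> with \<open>w = 2 ^ i\<close>.\<close>
  obtain i where i: "N * 512 ^ i \<le> 2048 * M * real (card {s \<in> carrier R. N / 32 ^ i \<le> real (reps A s)})"
    using exists_energy_level[OF finite_carrier N, of M "reps A"] M energy reps_le_card[OF Ac]
    by (auto simp: N_def additive_energy_eq_sum[OF Ac])
  define \<theta> where "\<theta> = N / 32 ^ i"
  define w :: real where "w = 2 ^ i"
  have w1: "w \<ge> 1" by (simp add: w_def)
  have "w ^ k = (2 ^ k) ^ i" for k by (simp add: w_def mult.commute flip: power_mult)
  from this[of 5] this[of 9] have w5: "32 ^ i = w ^ 5" and w9: "512 ^ i = w ^ 9" by simp_all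
  have \<theta>: "\<theta> > 0" using N by (simp add: \<theta>_def)
  define s where "s = (\<lambda>n. real (card (popular (V n) \<theta>)))"
  have finpop: "finite (popular V' \<theta>')" for V' \<theta>'
    using finite_carrier by (simp add: popular_def)

  have start: "N * w ^ 9 \<le> 2048 * M * s 1"
  proof -
    obtain a where a: "a \<in> A" using A by auto
    have aU: "a \<in> Units R" using a A by (auto simp: field_Units)
    then have ia: "inv a \<in> carrier R" "inv a \<noteq> \<zero>" using Units_inv_Units[OF aU] by (auto simp: field_Units)
    have "inj_on ((\<otimes>) (inv a)) (popular A \<theta>)"
      using ia by (auto simp: inj_on_def popular_def m_lcancel)
    moreover have "(\<otimes>) (inv a) ` popular A \<theta> \<subseteq> popular (V 1) \<theta>"
      using popular_mult[OF Ac Vc' ia] H(4)[OF a] HV by blast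
    ultimately have "card (popular A \<theta>) \<le> card (popular (V 1) \<theta>)" using finpop by (intro card_inj_on_le)
    then have "2048 * M * real (card (popular A \<theta>)) \<le> 2048 * M * s 1"
      using M by (intro mult_left_mono) (auto simp: s_def)
    then show ?thesis using i by (simp add: popular_def \<theta>_def w9)
  qed
  have s_mono: "s n \<le> s m" if "n \<le> m" for n m
  proof -
    have "popular (V n) \<theta> \<subseteq> popular (V m) \<theta>"
    proof
      fix x assume x: "x \<in> popular (V n) \<theta>"
      have "\<one> \<otimes> x \<in> popular (V m) \<theta>"
      proof (rule popular_mult[OF Vc' Vc' _ _ _ x])
        show "\<one> \<otimes> y \<in> V m" if "y \<in> V n" for y
          using Vmult[OF V1[of "m - n"] that] \<open>n \<le> m\<close> by simp
      qed auto
      then show "x \<in> popular (V m) \<theta>" using x by (auto simp: popular_def)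
    qed
    then show ?thesis using finpop by (auto simp: s_def intro: card_mono)
  qed
  have s1: "0 < s 1"
  proof -
    have "0 < N * w ^ 9" using N w1 by simp
    then have "0 < 2048 * M * s 1" using start by linarith
    then show ?thesis using M by (simp add: zero_less_mult_iff)
  qed
  have s_pos: "0 < s (6 ^ j)" for j using s1 s_mono[of 1 "6 ^ j"] by simp

  \<comment> \<open>Counting representations bounds the popular set at the top scale, and hence its growth over all scales.\<close>
  have "s (6 ^ 12) \<le> (2048 * C ^ 2 * M) * s (6 ^ 0)"
  proof -
    have "\<theta> * s top \<le> real (card (V top) ^ 2)" unfolding s_def by (rule card_popular[OF Vc'])
    also have "\<dots> \<le> (C * N) ^ 2" using cardV[of top] by (simp add: power_mono)
    finally have "N * s top \<le> N * (C ^ 2 * N * w ^ 5)"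
      using N w1 by (simp add: \<theta>_def w5 divide_le_eq power2_eq_square mult_ac)
    then have "s top \<le> C ^ 2 * (N * w ^ 5)" using N by simp
    also have "\<dots> \<le> C ^ 2 * (N * w ^ 9)" using N w1 by (intro mult_left_mono power_increasing) auto
    also have "\<dots> \<le> C ^ 2 * (2048 * M * s 1)" using start by (intro mult_left_mono) auto
    finally show ?thesis by (simp add: top_def mult_ac)
  qed
  then obtain j where j: "j < 12" "s (6 ^ Suc j) ^ 12 \<le> (2048 * C ^ 2 * M) * s (6 ^ j) ^ 12"
    using exists_small_ratio[of "\<lambda>j. s (6 ^ j)" "2048 * C ^ 2 * M" 12] s_pos M by auto
  define n :: nat where "n = 6 ^ j"
  have n1: "1 \<le> n" by (simp add: n_def)
  have n_top: "6 * n \<le> top"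
  proof -
    have "(6 :: nat) ^ Suc j \<le> 6 ^ 12" using j by (intro power_increasing) auto
    then show ?thesis by (simp add: n_def top_def)
  qed
  have s': "s (6 * n) ^ 12 \<le> (2048 * C ^ 2 * M) * s n ^ 12" using j(2) by (simp add: n_def)
  have sn: "N * w ^ 9 \<le> 2048 * M * s n"
  proof -
    have "2048 * M * s 1 \<le> 2048 * M * s n" using s_mono[OF n1] M by (intro mult_left_mono) auto
    then show ?thesis using start by linarith
  qed

  have "popular (V n) \<theta> \<noteq> {}" using s1 s_mono[OF n1] by (auto simp: s_def)
  from exists_neighbourhood[OF H(1-3) this[unfolded V_def] \<theta>] obtain T
    where T': "T \<subseteq> V (2 * n) \<and> T \<noteq> {} \<and> \<theta> * s n \<le> real (card (V n)) * real (card T) \<and>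
      (\<forall>t\<in>T. \<forall>u\<in>T. \<forall>v\<in>T. t \<otimes> u \<otimes> (\<one> \<ominus> v) \<in> popular (V (6 * n)) \<theta>)"
    unfolding s_def V_def by blast
  then have T: "T \<subseteq> V (2 * n)" "T \<noteq> {}"
    and large: "\<theta> * s n \<le> real (card (V n)) * real (card T)"
    and TTS: "\<And>t u v. t \<in> T \<Longrightarrow> u \<in> T \<Longrightarrow> v \<in> T \<Longrightarrow> t \<otimes> u \<otimes> (\<one> \<ominus> v) \<in> popular (V (6 * n)) \<theta>"
    by simp_all
  have Tc: "T \<subseteq> carrier R - {\<zero>}" using T(1) Vc by blast
  have TT: "quotient_set (units_of R) T T \<subseteq> V (4 * n)"
  proof
    fix x assume "x \<in> quotient_set (units_of R) T T"
    then obtain t u where tu: "t \<in> T" "u \<in> T" "x = t \<otimes> inv\<^bsub>units_of R\<^esub> u"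
      by (auto simp: quotient_set_def units_of_mult)
    have "inv\<^bsub>units_of R\<^esub> h \<in> H" if "h \<in> H" for h
      using H that by (subst units_of_inv) (auto simp: field_Units)
    then have "inv\<^bsub>units_of R\<^esub> u \<in> V (2 * n)"
      using U.set_power_inv_mem[OF HU] tu(2) T(1) by (auto simp: V_def)
    then have "t \<otimes> inv\<^bsub>units_of R\<^esub> u \<in> V (2 * n + 2 * n)" using tu(1) T(1) by (intro Vmult) auto
    then show "x \<in> V (4 * n)" using tu by simp
  qed
  have "card (quotient_set (units_of R) T T) \<le> card (V (4 * n))" using TT finV by (intro card_mono)
  then have TTcard: "real (card (quotient_set (units_of R) T T)) \<le> C * N"
    using cardV[of "4 * n"] n_top by linarith
  obtain B where B: "B \<subseteq> quotient_set (units_of R) T T" "\<one> \<in> B" "card T \<le> 2 * card B"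
    and dil: "\<And>b. b \<in> B \<Longrightarrow> real (card ((\<lambda>(x, y). b \<otimes> x \<ominus> y) ` (B \<times> B))) * real (card T) ^ 8
      \<le> 221184 * s (6 * n) ^ 4 * (C * N) ^ 5"
    using normalised_dilate_differences[OF Tc T(2) _ TTS TTcard] unfolding s_def popular_def by blast
  define \<tau> where "\<tau> = real (card T)"
  define \<beta> where "\<beta> = real (card B)"
  have BV: "B \<subseteq> V (4 * n)" using B(1) TT by auto
  have Bc: "B \<subseteq> carrier R - {\<zero>}" using BV Vc by blast
  have \<tau>0: "\<tau> > 0" using T(2) finite_subset_carrier[of T] Tc by (auto simp: \<tau>_def card_gt_0_iff)
  have \<tau>\<beta>: "\<tau> \<le> 2 * \<beta>" using B(3) by (simp add: \<tau>_def \<beta>_def)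
  have \<beta>0: "\<beta> > 0" using \<tau>0 \<tau>\<beta> by simp
  have s\<tau>: "s n \<le> C * w ^ 5 * \<tau>"
  proof -
    have "\<theta> * s n \<le> C * N * \<tau>"
      using large cardV[of n] n_top mult_right_mono[of "real (card (V n))" "C * N" \<tau>] by (simp add: \<tau>_def)
    then have "N * s n \<le> N * (C * w ^ 5 * \<tau>)"
      using w1 by (simp add: \<theta>_def w5 divide_le_eq mult_ac)
    then show ?thesis using N by simp
  qed
  define \<kappa> where "\<kappa> = 221184 * s (6 * n) ^ 4 * (C * N) ^ 5 / (\<tau> ^ 8 * \<beta>)"
  have \<kappa>: "real (card ((\<lambda>(x, y). b \<otimes> x \<ominus> y) ` (B \<times> B))) \<le> \<kappa> * real (card B)" if "b \<in> B" for b
  proof -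
    have "\<kappa> * \<beta> = 221184 * s (6 * n) ^ 4 * (C * N) ^ 5 / \<tau> ^ 8" using \<beta>0 by (simp add: \<kappa>_def)
    then show ?thesis using dil[OF that] \<tau>0 by (simp add: \<beta>_def \<tau>_def le_divide_eq)
  qed
  have \<kappa>1: "1 \<le> \<kappa>" using kappa_ge_1[OF Bc B(2) \<kappa>] .
  define c where "c = 442368 ^ 3 * 2048 ^ 16 * C ^ 44"
  have c1: "1 \<le> c"
  proof -
    have "1 * 1 \<le> (442368 ^ 3 * 2048 ^ 16) * C ^ 44"
      using one_le_power[OF C1, of 44] by (intro mult_mono) auto
    then show ?thesis by (simp add: c_def)
  qed
  have bound: "\<kappa> ^ 3 \<le> c * M ^ 16" and N_le: "N \<le> 4096 * C * M * \<beta>"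
    using growth_constant_bound[of N M C w "s (6 * n)" "s n" \<tau> \<beta>] N M C1 w1 sn s' s\<tau> \<tau>\<beta>
    by (auto simp: \<kappa>_def c_def s_def)
  have pow6: "2 * (4 * \<kappa>) ^ 6 \<le> 8192 * c ^ 2 * M ^ 32"
  proof -
    have "2 * (4 * \<kappa>) ^ 6 = 8192 * (\<kappa> ^ 3) ^ 2" by (simp add: power_mult_distrib flip: power_mult)
    also have "\<dots> \<le> 8192 * (c * M ^ 16) ^ 2" using bound \<kappa>1 by (intro mult_left_mono power_mono) auto
    also have "\<dots> = 8192 * c ^ 2 * M ^ 32" by (simp add: power_mult_distrib flip: power_mult)
    finally show ?thesis .
  qed
  have pow4: "2 * (4 * \<kappa>) ^ 4 \<le> 8192 * c ^ 2 * M ^ 32"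
  proof -
    have "(4 * \<kappa>) ^ 4 \<le> (4 * \<kappa>) ^ 6" using \<kappa>1 by (intro power_increasing) auto
    then show ?thesis using pow6 by linarith
  qed
  define E where "E = energy_const C"
  have E: "E = 33554432 * C ^ 2 * c ^ 2" by (simp add: E_def energy_const_def c_def)
  have CC: "C \<le> C ^ 2" "1 \<le> C ^ 2" "1 \<le> c ^ 2"
    using C1 one_le_power[OF C1, of 2] one_le_power[OF c1, of 2] by (auto simp: power2_eq_square)
  have E1: "33554432 * C * c ^ 2 \<le> E" unfolding E using CC C1 by (intro mult_mono) auto
  have E2: "8192 * c ^ 2 * C \<le> E"
  proof -
    have "8192 * c ^ 2 * C = 8192 * (C * c ^ 2)" by simp
    also have "\<dots> \<le> 33554432 * (C ^ 2 * c ^ 2)" using CC C1 by (intro mult_mono) auto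
    finally show ?thesis by (simp add: E)
  qed
  have E3: "4096 * C ^ 2 \<le> E"
  proof -
    have "4096 * C ^ 2 * 1 \<le> 33554432 * C ^ 2 * c ^ 2" using CC by (intro mult_mono) auto
    then show ?thesis by (simp add: E)
  qed
  have M0: "0 \<le> M" using M by simp
  have E0: "0 \<le> E" by (simp add: E)
  consider "\<beta> \<le> 2 * (4 * \<kappa>) ^ 6"
    | G where "subfield G R" "B \<subseteq> G" "real (card G) \<le> 2 * (4 * \<kappa>) ^ 4 * \<beta>"
    using small_or_subfield[OF Bc B(2) \<kappa>] by (auto simp: \<beta>_def)
  then show ?thesis
  proof cases
    case 1
    have "N \<le> 4096 * C * M * \<beta>" by (rule N_le)
    also have "\<dots> \<le> 4096 * C * M * (8192 * c ^ 2 * M ^ 32)"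
      using 1 pow6 C1 M by (intro mult_left_mono) auto
    also have "\<dots> = (33554432 * C * c ^ 2) * M ^ 33" by (simp add: eval_nat_numeral)
    also have "\<dots> \<le> E * M ^ 33" using E1 M by (intro mult_right_mono) auto
    finally show ?thesis by (simp add: N_def E_def)
  next
    case 2
    have G\<beta>: "real (card G) \<le> 8192 * c ^ 2 * M ^ 32 * \<beta>"
      using 2(3) mult_right_mono[OF pow4, of \<beta>] \<beta>0 by linarith
    show ?thesis
    proof (cases "G = carrier R")
      case True
      have "card B \<le> card (V (4 * n))" using BV finV by (intro card_mono)
      then have "\<beta> \<le> C * N" using cardV[of "4 * n"] n_top unfolding \<beta>_def by linarith
      then have "8192 * c ^ 2 * M ^ 32 * \<beta> \<le> 8192 * c ^ 2 * M ^ 32 * (C * N)"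
        using M by (intro mult_left_mono) auto
      also have "\<dots> = (8192 * c ^ 2 * C) * M ^ 32 * N" by simp
      also have "\<dots> \<le> E * M ^ 33 * N"
        using E2 E0 M N C1 by (intro mult_mono power_increasing) auto
      finally show ?thesis using G\<beta> True by (simp add: N_def E_def)
    next
      case False
      have "real (card (B <#>\<^bsub>units_of R\<^esub> A)) \<le> C * real (card A)"
      proof -
        obtain a where a: "a \<in> A" using A by auto
        have "a \<in> Units R" using a A by (auto simp: field_Units)
        then have ac: "a \<in> carrier R" "inv a \<in> carrier R" "a \<otimes> inv a = \<one>" by auto
        have "B <#>\<^bsub>units_of R\<^esub> A \<subseteq> (\<otimes>) a ` V (4 * n + 1)"
        proof
          fix z assume "z \<in> B <#>\<^bsub>units_of R\<^esub> A"
          then obtain b x where bx: "b \<in> B" "x \<in> A" "z = b \<otimes> x" by (auto simp: set_mult_def units_of_mult)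
          have "b \<in> carrier R" "x \<in> carrier R" using bx Bc A by auto
          then have "z = (a \<otimes> inv a) \<otimes> (b \<otimes> x)" using bx ac by simp
          also have "\<dots> = a \<otimes> (b \<otimes> (inv a \<otimes> x))"
            using \<open>b \<in> carrier R\<close> \<open>x \<in> carrier R\<close> ac(1,2) by (simp add: m_ac)
          also have "b \<otimes> (inv a \<otimes> x) \<in> V (4 * n + 1)"
            using bx BV HV H(4)[OF a bx(2)] by (intro Vmult) auto
          ultimately show "z \<in> (\<otimes>) a ` V (4 * n + 1)" by (metis imageI)
        qed
        then have "card (B <#>\<^bsub>units_of R\<^esub> A) \<le> card ((\<otimes>) a ` V (4 * n + 1))"
          using finV by (intro card_mono) auto
        also have "\<dots> \<le> card (V (4 * n + 1))" using finV by (rule card_image_le)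
        finally show ?thesis using cardV[of "4 * n + 1"] n_top n1 by (simp add: N_def)
      qed
      moreover have "B \<noteq> {}" using B(2) by auto
      ultimately obtain d where d: "d \<in> carrier R" "\<beta> \<le> C * real (card (A \<inter> (d <#\<^bsub>R\<^esub> G)))"
        using card_le_coset_intersection[OF 2(1,2) Bc _ A, of C] C1 unfolding \<beta>_def by auto
      define x where "x = real (card (A \<inter> (d <#\<^bsub>R\<^esub> G)))"
      have x0: "0 \<le> x" by (simp add: x_def)
      have "4096 * C * M * \<beta> \<le> 4096 * C * M * (C * x)"
        using d(2) C1 M by (intro mult_left_mono) (auto simp: x_def)
      also have "\<dots> = (4096 * C ^ 2) * M * x" by (simp add: power2_eq_square)
      also have "\<dots> \<le> E * M * x" using E3 M x0 by (intro mult_right_mono) auto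
      finally have "N \<le> E * M * x" using N_le by linarith
      moreover have "real (card G) \<le> E * M ^ 32 * x"
      proof -
        have "8192 * c ^ 2 * M ^ 32 * \<beta> \<le> 8192 * c ^ 2 * M ^ 32 * (C * x)"
          using d(2) M by (intro mult_left_mono) (auto simp: x_def)
        also have "\<dots> = (8192 * c ^ 2 * C) * M ^ 32 * x" by simp
        also have "\<dots> \<le> E * M ^ 32 * x" using E2 M x0 by (intro mult_right_mono) auto
        finally show ?thesis using G\<beta> by linarith
      qed
      moreover have "proper_subfield G R" using 2(1) False by (simp add: proper_subfield_def)
      ultimately show ?thesis using d(1) by (auto simp: N_def E_def x_def)
    qed
  qed
qed

text \<open>
Removing \<open>0\<close> from \<open>A\<close> costs at most \<open>4 |A|\<^sup>2\<close> of the energy, at most half of it here, and at most half of the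
elements.
\<close>

lemma energy_alternatives_with_zero:
  fixes K :: real
  defines "C \<equiv> energy_const (max 1 (2 * K) ^ (2 * 6 ^ 12))"
  assumes A: "A \<subseteq> carrier R" and approx: "approx_with K (real (card (ratio_set R A))) (real (card A))"
    and large: "8 * real (card A) ^ 2 \<le> real (additive_energy R A)"
  defines "M \<equiv> 2 * real (card A) ^ 3 / real (additive_energy R A)"
  shows "real (card A) \<le> 2 * C * M ^ 33 \<or>
    real (card (carrier R)) \<le> C * M ^ 33 * real (card A) \<or>
    (\<exists>G c. proper_subfield G R \<and> c \<in> carrier R \<and>
      real (card A) \<le> 2 * C * M * real (card (A \<inter> (c <#\<^bsub>R\<^esub> G))) \<and>
      real (card G) \<le> C * M ^ 32 * real (card (A \<inter> (c <#\<^bsub>R\<^esub> G))))"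
proof -
  interpret U: comm_group "units_of R" by (rule units_comm_group)
  define A0 where "A0 = A - {\<zero>}"
  define N where "N = real (card A)"
  define N0 where "N0 = real (card A0)"
  define E where "E = real (additive_energy R A)"
  define E0 where "E0 = real (additive_energy R A0)"
  define K0 where "K0 = max 1 (2 * K)"
  have finA: "finite A" using A by (rule finite_subset_carrier)
  have N: "N > 0" and ratio0: "card (ratio_set R A) > 0" and ratio: "real (card (ratio_set R A)) \<le> K * N"
    using approx by (auto simp: approx_with_def N_def)
  have A0: "A0 \<subseteq> carrier R - {\<zero>}" using A by (auto simp: A0_def)
  have "ratio_set R A \<noteq> {}" using ratio0 by auto
  then have A0ne: "A0 \<noteq> {}" by (auto simp: ratio_set_def A0_def)
  have finA0: "finite A0" using finA by (simp add: A0_def)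
  have "card A0 \<ge> 1" using finA0 A0ne by (simp add: Suc_le_eq card_gt_0_iff)
  moreover have "card A \<le> card A0 + 1"
  proof -
    have "card A \<le> card (insert \<zero> A0)" using finA0 by (intro card_mono) (auto simp: A0_def)
    also have "\<dots> \<le> card A0 + 1" using finA0 by (simp add: card_insert_if)
    finally show ?thesis .
  qed
  ultimately have NN0: "N \<le> 2 * N0" by (simp add: N_def N0_def)
  have N0N: "N0 \<le> N" using finA by (auto simp: N_def N0_def A0_def intro: card_mono)
  have N0: "N0 > 0" using NN0 N by simp
  have finratio: "finite (ratio_set R A)"
    by (rule finite_subset[of _ "(\<lambda>(a, b). a \<otimes> inv b) ` (A \<times> A)"]) (auto simp: ratio_set_def finA)
  have "quotient_set (units_of R) A0 A0 \<subseteq> ratio_set R A"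
  proof
    fix x assume "x \<in> quotient_set (units_of R) A0 A0"
    then obtain a b where ab: "a \<in> A0" "b \<in> A0" "x = a \<otimes> inv\<^bsub>units_of R\<^esub> b"
      by (auto simp: quotient_set_def units_of_mult)
    have "b \<in> Units R" using ab(2) A0 by (auto simp: field_Units)
    then have "x = a \<otimes> inv b" using ab(3) by (simp only: units_of_inv)
    then show "x \<in> ratio_set R A" using ab(1,2) unfolding ratio_set_def A0_def by blast
  qed
  then have "card (quotient_set (units_of R) A0 A0) \<le> card (ratio_set R A)"
    using finratio by (rule card_mono[rotated])
  then have "real (card (quotient_set (units_of R) A0 A0)) \<le> K * N" using ratio by linarith
  also have "\<dots> \<le> K0 * N0"
  proof -
    have "0 < K * N" using ratio ratio0 by linarith
    then have "K > 0" using N by (simp add: zero_less_mult_iff)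
    then have "K * N \<le> K * (2 * N0)" using NN0 by (intro mult_left_mono) auto
    also have "\<dots> \<le> K0 * N0" using N0 by (simp add: K0_def)
    finally show ?thesis .
  qed
  finally have quot: "real (card (quotient_set (units_of R) A0 A0)) \<le> K0 * real (card A0)" by (simp add: N0_def)
  have growth: "real (card (set_power (units_of R) (quotient_set (units_of R) A0 A0) n)) \<le> K0 ^ (2 * 6 ^ 12) * real (card A0)"
    if "n \<le> 6 ^ 12" for n
  proof -
    have "real (card (set_power (units_of R) (quotient_set (units_of R) A0 A0) n)) \<le> K0 ^ (2 * n) * real (card A0)"
      using finA0 A0 A0ne quot by (intro U.card_set_power_quotient_set) (auto simp: carrier_units_of)
    also have "\<dots> \<le> K0 ^ (2 * 6 ^ 12) * real (card A0)"
      using that by (intro mult_right_mono power_increasing mult_le_mono2) (auto simp: K0_def)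
    finally show ?thesis .
  qed
  have E: "E > 0" using large N unfolding E_def N_def
    by (metis less_le_trans mult_pos_pos zero_less_numeral zero_less_power)
  have "additive_energy R A \<le> additive_energy R A0 + 4 * card A ^ 2"
    using additive_energy_delete_zero[OF A] by (simp add: A0_def)
  then have "real (additive_energy R A) \<le> real (additive_energy R A0 + 4 * card A ^ 2)" by (rule of_nat_mono)
  then have "E \<le> E0 + 4 * N ^ 2" by (simp add: E_def E0_def N_def)
  then have E0: "E \<le> 2 * E0" using large by (simp add: E_def N_def)
  have "additive_energy R A \<le> card A ^ 3" by (rule additive_energy_le_cube[OF A])
  then have "E \<le> N ^ 3" unfolding E_def N_def by (metis of_nat_le_iff of_nat_power)
  then have M1: "1 \<le> M" using E by (simp add: M_def flip: E_def N_def)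
  have M0: "0 \<le> M" using M1 by simp
  have energy: "N0 ^ 3 \<le> M * E0"
  proof -
    have "N0 ^ 3 \<le> N ^ 3" using N0N N0 by (intro power_mono) auto
    also have "\<dots> = M * (E / 2)" using E by (simp add: M_def flip: E_def N_def)
    also have "\<dots> \<le> M * E0" using E0 M0 by (intro mult_left_mono) auto
    finally show ?thesis .
  qed
  have C: "C = energy_const (K0 ^ (2 * 6 ^ 12))" by (simp only: C_def K0_def)
  have "C \<ge> 0" by (simp add: C energy_const_def K0_def)
  have sub: "real (card (A0 \<inter> V)) \<le> real (card (A \<inter> V))" for V
    using finA by (intro of_nat_mono card_mono) (auto simp: A0_def)
  consider "N0 \<le> C * M ^ 33" | "real (card (carrier R)) \<le> C * M ^ 33 * N0"
    | G c where "proper_subfield G R" "c \<in> carrier R" "N0 \<le> C * M * real (card (A0 \<inter> (c <#\<^bsub>R\<^esub> G)))"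
      "real (card G) \<le> C * M ^ 32 * real (card (A0 \<inter> (c <#\<^bsub>R\<^esub> G)))"
    using energy_alternatives[OF A0 A0ne growth M1, folded N0_def C E0_def, OF _ energy] by blast
  then show ?thesis
  proof cases
    case 1
    then show ?thesis using NN0 by (simp flip: N_def)
  next
    case 2
    also have "C * M ^ 33 * N0 \<le> C * M ^ 33 * N"
      using N0N \<open>C \<ge> 0\<close> M0 by (intro mult_left_mono) auto
    finally show ?thesis by (simp flip: N_def)
  next
    case 3
    have "C * M * real (card (A0 \<inter> (c <#\<^bsub>R\<^esub> G))) \<le> C * M * real (card (A \<inter> (c <#\<^bsub>R\<^esub> G)))"
      "C * M ^ 32 * real (card (A0 \<inter> (c <#\<^bsub>R\<^esub> G))) \<le> C * M ^ 32 * real (card (A \<inter> (c <#\<^bsub>R\<^esub> G)))"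
      using sub \<open>C \<ge> 0\<close> M0 by (auto intro!: mult_left_mono)
    then have "N \<le> 2 * C * M * real (card (A \<inter> (c <#\<^bsub>R\<^esub> G)))"
        "real (card G) \<le> C * M ^ 32 * real (card (A \<inter> (c <#\<^bsub>R\<^esub> G)))"
      using 3(3,4) NN0 by linarith+
    then show ?thesis using 3(1,2) by (auto simp flip: N_def)
  qed
qed

end

text \<open>
What the failure of the energy bound with constant \<open>B\<close> says about \<open>M\<close>, where half of the energy \<open>E\<close> is \<open>N\<^sup>3 / M\<close>. Since
\<open>2 / B \<le> 1\<close>, its 33rd power is estimated by \<open>2 / B\<close>.
\<close>

lemma large_energy_ratio:
  fixes N q E B \<delta> :: real
  assumes N: "1 \<le> N" and q: "0 < q" and B: "8 \<le> B" and \<delta>: "\<delta> \<le> 1 / 33" and EN: "E \<le> N ^ 3"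
    and E: "B * max (N powr (3 - \<delta>)) (N powr (3 + 1 / 33) / q powr (1 / 33)) \<le> E"
  defines "M \<equiv> 2 * N ^ 3 / E"
  shows "8 * N ^ 2 \<le> E" "M \<le> 2 / B * N powr \<delta>" "M ^ 33 \<le> 2 / B * N" "M ^ 33 * N \<le> 2 / B * q"
proof -
  have N0: "0 < N" using N by simp
  have N3: "N powr 3 = N ^ 3" using N0 powr_realpow[of N 3] by simp
  have le_E: "B * x \<le> E" if "x \<le> max (N powr (3 - \<delta>)) (N powr (3 + 1 / 33) / q powr (1 / 33))" for x
    using mult_left_mono[OF that, of B] B E by linarith
  have E1: "B * N powr (3 - \<delta>) \<le> E" and E2: "B * (N powr (3 + 1 / 33) / q powr (1 / 33)) \<le> E"
    by (rule le_E; rule max.cobounded1 max.cobounded2)+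
  have E0: "E > 0" using E1 B N0 by (intro less_le_trans[OF _ E1] mult_pos_pos) auto
  have root33: "(x powr (1 / 33)) ^ 33 = x" if "0 < x" for x :: real
    using that by (simp add: powr_powr flip: powr_realpow)
  have B2: "(2 / B) ^ 33 \<le> 2 / B" using B power_decreasing[of 1 33 "2 / B"] by simp
  show "8 * N ^ 2 \<le> E"
  proof -
    have "N ^ 2 = N powr 2" using N0 powr_realpow[of N 2] by simp
    also have "\<dots> \<le> N powr (3 - \<delta>)" using N \<delta> by (intro powr_mono) auto
    finally have "8 * N ^ 2 \<le> B * N powr (3 - \<delta>)" using B by (intro mult_mono) auto
    then show ?thesis using E1 by linarith
  qed
  show M\<delta>: "M \<le> 2 / B * N powr \<delta>"
  proof -
    have "M \<le> 2 * N ^ 3 / (B * N powr (3 - \<delta>))"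
      unfolding M_def using E1 E0 B N0 by (intro divide_left_mono mult_pos_pos) auto
    also have "\<dots> = 2 / B * N powr \<delta>" using N0 B by (simp add: powr_diff N3 field_simps)
    finally show ?thesis .
  qed
  have M0: "0 \<le> M" using N0 E0 by (simp add: M_def)
  show "M ^ 33 \<le> 2 / B * N"
  proof -
    have "N powr \<delta> \<le> N powr (1 / 33)" using N \<delta> by (intro powr_mono) auto
    then have "2 / B * N powr \<delta> \<le> 2 / B * N powr (1 / 33)" using B by (intro mult_left_mono) auto
    then have "M ^ 33 \<le> (2 / B * N powr (1 / 33)) ^ 33" using M\<delta> M0 by (intro power_mono) auto
    also have "\<dots> = (2 / B) ^ 33 * N" using N0 by (simp only: power_mult_distrib root33)
    also have "\<dots> \<le> 2 / B * N" using B2 N0 by (intro mult_right_mono) auto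
    finally show ?thesis .
  qed
  show "M ^ 33 * N \<le> 2 / B * q"
  proof -
    have "M \<le> 2 * N ^ 3 / (B * (N powr (3 + 1 / 33) / q powr (1 / 33)))"
      unfolding M_def using E2 E0 B N0 q by (intro divide_left_mono mult_pos_pos divide_pos_pos) auto
    also have "\<dots> = 2 / B * (q powr (1 / 33) / N powr (1 / 33))"
      unfolding powr_add N3 using N0 B q by simp
    finally have "M ^ 33 \<le> (2 / B * (q powr (1 / 33) / N powr (1 / 33))) ^ 33" using M0 by (intro power_mono) auto
    also have "\<dots> = (2 / B) ^ 33 * (q / N)" using N0 q by (simp only: power_mult_distrib power_divide root33)
    also have "\<dots> \<le> 2 / B * (q / N)" using B2 N0 q by (intro mult_right_mono) auto
    finally have "M ^ 33 * N \<le> 2 / B * (q / N) * N" using N0 by (intro mult_right_mono) auto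
    then show ?thesis using N0 by simp
  qed
qed

text \<open>
If the bound fails, the first two of the three alternatives for the energy contradict the size of \<open>B\<close>. The
third one is left to the hypothesis \<open>sub\<close>, in which the two kinds of information on \<open>M\<close> from \<open>large_energy_ratio\<close> are
available; the two parts of the theorem differ only here.
\<close>

lemma energy_bound:
  fixes K B \<delta> :: real and F :: "'a ring"
  defines "C \<equiv> energy_const (max 1 (2 * K) ^ (2 * 6 ^ 12))"
  assumes F: "finite_field_of_order F q" and A: "A \<subseteq> carrier F"
    and approx: "approx_with K (real (card (ratio_set F A))) (real (card A))"
    and \<delta>: "\<delta> \<le> 1 / 33" and B: "8 + 8 * C \<le> B"
    and sub: "\<And>G c M. proper_subfield G F \<Longrightarrow> c \<in> carrier F \<Longrightarrow> 0 \<le> M \<Longrightarrow>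
      M \<le> 2 / B * real (card A) powr \<delta> \<Longrightarrow> M ^ 33 \<le> 2 / B * real (card A) \<Longrightarrow>
      real (card A) \<le> 2 * C * M * real (card (A \<inter> (c <#\<^bsub>F\<^esub> G))) \<Longrightarrow>
      real (card G) \<le> C * M ^ 32 * real (card (A \<inter> (c <#\<^bsub>F\<^esub> G))) \<Longrightarrow> False"
  shows "real (additive_energy F A)
    < B * max (real (card A) powr (3 - \<delta>)) (real (card A) powr (3 + 1 / 33) / real q powr (1 / 33))"
proof (rule ccontr)
  interpret field F using F by (simp add: finite_field_of_order_def)
  interpret finite_field F using F by unfold_locales (simp add: finite_field_of_order_def)
  assume "\<not> ?thesis"
  then have E: "B * max (real (card A) powr (3 - \<delta>)) (real (card A) powr (3 + 1 / 33) / real q powr (1 / 33))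
      \<le> real (additive_energy F A)" by simp
  have q: "card (carrier F) = q" "0 < real q"
    using F carrier_not_empty by (auto simp: finite_field_of_order_def card_gt_0_iff)
  have C0: "0 \<le> C" by (simp add: C_def energy_const_def)
  have B8: "8 \<le> B" using B C0 by simp
  have N1: "1 \<le> real (card A)" using approx by (simp add: approx_with_def)
  have cube: "real (additive_energy F A) \<le> real (card A) ^ 3"
    using additive_energy_le_cube[OF A] by (metis of_nat_le_iff of_nat_power)
  define M where "M = 2 * real (card A) ^ 3 / real (additive_energy F A)"
  note bounds = large_energy_ratio[OF N1 q(2) B8 \<delta> cube E, folded M_def]
  have CB: "2 * C * (2 / B) \<le> 1 / 2"
  proof -
    have "8 * C \<le> B" using B by simp
    then show ?thesis using B8 by (simp add: divide_le_eq)
  qed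
  have M0: "0 \<le> M" by (simp add: M_def)
  consider "real (card A) \<le> 2 * C * M ^ 33" | "real q \<le> C * M ^ 33 * real (card A)"
    | G c where "proper_subfield G F" "c \<in> carrier F" "real (card A) \<le> 2 * C * M * real (card (A \<inter> (c <#\<^bsub>F\<^esub> G)))"
      "real (card G) \<le> C * M ^ 32 * real (card (A \<inter> (c <#\<^bsub>F\<^esub> G)))"
    using energy_alternatives_with_zero[OF A approx bounds(1), folded C_def M_def] q(1) by auto
  then show False
  proof cases
    case 1
    also have "2 * C * M ^ 33 \<le> 2 * C * (2 / B * real (card A))"
      using bounds(3) C0 by (intro mult_left_mono) auto
    also have "\<dots> = 2 * C * (2 / B) * real (card A)" by simp
    also have "\<dots> \<le> 1 / 2 * real (card A)" using CB by (intro mult_right_mono) auto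
    finally show False using N1 by simp
  next
    case 2
    also have "C * M ^ 33 * real (card A) = C * (M ^ 33 * real (card A))" by simp
    also have "\<dots> \<le> C * (2 / B * real q)" using bounds(4) C0 by (rule mult_left_mono)
    also have "\<dots> = (C * (2 / B)) * real q" by simp
    also have "\<dots> \<le> 1 / 2 * real q"
    proof (rule mult_right_mono)
      have "0 \<le> C * (2 / B)" using C0 B8 by simp
      then show "C * (2 / B) \<le> 1 / 2" using CB by linarith
    qed simp
    finally show False using q(2) by simp
  next
    case 3
    then show False using sub[OF 3(1,2) M0 bounds(2,3)] by simp
  qed
qed

lemma mult_two_div_le_half:
  fixes t B x :: real
  assumes "0 < B" "4 * t \<le> B" "0 \<le> x"
  shows "t * (2 / B) * x \<le> x / 2"
proof -
  have "t * (2 / B) \<le> 1 / 2" using assms by (simp add: divide_le_eq)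
  then have "t * (2 / B) * x \<le> 1 / 2 * x" using assms(3) by (rule mult_right_mono)
  then show ?thesis by simp
qed

lemma energy_bound_if_coset_intersections_small:
  fixes K \<delta> :: real and F :: "'a ring"
  defines "C \<equiv> energy_const (max 1 (2 * K) ^ (2 * 6 ^ 12))"
  assumes F: "finite_field_of_order F q" and A: "A \<subseteq> carrier F"
    and approx: "approx_with K (real (card (ratio_set F A))) (real (card A))"
    and \<delta>: "\<delta> \<le> 1 / 33"
    and sub: "\<And>G c. proper_subfield G F \<Longrightarrow> c \<in> carrier F \<Longrightarrow>
      real (card (A \<inter> (c <#\<^bsub>F\<^esub> G))) \<le> real (card A) powr (1 - \<delta>)"
  shows "real (additive_energy F A) < (8 + 8 * C) *
    max (real (card A) powr (3 - \<delta>)) (real (card A) powr (3 + 1 / 33) / real q powr (1 / 33))"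
proof -
  define B where "B = 8 + 8 * C"
  have C0: "0 \<le> C" by (simp add: C_def energy_const_def)
  have N: "0 < real (card A)" using approx by (simp add: approx_with_def)
  have "real (additive_energy F A) < B *
    max (real (card A) powr (3 - \<delta>)) (real (card A) powr (3 + 1 / 33) / real q powr (1 / 33))"
  proof (rule energy_bound[OF F A approx \<delta>, folded C_def])
    show "8 + 8 * C \<le> B" by (simp add: B_def)
    fix G c and M :: real
    assume G: "proper_subfield G F" "c \<in> carrier F" and M: "0 \<le> M" "M \<le> 2 / B * real (card A) powr \<delta>"
      and le: "real (card A) \<le> 2 * C * M * real (card (A \<inter> (c <#\<^bsub>F\<^esub> G)))"
    have "M * real (card (A \<inter> (c <#\<^bsub>F\<^esub> G))) \<le> (2 / B * real (card A) powr \<delta>) * real (card A) powr (1 - \<delta>)"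
      using sub[OF G] M by (intro mult_mono) auto
    also have "\<dots> = 2 / B * (real (card A) powr \<delta> * real (card A) powr (1 - \<delta>))" by simp
    also have "\<dots> = 2 / B * real (card A)" unfolding powr_add[symmetric] using N by simp
    finally have "2 * C * (M * real (card (A \<inter> (c <#\<^bsub>F\<^esub> G)))) \<le> 2 * C * (2 / B * real (card A))"
      using C0 by (intro mult_left_mono) auto
    also have "\<dots> = 2 * C * (2 / B) * real (card A)" by simp
    also have "\<dots> \<le> real (card A) / 2" using C0 N by (intro mult_two_div_le_half) (auto simp: B_def)
    finally show False using le N by simp
  qed
  then show ?thesis by (simp only: B_def)
qed

text \<open>
Write \<open>x = |A \<inter> c G|\<close>. The hypothesis gives \<open>x\<^sup>2 \<le> L\<^sup>2 |G|\<close>, which together with \<open>|G| \<le> C M ^ 32 x\<close> bounds \<open>x\<close> by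
\<open>L\<^sup>2 C M ^ 32\<close>; then \<open>|A| \<le> 2 C M x\<close> is at most of order \<open>M ^ 33\<close>.
\<close>

lemma energy_bound_if_coset_intersections_le_sqrt:
  fixes K L :: real and F :: "'a ring"
  defines "C \<equiv> energy_const (max 1 (2 * K) ^ (2 * 6 ^ 12))"
  assumes F: "finite_field_of_order F q" and A: "A \<subseteq> carrier F"
    and approx: "approx_with K (real (card (ratio_set F A))) (real (card A))"
    and sub: "\<And>G c. proper_subfield G F \<Longrightarrow> c \<in> carrier F \<Longrightarrow>
      real (card (A \<inter> (c <#\<^bsub>F\<^esub> G))) \<le> L * real (card G) powr (1 / 2)"
  shows "real (additive_energy F A) < (8 + 8 * C + 8 * (C\<^sup>2 * L\<^sup>2)) *
    max (real (card A) powr (3 - 1 / 33)) (real (card A) powr (3 + 1 / 33) / real q powr (1 / 33))"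
proof -
  define B where "B = 8 + 8 * C + 8 * (C\<^sup>2 * L\<^sup>2)"
  have C0: "0 \<le> C" by (simp add: C_def energy_const_def)
  have B: "0 < B" "8 + 8 * C \<le> B" using C0 by (auto simp: B_def add_pos_nonneg)
  have N: "0 < real (card A)" using approx by (simp add: approx_with_def)
  have "real (additive_energy F A) < B *
    max (real (card A) powr (3 - 1 / 33)) (real (card A) powr (3 + 1 / 33) / real q powr (1 / 33))"
  proof (rule energy_bound[OF F A approx order_refl, folded C_def])
    show "8 + 8 * C \<le> B" by (rule B)
    fix G c and M :: real
    assume G: "proper_subfield G F" "c \<in> carrier F" and M: "0 \<le> M" "M ^ 33 \<le> 2 / B * real (card A)"
      and le: "real (card A) \<le> 2 * C * M * real (card (A \<inter> (c <#\<^bsub>F\<^esub> G)))"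
      and G_le: "real (card G) \<le> C * M ^ 32 * real (card (A \<inter> (c <#\<^bsub>F\<^esub> G)))"
    define x where "x = real (card (A \<inter> (c <#\<^bsub>F\<^esub> G)))"
    have "x \<noteq> 0" using le[folded x_def] N by auto
    moreover have "0 \<le> x" by (simp add: x_def)
    ultimately have x: "x > 0" by simp
    have "x \<le> L * sqrt (real (card G))" using sub[OF G] by (simp add: x_def powr_half_sqrt)
    then have "x\<^sup>2 \<le> (L * sqrt (real (card G)))\<^sup>2" using x by (intro power_mono) auto
    also have "\<dots> = L\<^sup>2 * real (card G)" by (simp add: power_mult_distrib)
    also have "\<dots> \<le> L\<^sup>2 * (C * M ^ 32 * x)" using G_le by (intro mult_left_mono) (auto simp: x_def)
    finally have "x * x \<le> (L\<^sup>2 * C * M ^ 32) * x" by (simp add: power2_eq_square)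
    then have x_le: "x \<le> L\<^sup>2 * C * M ^ 32" using x by simp
    have "real (card A) \<le> 2 * C * M * x" using le by (simp add: x_def)
    also have "\<dots> \<le> 2 * C * M * (L\<^sup>2 * C * M ^ 32)" using x_le C0 M by (intro mult_left_mono) auto
    also have "\<dots> = 2 * (C\<^sup>2 * L\<^sup>2) * M ^ 33" by (simp add: eval_nat_numeral)
    also have "\<dots> \<le> 2 * (C\<^sup>2 * L\<^sup>2) * (2 / B * real (card A))" using M by (intro mult_left_mono) auto
    also have "\<dots> = 2 * (C\<^sup>2 * L\<^sup>2) * (2 / B) * real (card A)" by simp
    also have "\<dots> \<le> real (card A) / 2" using B(1) N C0 by (intro mult_two_div_le_half) (auto simp: B_def)
    finally show False using N by simp
  qed
  then show ?thesis by (simp only: B_def)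
qed

theorem theorem1:
  shows
    "(\<exists>lam::real. lam > 0 \<and>
       (\<forall>K::real. K > 0 \<longrightarrow>
         (\<exists>C::real. C > 0 \<and>
           (\<forall>(\<delta>::real) (p::nat) (m::nat) (q::nat) (F::'a ring) (A::'a set).
              \<delta> \<le> 1 / 33 \<longrightarrow>
              Factorial_Ring.prime p \<longrightarrow> m \<ge> 1 \<longrightarrow> q = p ^ m \<longrightarrow>
              finite_field_of_order F q \<longrightarrow>
              A \<subseteq> carrier F \<longrightarrow>
              approx_with K (real (card (ratio_set F A))) (real (card A)) \<longrightarrow>
              (\<forall>G c. proper_subfield G F \<longrightarrow> c \<in> carrier F \<longrightarrow>
                 real (card (A \<inter> (c <#\<^bsub>F\<^esub> G))) \<le> lam * real (card A) powr (1 - \<delta>)) \<longrightarrow>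
              real (additive_energy F A)
                < C * max (real (card A) powr (3 - \<delta>))
                          (real (card A) powr (3 + 1 / 33) / real q powr (1 / 33))))))
     \<and>
     (\<forall>(K::real) (L::real). K > 0 \<longrightarrow> L > 0 \<longrightarrow>
       (\<exists>C::real. C > 0 \<and>
         (\<forall>(p::nat) (m::nat) (q::nat) (F::'a ring) (A::'a set).
            Factorial_Ring.prime p \<longrightarrow> m \<ge> 1 \<longrightarrow> q = p ^ m \<longrightarrow>
            finite_field_of_order F q \<longrightarrow>
            A \<subseteq> carrier F \<longrightarrow>
            approx_with K (real (card (ratio_set F A))) (real (card A)) \<longrightarrow>
            (\<forall>G c. proper_subfield G F \<longrightarrow> c \<in> carrier F \<longrightarrow>
               real (card (A \<inter> (c <#\<^bsub>F\<^esub> G))) \<le> L * real (card G) powr (1 / 2)) \<longrightarrow>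
            real (additive_energy F A)
              < C * max (real (card A) powr (3 - 1 / 33))
                        (real (card A) powr (3 + 1 / 33) / real q powr (1 / 33)))))"
proof (rule conjI, goal_cases)
  case 1
  \<comment> \<open>The value \<open>lam = 1\<close> suffices, because \<open>C\<close> may depend on \<open>K\<close> and absorbs all other losses.\<close>
  show ?case
  proof (rule exI[of _ 1], intro conjI zero_less_one allI impI, goal_cases)
    case (1 K)
    define C where "C = energy_const (max 1 (2 * K) ^ (2 * 6 ^ 12))"
    have "0 \<le> C" by (simp add: C_def energy_const_def)
    then have pos: "0 < 8 + 8 * C" by simp
    show ?case
    proof (rule exI[of _ "8 + 8 * C"], intro conjI allI impI pos, goal_cases)
      case (1 \<delta> p m q F A)
      then show ?case
        by (intro energy_bound_if_coset_intersections_small[where K = K, folded C_def]) simp_all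
    qed
  qed
next
  case 2
  show ?case
  proof (intro allI impI, goal_cases)
    case (1 K L)
    define C where "C = energy_const (max 1 (2 * K) ^ (2 * 6 ^ 12))"
    have "0 \<le> C" by (simp add: C_def energy_const_def)
    then have pos: "0 < 8 + 8 * C + 8 * (C\<^sup>2 * L\<^sup>2)" by (auto intro!: add_pos_nonneg)
    show ?case
    proof (rule exI[of _ "8 + 8 * C + 8 * (C\<^sup>2 * L\<^sup>2)"], intro conjI allI impI pos, goal_cases)
      case (1 p m q F A)
      then show ?case
        by (intro energy_bound_if_coset_intersections_le_sqrt[where K = K and L = L, folded C_def]) simp_all
    qed
  qed
qed

end
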